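(* Let $G^N$ be the weighted Erdős–Rényi graph with weights $a_{ij}^N=w_{ij}^Nb_{ij}^N$, let $x^N(t)$ be the normalized global state of the local density-dependent Markov process on $G^N$, let $y^N(t)$ be its NIMFA approximation, and let $u(t)$ be the homogeneous mean-field approximation (all defined in the context). Assume that all rate functions $Q_{sk}$ are locally Lipschitz-continuous on $\mathbb{R}^S$ and that $x^N(0)\xrightarrow{p}u(0)$ and $y^N(0)\xrightarrow{p}u(0)$ as $N\to\infty$. Assume in addition that at least one of the following holds: (A) for all $s,k\in\mathcal{S}$, $Q_{sk}$ is globally Lipschitz continuous, and there are constants $c,\epsilon>0$ such that $\langle d\rangle\ge cN^{\frac12+\epsilon}$; or (B) $p^N\equiv 1$, and $\Lambda(s)=\log \mathbb{E}(\exp(s w_{12}^N))$ is finite for some $s>0$. Then for every $T>0$, $$\sup_{0\le t\le T}\left\|x^N(t)-u(t)\right\|\xrightarrow{p}0\qquad\text{and}\qquad \sup_{0\le t\le T}\left\|y^N(t)-u(t)\right\|\xrightarrow{p}0$$ as $N\to\infty$.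
   Context: $\xrightarrow{p}$ denotes convergence in probability; $\|\cdot\|=\|\cdot\|_1$ on $\mathbb{R}^S$. Graph: for each $N\ge2$, $G^N$ has vertices $1,\dots,N$ and random weights $a_{ij}^N=a_{ji}^N$, $a_{ii}^N=0$, and $a_{ij}^N=w_{ij}^Nb_{ij}^N$ for $i<j$, where all $w_{ij}^N,b_{ij}^N$ ($i<j$) are independent; the $w_{ij}^N$ are i.i.d. with a common distribution on $[0,\infty)$ that does not depend on $N$ and has finite mean $\mu>0$ and finite variance $\sigma^2$; the $b_{ij}^N$ are i.i.d. with values in $\{0,1\}$ and $\mathbb{P}(b_{ij}^N=1)=p^N\in(0,1]$, where $p^N$ may depend on $N$. Put $\langle d\rangle=(N-1)p^N\mu$ (the expected total weight at a vertex). Rates: the local state space is $\mathcal{S}=\{1,\dots,S\}$. For $k\ne s$, $Q_{ks}:\mathbb{R}^S\to\mathbb{R}$ is a rate function for the transition from state $s$ to state $k$ (being a rate, it is nonnegative on $[0,\infty)^S$), and $Q_{ss}:=-\sum_{k\ne s}Q_{ks}$. $Q(\phi)=(Q_{ks}(\phi))_{k,s=1}^S$ is the corresponding matrix. $\Delta=\{v\in\mathbb{R}^S: v_s\ge 0\ \forall s,\ \sum_s v_s=1\}$. Local density-dependent Markov process: each vertex $i$ has a local state in $\mathcal{S}$ at each time $t\ge0$; $\xi_{s,i}^N(t)$ is the indicator that vertex $i$ is in state $s$ at time $t$, and $\xi_i^N(t)=(\xi_{s,i}^N(t))_{s\in\mathcal{S}}$. Put $$\phi_i^N(t)=\frac{1}{\langle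 d\rangle}\sum_{j=1}^N a_{ij}^N\xi_j^N(t).$$ Conditionally on $G^N$, $(\xi_i^N(t))_{i=1}^N$ is a continuous-time Markov chain in which vertex $i$, when in state $s$, jumps to state $k\neq s$ at rate $Q_{ks}(\phi_i^N(t))$ (one vertex changing at a time). The normalized global state is $x^N(t)=\frac1N\sum_{i=1}^N\xi_i^N(t)$. Homogeneous mean-field approximation: $u(t)\in\Delta$ is the unique solution of $\frac{\mathrm d}{\mathrm dt}u(t)=Q(u(t))u(t)$ with initial condition $u(0)\in\Delta$. NIMFA: given $G^N$ and initial conditions $z_i^N(0)\in\Delta$, $i=1,\dots,N$, let $(z_i^N(t))_{i=1}^N$ be the solution of $$\dot z_i^N(t)=Q(\rho_i^N(t))z_i^N(t),\qquad \rho_i^N(t)=\frac1{\langle d\rangle}\sum_{j=1}^N a_{ij}^Nz_j^N(t),$$ which exists, is unique for all $t\ge 0$ and stays in $\Delta$; and $y^N(t)=\frac1N\sum_{i=1}^N z_i^N(t)$. *)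

theory Defs
  imports "HOL-Probability.Probability"
begin

section \<open>Convergence in probability to a constant\<close>

text \<open>
  The \<open>n\<close>-th variable lives on its own probability space \<open>M n\<close>. Measurability is part of the
  notion, because \<^const>\<open>measure\<close> vanishes on sets that are not measurable.
\<close>

definition tendsto_in_prob ::
    "(nat \<Rightarrow> 'w measure) \<Rightarrow> (nat \<Rightarrow> 'w \<Rightarrow> 'b::metric_space) \<Rightarrow> 'b \<Rightarrow> bool" where
  "tendsto_in_prob M X c \<longleftrightarrow>
     (\<forall>\<^sub>F n in sequentially. X n \<in> borel_measurable (M n)) \<and>
     (\<forall>\<epsilon>>0. (\<lambda>n. measure (M n) {\<omega> \<in> space (M n). dist (X n \<omega>) c > \<epsilon>}) \<longlonglongrightarrow> 0)"


section \<open>Local states and rates\<close>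

text \<open>The local states are the elements of a finite type \<open>'s\<close>.\<close>

definition norm1 :: "real^'s \<Rightarrow> real" where
  "norm1 v = (\<Sum>s\<in>UNIV. \<bar>v $ s\<bar>)"

definition Delta :: "(real^'s) set" where
  "Delta = {v. (\<forall>s. 0 \<le> v $ s) \<and> (\<Sum>s\<in>UNIV. v $ s) = 1}"

text \<open>
  The entry \<open>Q \<phi> $ k $ s\<close> (row \<open>k\<close>, column \<open>s\<close>) is the rate of the transition from \<open>s\<close> to \<open>k\<close>.
\<close>

definition rate_function :: "(real^'s \<Rightarrow> real^'s^'s) \<Rightarrow> bool" where
  "rate_function Q \<longleftrightarrow>
     (\<forall>\<phi> s. Q \<phi> $ s $ s = - (\<Sum>k\<in>UNIV - {s}. Q \<phi> $ k $ s)) \<and>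
     (\<forall>\<phi> k s. k \<noteq> s \<longrightarrow> (\<forall>r. 0 \<le> \<phi> $ r) \<longrightarrow> 0 \<le> Q \<phi> $ k $ s)"

definition locally_lipschitz :: "('a::metric_space \<Rightarrow> real) \<Rightarrow> bool" where
  "locally_lipschitz f \<longleftrightarrow> (\<forall>x. \<exists>r>0. \<exists>L. L-lipschitz_on (cball x r) f)"

definition globally_lipschitz :: "('a::metric_space \<Rightarrow> real) \<Rightarrow> bool" where
  "globally_lipschitz f \<longleftrightarrow> (\<exists>L. L-lipschitz_on UNIV f)"


section \<open>The weighted Erdos--Renyi graph\<close>

definition weight_law :: "real measure \<Rightarrow> bool" where
  "weight_law D \<longleftrightarrow>
     prob_space D \<and> sets D = sets borel \<and> (AE x in D. 0 \<le> x) \<and>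
     integrable D (\<lambda>x. x) \<and> 0 < (\<integral>x. x \<partial>D) \<and>
     integrable D (\<lambda>x. (x - (\<integral>y. y \<partial>D))\<^sup>2)"

definition vertex_pairs :: "nat \<Rightarrow> (nat \<times> nat) set" where
  "vertex_pairs N = {(i, j). i \<in> {1..N} \<and> j \<in> {1..N} \<and> i < j}"

definition weighted_ER ::
    "'w measure \<Rightarrow> real measure \<Rightarrow> real \<Rightarrow> nat \<Rightarrow>
     (nat \<Rightarrow> nat \<Rightarrow> 'w \<Rightarrow> real) \<Rightarrow> (nat \<Rightarrow> nat \<Rightarrow> 'w \<Rightarrow> real) \<Rightarrow> bool" where
  "weighted_ER M D p N w b \<longleftrightarrow>
     prob_space.indep_vars M (\<lambda>_. borel)
       (case_sum (\<lambda>(i, j). w i j) (\<lambda>(i, j). b i j)) (vertex_pairs N <+> vertex_pairs N) \<and>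
     (\<forall>(i, j) \<in> vertex_pairs N.
        distr M borel (w i j) = D \<and>
        measure M {\<omega> \<in> space M. b i j \<omega> = 1} = p \<and>
        (\<forall>\<omega> \<in> space M. 0 \<le> w i j \<omega> \<and> b i j \<omega> \<in> {0, 1}))"

definition edge_weight ::
    "(nat \<Rightarrow> nat \<Rightarrow> 'w \<Rightarrow> real) \<Rightarrow> (nat \<Rightarrow> nat \<Rightarrow> 'w \<Rightarrow> real) \<Rightarrow> nat \<Rightarrow> nat \<Rightarrow> 'w \<Rightarrow> real" where
  "edge_weight w b i j \<omega> =
     (if i < j then w i j \<omega> * b i j \<omega> else if j < i then w j i \<omega> * b j i \<omega> else 0)"

definition mean_degree :: "real measure \<Rightarrow> real \<Rightarrow> nat \<Rightarrow> real" where
  "mean_degree D p N = (real N - 1) * p * (\<integral>x. x \<partial>D)"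

definition graph_algebra :: "'w measure \<Rightarrow> nat \<Rightarrow> (nat \<Rightarrow> nat \<Rightarrow> 'w \<Rightarrow> real) \<Rightarrow> 'w measure" where
  "graph_algebra M N a =
     sigma (space M) {a i j -` B \<inter> space M |i j B. i \<in> {1..N} \<and> j \<in> {1..N} \<and> B \<in> sets borel}"


section \<open>Finite-state Markov chains with a random generator\<close>

text \<open>
  On the finite state space \<open>E\<close> with generator \<open>L\<close> (\<open>L x y\<close> is the rate from \<open>x\<close> to \<open>y\<close>),
  \<open>transition_prob E L t\<close> is the matrix exponential of \<open>t * L\<close>.
\<close>

fun matrix_power_on :: "'c set \<Rightarrow> ('c \<Rightarrow> 'c \<Rightarrow> real) \<Rightarrow> nat \<Rightarrow> 'c \<Rightarrow> 'c \<Rightarrow> real" where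
  "matrix_power_on E L 0 x y = (if x = y then 1 else 0)"
| "matrix_power_on E L (Suc n) x y = (\<Sum>v\<in>E. L x v * matrix_power_on E L n v y)"

definition transition_prob :: "'c set \<Rightarrow> ('c \<Rightarrow> 'c \<Rightarrow> real) \<Rightarrow> real \<Rightarrow> 'c \<Rightarrow> 'c \<Rightarrow> real" where
  "transition_prob E L t x y = (\<Sum>n. t ^ n / fact n * matrix_power_on E L n x y)"

text \<open>The information contained in \<open>G\<close> and in the path of \<open>X\<close> up to time \<open>s\<close>.\<close>

definition history :: "'w measure \<Rightarrow> 'w measure \<Rightarrow> (real \<Rightarrow> 'w \<Rightarrow> 'c) \<Rightarrow> real \<Rightarrow> 'w measure" where
  "history M G X s =
     sigma (space M) (sets G \<union> {X r -` B \<inter> space M |r B. r \<in> {0..s}})"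

text \<open>
  Conditionally on the sub-\<open>\<sigma>\<close>-algebra \<open>G\<close>, the process \<open>X\<close> is a right-continuous Markov chain on
  the finite set \<open>E\<close> with the (\<open>G\<close>-measurable) generator \<open>L \<omega>\<close>; its initial distribution is
  arbitrary and may depend on \<open>G\<close>.
\<close>

definition conditional_markov_chain ::
    "'w measure \<Rightarrow> 'w measure \<Rightarrow> 'c set \<Rightarrow> ('w \<Rightarrow> 'c \<Rightarrow> 'c \<Rightarrow> real) \<Rightarrow> (real \<Rightarrow> 'w \<Rightarrow> 'c) \<Rightarrow> bool" where
  "conditional_markov_chain M G E L X \<longleftrightarrow>
     (\<forall>t\<ge>0. X t \<in> M \<rightarrow>\<^sub>M count_space E) \<and>
     (\<forall>\<omega>\<in>space M. \<forall>t\<ge>0. \<exists>\<delta>>0. \<forall>r\<in>{t..<t + \<delta>}. X r \<omega> = X t \<omega>) \<and>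
     (\<forall>s\<ge>0. \<forall>t\<ge>0. \<forall>y\<in>E. AE \<omega> in M.
        real_cond_exp M (history M G X s) (indicat_real {\<omega>\<in>space M. X (s + t) \<omega> = y}) \<omega> =
        transition_prob E (L \<omega>) t (X s \<omega>) y)"


section \<open>The local density-dependent Markov process\<close>

definition local_density ::
    "nat \<Rightarrow> real \<Rightarrow> (nat \<Rightarrow> nat \<Rightarrow> real) \<Rightarrow> (nat \<Rightarrow> real^'s) \<Rightarrow> nat \<Rightarrow> real^'s" where
  "local_density N d a v i = (1 / d) *\<^sub>R (\<Sum>j\<in>{1..N}. a i j *\<^sub>R v j)"

definition average :: "nat \<Rightarrow> (nat \<Rightarrow> real^'s) \<Rightarrow> real^'s" where
  "average N v = (1 / real N) *\<^sub>R (\<Sum>i\<in>{1..N}. v i)"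

text \<open>
  A configuration assigns a local state to each vertex; the vector of indicators of the state of
  vertex \<open>i\<close> is \<open>state_indicator \<eta> i\<close>.
\<close>

definition configs :: "nat \<Rightarrow> (nat \<Rightarrow> 's) set" where
  "configs N = {1..N} \<rightarrow>\<^sub>E UNIV"

definition state_indicator :: "(nat \<Rightarrow> 's) \<Rightarrow> nat \<Rightarrow> real^'s" where
  "state_indicator \<eta> i = axis (\<eta> i) 1"

text \<open>
  For \<open>\<eta>' \<noteq> \<eta>\<close> at most one summand of the jump rate is nonzero: the one for the vertex \<open>i\<close> at which
  the configurations differ and its new state \<open>k\<close>, if there is exactly one such vertex.
\<close>

definition jump_rate ::
    "(real^'s \<Rightarrow> real^'s^'s) \<Rightarrow> nat \<Rightarrow> real \<Rightarrow> (nat \<Rightarrow> nat \<Rightarrow> real) \<Rightarrow>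
     (nat \<Rightarrow> 's) \<Rightarrow> (nat \<Rightarrow> 's) \<Rightarrow> real" where
  "jump_rate Q N d a \<eta> \<eta>' =
     (\<Sum>i\<in>{1..N}. \<Sum>k\<in>UNIV - {\<eta> i}.
        if \<eta>' = \<eta>(i := k) then Q (local_density N d a (state_indicator \<eta>) i) $ k $ \<eta> i else 0)"

definition generator ::
    "(real^'s \<Rightarrow> real^'s^'s) \<Rightarrow> nat \<Rightarrow> real \<Rightarrow> (nat \<Rightarrow> nat \<Rightarrow> real) \<Rightarrow>
     (nat \<Rightarrow> 's) \<Rightarrow> (nat \<Rightarrow> 's) \<Rightarrow> real" where
  "generator Q N d a \<eta> \<eta>' =
     (if \<eta> = \<eta>' then - (\<Sum>\<zeta>\<in>configs N - {\<eta>}. jump_rate Q N d a \<eta> \<zeta>)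
      else jump_rate Q N d a \<eta> \<eta>')"

definition local_density_process ::
    "'w measure \<Rightarrow> (real^'s \<Rightarrow> real^'s^'s) \<Rightarrow> nat \<Rightarrow> real \<Rightarrow> (nat \<Rightarrow> nat \<Rightarrow> 'w \<Rightarrow> real) \<Rightarrow>
     (real \<Rightarrow> 'w \<Rightarrow> nat \<Rightarrow> 's) \<Rightarrow> bool" where
  "local_density_process M Q N d a X \<longleftrightarrow>
     conditional_markov_chain M (graph_algebra M N a) (configs N)
       (\<lambda>\<omega>. generator Q N d (\<lambda>i j. a i j \<omega>)) X"


section \<open>Mean-field approximations\<close>

definition mean_field_solution ::
    "(real^'s \<Rightarrow> real^'s^'s) \<Rightarrow> (real \<Rightarrow> real^'s) \<Rightarrow> bool" where
  "mean_field_solution Q u \<longleftrightarrow>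
     (\<forall>t\<ge>0. u t \<in> Delta \<and> (u has_vector_derivative Q (u t) *v u t) (at t within {0..}))"

definition NIMFA_solution ::
    "(real^'s \<Rightarrow> real^'s^'s) \<Rightarrow> nat \<Rightarrow> real \<Rightarrow> (nat \<Rightarrow> nat \<Rightarrow> real) \<Rightarrow>
     (real \<Rightarrow> nat \<Rightarrow> real^'s) \<Rightarrow> bool" where
  "NIMFA_solution Q N d a z \<longleftrightarrow>
     (\<forall>t\<ge>0. \<forall>i\<in>{1..N}. z t i \<in> Delta \<and>
        ((\<lambda>r. z r i) has_vector_derivative Q (local_density N d a (z t) i) *v z t i)
          (at t within {0..}))"

end

theory Submission
  imports Defs
begin

text \<open>
  Everything about the graph that matters is the number
  \<open>W = (1/N) \<Sum>\<^sub>j\<^sub>k |\<Sum>\<^sub>i c\<^sub>i\<^sub>j c\<^sub>i\<^sub>k|\<close>, where \<open>c\<close> is the centred and rescaled weight matrix. It bounds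
  the quadratic form of \<open>c\<^sup>T c\<close> on \<open>[-1,1]\<^sup>N\<close>, so for any assignment of vectors in \<open>Delta\<close> to the vertices,
  even one depending on the graph, the local density of most vertices is within \<open>O(\<surd>W + 1/N)\<close> of the
  global average, and all but \<open>W N\<close> vertices are good: they have at most twice the mean degree. By
  pairwise orthogonality of the products of edge weights, \<open>E W = O(\<surd>N / d)\<close>, which tends to \<open>0\<close> in both cases.
  The rates at the good vertices are evaluated in a fixed compact set only, hence are Lipschitz there. The
  bad vertices change averages by at most \<open>W\<close>, whatever their rates.

  The average of NIMFA over the good vertices then satisfies a perturbed mean-field equation,
  and Gronwall's inequality applies. For the Markov chain, the squared distance between the average over
  the good vertices and \<open>u\<close>, observed on a grid of mesh \<open>h\<close>, is a supermartingale up to a factor \<open>1 + O(h)\<close>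
  and an error \<open>h (O(W) + O(1/N)) + O(h\<^sup>2)\<close>; a maximal inequality on dyadic grids and
  right-continuity of the paths give the supremum.
\<close>

section \<open>Rates on compact sets\<close>

text \<open>Off the diagonal, an entry of \<open>c\<^sup>T c\<close> is a sum of products of two
  distinct independent edges: its second moment needs second moments only, and orthogonality gives a
  mean absolute value of order \<open>sqrt N\<close> instead of \<open>N\<close> times one variance.
  Diagonal entries are sums of squares and get a first-moment bound without cancellation, which is
  enough for \<open>N\<close> of the \<open>N * N\<close> entries. Secondly, the rates at bad
  vertices admit no bound uniform in \<open>N\<close>. The good set is fixed by the graph, so jumps
  elsewhere do not move the observed average; their rates enter only through a bound
  \<open>R\<close> on the whole generator, in the second-order error of a time step. Hence the order
  of limits: the mesh tends to 0 with \<open>R\<close> and \<open>N\<close> fixed, then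
  \<open>R\<close> tends to infinity, then \<open>N\<close>, and the tolerance
  \<open>\<delta>\<close> makes the remaining bound small. Squared distances are used because the
  generator turns them into a drift term plus a jump variance of order \<open>1 / N\<close>.\<close>

lemma recursive_bound:
  fixes e :: "nat \<Rightarrow> real"
  assumes "0 \<le> c" "0 \<le> \<gamma>" "0 \<le> e 0"
    and "\<And>k. k < m \<Longrightarrow> e (Suc k) \<le> (1 + c) * e k + \<gamma>"
  shows "e m \<le> exp (c * real m) * (e 0 + real m * \<gamma>)"
proof -
  \<comment> \<open>Every error \<open>\<gamma>\<close> is charged the full growth factor, late ones
    included; this gives the bound its product form.\<close>
  have "k \<le> m \<Longrightarrow> e k \<le> (1 + c) ^ k * (e 0 + real k * \<gamma>)" for k
  proof (induction k)
    case (Suc k)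
    have "\<gamma> \<le> (1 + c) ^ Suc k * \<gamma>"
      using assms(1,2) by (metis add_increasing2 le_add_same_cancel1 mult_right_mono mult_1 one_le_power order_refl)
    have "e (Suc k) \<le> (1 + c) * e k + \<gamma>"
      using Suc assms(4) by simp
    also have "\<dots> \<le> (1 + c) * ((1 + c) ^ k * (e 0 + real k * \<gamma>)) + (1 + c) ^ Suc k * \<gamma>"
      using Suc assms(1) \<open>\<gamma> \<le> _\<close> by (intro add_mono mult_left_mono) auto
    finally show ?case
      by (simp add: algebra_simps)
  qed auto
  then have "e m \<le> (1 + c) ^ m * (e 0 + real m * \<gamma>)"
    by simp
  also have "\<dots> \<le> exp (c * real m) * (e 0 + real m * \<gamma>)"
  proof (intro mult_right_mono)
    have "(1 + c) ^ m \<le> exp c ^ m"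
      using assms(1) by (intro power_mono) auto
    then show "(1 + c) ^ m \<le> exp (c * real m)"
      by (simp add: exp_of_nat2_mult)
  qed (use assms in auto)
  finally show ?thesis .
qed

lemma norm_matrix_vector_le:
  fixes A :: "real^'n^'m"
  assumes "\<And>i j. \<bar>A $ i $ j\<bar> \<le> B"
  shows "norm (A *v x) \<le> real CARD('m) * real CARD('n) * B * norm x"
proof -
  have "\<bar>(A *v x) $ i\<bar> \<le> real CARD('n) * B * norm x" for i
  proof -
    have "\<bar>(A *v x) $ i\<bar> \<le> (\<Sum>j\<in>UNIV. \<bar>A $ i $ j * x $ j\<bar>)"
      by (simp add: matrix_vector_mult_def)
    also have "\<dots> \<le> (\<Sum>j\<in>(UNIV::'n set). B * norm x)"
      by (intro sum_mono) (simp add: abs_mult assms component_le_norm_cart mult_mono')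
    finally show ?thesis by simp
  qed
  then have "(\<Sum>i\<in>UNIV. \<bar>(A *v x) $ i\<bar>) \<le> (\<Sum>i\<in>(UNIV::'m set). real CARD('n) * B * norm x)"
    by (intro sum_mono) auto
  then show ?thesis
    using norm_le_l1_cart[of "A *v x"] by (simp add: algebra_simps)
qed

lemma norm1_le: "norm1 (v :: real^'s) \<le> real CARD('s) * norm v"
proof -
  have "norm1 v \<le> (\<Sum>s\<in>(UNIV :: 's set). norm v)"
    unfolding norm1_def by (intro sum_mono component_le_norm_cart)
  then show ?thesis by simp
qed

lemma Delta_norm_le: "v \<in> Delta \<Longrightarrow> norm v \<le> 1"
  using norm_le_l1_cart[of v] by (simp add: Delta_def)

lemma Delta_component: "v \<in> Delta \<Longrightarrow> 0 \<le> v $ s \<and> v $ s \<le> 1"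
  using member_le_sum[of s UNIV "\<lambda>s. v $ s"] by (simp add: Delta_def)

lemma axis_in_Delta: "axis s 1 \<in> (Delta :: (real^'s) set)"
  by (simp add: Delta_def axis_def)

lemma Delta_subset_cbox: "1 \<le> r \<Longrightarrow> Delta \<subseteq> cbox 0 (vec r :: real^'s)"
proof
  fix v :: "real^'s" assume r: "1 \<le> r" and v: "v \<in> Delta"
  have "v $ s \<le> r" for s
    using Delta_component[OF v, of s] r by linarith
  then show "v \<in> cbox 0 (vec r)"
    using Delta_component[OF v] by (simp add: mem_box_cart)
qed

text \<open>One constant serves as entry bound, operator bound and Lipschitz bound on the cube of
  side \<open>r\<close>. At a vertex of degree at most \<open>r * d\<close> the local density lies
  in this cube. The value 2 belongs to the good vertices; other values occur only in the Euler
  scheme for a single graph.\<close>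

definition rate_bound :: "(real^'s \<Rightarrow> real^'s^'s) \<Rightarrow> real \<Rightarrow> real \<Rightarrow> bool" where
  "rate_bound Q r C \<longleftrightarrow> 0 \<le> C \<and>
     (\<forall>\<phi>\<in>cbox 0 (vec r). (\<forall>k s. \<bar>Q \<phi> $ k $ s\<bar> \<le> C) \<and> (\<forall>v. norm (Q \<phi> *v v) \<le> C * norm v)) \<and>
     (\<forall>\<phi>\<in>cbox 0 (vec r). \<forall>\<psi>\<in>cbox 0 (vec r). \<forall>v.
        norm (Q \<phi> *v v - Q \<psi> *v v) \<le> C * norm (\<phi> - \<psi>) * norm v)"

text \<open>Compactness of the cube turns local Lipschitz continuity of the finitely many entries
  into one common constant.\<close>

lemma rate_bound_exists:
  fixes Q :: "real^'s \<Rightarrow> real^'s^'s"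
  assumes "\<And>k s. locally_lipschitz (\<lambda>\<phi>. Q \<phi> $ k $ s)"
  shows "\<exists>C. rate_bound Q r C"
proof -
  let ?K = "cbox 0 (vec r) :: (real^'s) set"
  let ?S = "real CARD('s)"
  have "\<exists>L. L-lipschitz_on ?K (\<lambda>\<phi>. Q \<phi> $ k $ s)" for k s
  proof -
    let ?f = "\<lambda>\<phi>. Q \<phi> $ k $ s"
    \<comment> \<open>\<open>local_lipschitz\<close> concerns families of maps indexed by time; the
      one-point time set makes the family a single map.\<close>
    have "local_lipschitz {0::real} ?K (\<lambda>_. ?f)"
      unfolding local_lipschitz_def
    proof safe
      fix x :: "real^'s" assume "x \<in> ?K"
      obtain \<epsilon> L where "\<epsilon> > 0" "L-lipschitz_on (cball x \<epsilon>) ?f"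
        using assms[of k s] unfolding locally_lipschitz_def by blast
      then show "\<exists>u>0. \<exists>L. \<forall>t\<in>cball 0 u \<inter> {0}. L-lipschitz_on (cball x u \<inter> ?K) ?f"
        by (meson inf_le1 lipschitz_on_subset)
    qed
    then obtain L where "\<And>t. t \<in> {0::real} \<Longrightarrow> L-lipschitz_on ?K ?f"
      using local_lipschitz_compact_implies_lipschitz[of "{0::real}" ?K "\<lambda>_. ?f"]
      by (metis compact_cbox compact_sing continuous_on_const)
    then show ?thesis by blast
  qed
  then obtain L where L: "\<And>k s. (L k s)-lipschitz_on ?K (\<lambda>\<phi>. Q \<phi> $ k $ s)"
    by metis
  have Lnn: "0 \<le> L k s" for k s
    using L lipschitz_on_nonneg by blast
  have "bounded ((\<lambda>\<phi>. Q \<phi> $ k $ s) ` ?K)" for k s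
    using compact_continuous_image[OF lipschitz_on_continuous_on[OF L] compact_cbox]
      compact_imp_bounded by blast
  then have "\<exists>B. \<forall>\<phi>\<in>?K. \<bar>Q \<phi> $ k $ s\<bar> \<le> B" for k s
    unfolding bounded_iff by force
  then obtain B where B: "\<And>k s \<phi>. \<phi> \<in> ?K \<Longrightarrow> \<bar>Q \<phi> $ k $ s\<bar> \<le> B k s"
    by metis
  \<comment> \<open>The sum dominates every single Lipschitz constant and bound. Passing from
    entries to operators then costs the factor \<open>?S * ?S\<close>.\<close>
  define D where "D = (\<Sum>k\<in>UNIV. \<Sum>s\<in>UNIV. L k s + \<bar>B k s\<bar>)"
  have le: "L k s + \<bar>B k s\<bar> \<le> D" for k s
  proof -
    have "L k s + \<bar>B k s\<bar> \<le> (\<Sum>s\<in>UNIV. L k s + \<bar>B k s\<bar>)"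
      by (intro member_le_sum[where f="\<lambda>s. L k s + \<bar>B k s\<bar>"]) (auto simp: Lnn)
    also have "\<dots> \<le> D" unfolding D_def
      by (intro member_le_sum[where f="\<lambda>k. \<Sum>s\<in>UNIV. L k s + \<bar>B k s\<bar>"]) (auto simp: Lnn sum_nonneg)
    finally show ?thesis .
  qed
  have D0: "0 \<le> D" unfolding D_def by (auto simp: Lnn sum_nonneg)
  have "1 \<le> ?S * ?S" by (simp add: Suc_leI flip: of_nat_mult)
  then have DS: "D \<le> ?S * ?S * D"
    using D0 mult_right_mono by fastforce
  have Qle: "\<bar>Q \<phi> $ k $ s\<bar> \<le> D" if "\<phi> \<in> ?K" for \<phi> k s
    using B[OF that, of k s] le[of k s] Lnn[of k s] by linarith
  have lip: "\<bar>(Q \<phi> - Q \<psi>) $ k $ s\<bar> \<le> D * norm (\<phi> - \<psi>)" if "\<phi> \<in> ?K" "\<psi> \<in> ?K" for \<phi> \<psi> k s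
  proof -
    have "\<bar>(Q \<phi> - Q \<psi>) $ k $ s\<bar> \<le> L k s * norm (\<phi> - \<psi>)"
      using lipschitz_onD[OF L that, of k s] by (simp add: dist_norm)
    also have "\<dots> \<le> D * norm (\<phi> - \<psi>)"
      using le[of k s] by (intro mult_right_mono) auto
    finally show ?thesis .
  qed
  have "rate_bound Q r (?S * ?S * D)"
    unfolding rate_bound_def
  proof (intro conjI ballI allI)
    fix \<phi> \<psi> v :: "real^'s" assume "\<phi> \<in> ?K" "\<psi> \<in> ?K"
    then show "norm (Q \<phi> *v v - Q \<psi> *v v) \<le> ?S * ?S * D * norm (\<phi> - \<psi>) * norm v"
      using norm_matrix_vector_le[of "Q \<phi> - Q \<psi>" "D * norm (\<phi> - \<psi>)" v] lip
      by (simp add: matrix_vector_mult_diff_rdistrib mult.assoc)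
  next
    fix \<phi> v :: "real^'s" assume "\<phi> \<in> ?K"
    then show "norm (Q \<phi> *v v) \<le> ?S * ?S * D * norm v"
      using norm_matrix_vector_le[of "Q \<phi>" D v] Qle by simp
  next
    fix \<phi> :: "real^'s" and k s assume "\<phi> \<in> ?K"
    then show "\<bar>Q \<phi> $ k $ s\<bar> \<le> ?S * ?S * D"
      using Qle DS order_trans by blast
  qed (use D0 in simp)
  then show ?thesis ..
qed

lemma rate_boundD:
  assumes "rate_bound Q r C"
  shows "0 \<le> C" and "\<phi> \<in> cbox 0 (vec r) \<Longrightarrow> \<bar>Q \<phi> $ k $ s\<bar> \<le> C"
    and "\<phi> \<in> cbox 0 (vec r) \<Longrightarrow> norm (Q \<phi> *v v) \<le> C * norm v"
    and "\<phi> \<in> cbox 0 (vec r) \<Longrightarrow> \<psi> \<in> cbox 0 (vec r) \<Longrightarrow>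
      norm (Q \<phi> *v v - Q \<psi> *v v) \<le> C * norm (\<phi> - \<psi>) * norm v"
  using assms unfolding rate_bound_def by simp_all

text \<open>The change of the vector is split off from the change of the matrix. Only the second
  vector has to be bounded: by 1 on \<open>Delta\<close>, by the number of states after
  clipping.\<close>

lemma rate_field_lipschitz:
  assumes "rate_bound Q r C" "\<phi> \<in> cbox 0 (vec r)" "\<psi> \<in> cbox 0 (vec r)" "norm w \<le> B"
  shows "norm (Q \<phi> *v v - Q \<psi> *v w) \<le> C * norm (v - w) + C * B * norm (\<phi> - \<psi>)"
proof -
  have eq: "Q \<phi> *v v - Q \<psi> *v w = Q \<phi> *v (v - w) + (Q \<phi> *v w - Q \<psi> *v w)"
    by (simp add: matrix_vector_mult_diff_distrib)
  have "norm (Q \<phi> *v w - Q \<psi> *v w) \<le> C * norm (\<phi> - \<psi>) * B"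
    using rate_boundD(1)[OF assms(1)] rate_boundD(4)[OF assms(1-3), of w]
    by (meson assms(4) mult_left_mono norm_ge_zero order_trans mult_nonneg_nonneg)
  then show ?thesis
    unfolding eq using rate_boundD(3)[OF assms(1,2), of "v - w"]
      norm_triangle_ineq[of "Q \<phi> *v (v - w)" "Q \<phi> *v w - Q \<psi> *v w"]
    by (simp add: mult_ac)
qed

text \<open>The remainder after the tangent at the left end. It is applied with \<open>B\<close>
  proportional to \<open>h\<close>, so that one step errs by order \<open>h\<^sup>2\<close>.\<close>

lemma euler_step_error:
  fixes f :: "real \<Rightarrow> 'b::real_normed_vector"
  assumes "\<And>s. 0 \<le> s \<Longrightarrow> (f has_vector_derivative f' s) (at s within {0..})"
    and "0 \<le> t" "0 \<le> h" "\<And>s. t \<le> s \<Longrightarrow> s \<le> t + h \<Longrightarrow> norm (f' s - f' t) \<le> B"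
  shows "norm (f (t + h) - f t - h *\<^sub>R f' t) \<le> B * h"
proof -
  have "norm (f (t + h) - f t - (t + h - t) *\<^sub>R f' t) \<le> norm (t + h - t) * B"
  proof (rule vector_differentiable_bound_linearization[where S="{t..t+h}"])
    show "(f has_vector_derivative f' s) (at s within {t..t + h})" if "s \<in> {t..t + h}" for s
      using that assms(1)[of s] assms(2) by (auto intro!: has_vector_derivative_within_subset[of f "f' s" s "{0..}" "{t..t + h}"])
  qed (use assms in \<open>auto simp: closed_segment_eq_real_ivl\<close>)
  then show ?thesis using assms(3) by (simp add: mult.commute)
qed

lemma vector_derivative_lipschitz:
  fixes f :: "real \<Rightarrow> 'b::real_normed_vector"
  assumes "\<And>s. 0 \<le> s \<Longrightarrow> (f has_vector_derivative f' s) (at s within {0..})"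
    and "0 \<le> t" "0 \<le> h" "\<And>s. 0 \<le> s \<Longrightarrow> norm (f' s) \<le> B"
  shows "norm (f (t + h) - f t) \<le> B * h"
proof -
  have "norm (f (t + h) - f t) \<le> B * norm (t + h - t)"
  proof (rule differentiable_bound[where S="{0..}" and f'="\<lambda>s h. h *\<^sub>R f' s"])
    show "(f has_derivative (\<lambda>h. h *\<^sub>R f' s)) (at s within {0..})" if "s \<in> {0..}" for s
      using assms(1)[of s] that by (simp add: has_vector_derivative_def)
    show "onorm (\<lambda>h. h *\<^sub>R f' s) \<le> B" if "s \<in> {0..}" for s
      using assms(4)[of s] that by (simp add: onorm_scaleR_left onorm_id bounded_linear_ident)
  qed (use assms in auto)
  then show ?thesis using assms(3) by simp
qed

text \<open>Bounds the mean distance of the local densities from the global average, plus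
  \<open>W\<close> for restricting that average to good vertices. \<open>c\<close> is the number of
  local states, since coordinates are treated one by one; \<open>2 / N\<close> pays for the missing
  loops.\<close>

definition mf_error :: "real \<Rightarrow> nat \<Rightarrow> real \<Rightarrow> real" where
  "mf_error c N W = c * (sqrt W + 2 / real N) + W"

section \<open>Mean-field estimates on a fixed weighted graph\<close>

text \<open>The function \<open>exp (- (K * s)) * (f s + b)\<close> has nonpositive
  derivative.\<close>

lemma gronwall_scalar:
  fixes f :: "real \<Rightarrow> real"
  assumes deriv: "\<And>s. 0 \<le> s \<Longrightarrow> (f has_real_derivative f' s) (at s within {0..})"
    and le: "\<And>s. 0 \<le> s \<Longrightarrow> f' s \<le> K * (f s + b)" and "0 \<le> t"
  shows "f t + b \<le> exp (K * t) * (f 0 + b)"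
proof -
  define g where "g s = exp (- (K * s)) * (f s + b)" for s
  define g' where "g' s = exp (- (K * s)) * (f' s - K * (f s + b))" for s
  have gd: "(g has_real_derivative g' s) (at s within {0..})" if "0 \<le> s" for s
    unfolding g_def g'_def by (auto intro!: derivative_eq_intros deriv that simp: algebra_simps)
  have "g t \<le> g 0"
  proof (cases "t = 0")
    case False
    then have "0 < t" using assms by simp
    have "continuous_on {0..} g"
      unfolding continuous_on_eq_continuous_within
      using gd by (auto intro: DERIV_continuous)
    then have "continuous_on {0..t} g"
      by (rule continuous_on_subset) auto
    \<comment> \<open>At 0 the derivative is one-sided, hence the monotonicity criterion on the open
      interval together with continuity up to the ends.\<close>
    moreover have "\<exists>y. (g has_real_derivative y) (at x) \<and> y \<le> 0" if "0 < x" "x < t" for x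
    proof (intro exI conjI)
      have "(g has_real_derivative g' x) (at x within {0<..})"
        using gd[of x] that by (auto intro: DERIV_subset)
      then show "(g has_real_derivative g' x) (at x)"
        using that by (simp add: at_within_open[of x "{0<..}"])
      show "g' x \<le> 0"
        unfolding g'_def using le[of x] that by (intro mult_nonneg_nonpos) auto
    qed
    ultimately show ?thesis
      using DERIV_nonpos_imp_decreasing_open[of 0 t g] \<open>0 < t\<close> by auto
  qed simp
  then show ?thesis
    by (simp add: g_def exp_minus field_simps)
qed

section \<open>Discrepancy and good vertices of a weighted graph\<close>

locale weighted_graph =
  fixes N :: nat and d :: real and a :: "nat \<Rightarrow> nat \<Rightarrow> real"
  assumes N2: "2 \<le> N" and d_pos: "0 < d" and a_nonneg: "\<And>i j. i \<in> {1..N} \<Longrightarrow> j \<in> {1..N} \<Longrightarrow> 0 \<le> a i j"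
    and a_diag: "\<And>i. a i i = 0"
begin

text \<open>If \<open>d\<close> is the mean degree of the random graph, \<open>1 / (N - 1)\<close>
  is the mean of \<open>a i j / d\<close> for \<open>i \<noteq> j\<close>. The diagonal vanishes
  because there are no loops.\<close>

definition centered :: "nat \<Rightarrow> nat \<Rightarrow> real" where
  "centered i j = (if i = j then 0 else a i j / d - 1 / (real N - 1))"

definition discrepancy :: real where
  "discrepancy = (\<Sum>j\<in>{1..N}. \<Sum>k\<in>{1..N}. \<bar>\<Sum>i\<in>{1..N}. centered i j * centered i k\<bar>) / real N"

text \<open>Beyond the threshold \<open>2 * d\<close> the centred row sum exceeds 1, which is what
  \<open>card_not_good_le\<close> counts; below it the local density stays in the cube of side
  2.\<close>

definition good :: "nat set" where
  "good = {i\<in>{1..N}. (\<Sum>j\<in>{1..N}. a i j) \<le> 2 * d}"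

text \<open>The divisor is \<open>N\<close> and not the number of good vertices: the distance to
  \<open>average\<close> is then at most the fraction of bad vertices, and a jump has size of order
  \<open>1 / N\<close>. For states in \<open>Delta\<close> the coordinates may sum to less than 1,
  so the value can lie outside \<open>Delta\<close>.\<close>

definition good_average :: "(nat \<Rightarrow> real^'s) \<Rightarrow> real^'s" where
  "good_average v = (1 / real N) *\<^sub>R (\<Sum>i\<in>good. v i)"

text \<open>Both the time derivative of \<open>good_average\<close> along NIMFA and its
  infinitesimal mean change under the Markov chain, so that one estimate serves both
  processes.\<close>

definition good_drift :: "(real^'s \<Rightarrow> real^'s^'s) \<Rightarrow> (nat \<Rightarrow> real^'s) \<Rightarrow> real^'s" where
  "good_drift Q v = (1 / real N) *\<^sub>R (\<Sum>i\<in>good. Q (local_density N d a v i) *v v i)"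

lemma discrepancy_nonneg: "0 \<le> discrepancy"
  unfolding discrepancy_def by (intro divide_nonneg_nonneg sum_nonneg) auto

lemma good_subset: "good \<subseteq> {1..N}" and finite_good: "finite good"
  by (auto simp: good_def)

lemma quadratic_form_le:
  assumes "\<And>j. j \<in> {1..N} \<Longrightarrow> \<bar>v j\<bar> \<le> 1"
  shows "(\<Sum>i\<in>{1..N}. (\<Sum>j\<in>{1..N}. centered i j * v j)\<^sup>2) \<le> real N * discrepancy"
proof -
  have "(\<Sum>i\<in>{1..N}. (\<Sum>j\<in>{1..N}. centered i j * v j)\<^sup>2)
      = (\<Sum>i\<in>{1..N}. \<Sum>j\<in>{1..N}. \<Sum>k\<in>{1..N}. (v j * v k) * (centered i j * centered i k))"
    by (simp add: power2_eq_square sum_product mult_ac)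
  also have "\<dots> = (\<Sum>j\<in>{1..N}. \<Sum>i\<in>{1..N}. \<Sum>k\<in>{1..N}. (v j * v k) * (centered i j * centered i k))"
    by (rule sum.swap)
  \<comment> \<open>The sum over \<open>i\<close> stays inside the absolute value below: its
    cancellation off the diagonal is what makes \<open>discrepancy\<close> small.\<close>
  also have "\<dots> = (\<Sum>j\<in>{1..N}. \<Sum>k\<in>{1..N}. (v j * v k) * (\<Sum>i\<in>{1..N}. centered i j * centered i k))"
    unfolding sum_distrib_left by (rule sum.cong[OF refl], rule sum.swap)
  also have "\<dots> \<le> (\<Sum>j\<in>{1..N}. \<Sum>k\<in>{1..N}. \<bar>\<Sum>i\<in>{1..N}. centered i j * centered i k\<bar>)"
  proof (intro sum_mono)
    fix j k assume "j \<in> {1..N}" "k \<in> {1..N}"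
    then have "\<bar>v j * v k\<bar> \<le> 1"
      using mult_mono[of "\<bar>v j\<bar>" 1 "\<bar>v k\<bar>" 1] assms by (simp add: abs_mult)
    then have "\<bar>v j * v k\<bar> * \<bar>\<Sum>i\<in>{1..N}. centered i j * centered i k\<bar>
        \<le> 1 * \<bar>\<Sum>i\<in>{1..N}. centered i j * centered i k\<bar>"
      by (intro mult_right_mono) auto
    then show "v j * v k * (\<Sum>i\<in>{1..N}. centered i j * centered i k)
        \<le> \<bar>\<Sum>i\<in>{1..N}. centered i j * centered i k\<bar>"
      using abs_ge_self[of "v j * v k * (\<Sum>i\<in>{1..N}. centered i j * centered i k)"]
      unfolding abs_mult[of "v j * v k"] by linarith
  qed
  also have "\<dots> = real N * discrepancy"
    using N2 by (simp add: discrepancy_def)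
  finally show ?thesis .
qed

text \<open>Cauchy-Schwarz against the constant vector; this is the source of the square root in
  \<open>mf_error\<close>.\<close>

lemma mean_linear_form_le:
  assumes "\<And>j. j \<in> {1..N} \<Longrightarrow> \<bar>v j\<bar> \<le> 1"
  shows "(\<Sum>i\<in>{1..N}. \<bar>\<Sum>j\<in>{1..N}. centered i j * v j\<bar>) \<le> real N * sqrt discrepancy"
proof -
  let ?x = "\<lambda>i. \<bar>\<Sum>j\<in>{1..N}. centered i j * v j\<bar>"
  have "(\<Sum>i\<in>{1..N}. ?x i * 1)\<^sup>2 \<le> (\<Sum>i\<in>{1..N}. (?x i)\<^sup>2) * (\<Sum>i\<in>{1..N}. 1\<^sup>2)"
    by (rule Cauchy_Schwarz_ineq_sum)
  also have "\<dots> \<le> (real N * discrepancy) * real N"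
    using quadratic_form_le[OF assms] by (simp add: mult_right_mono)
  finally have "(\<Sum>i\<in>{1..N}. ?x i)\<^sup>2 \<le> (real N * sqrt discrepancy)\<^sup>2"
    using discrepancy_nonneg by (simp add: power_mult_distrib power2_eq_square mult_ac)
  then show ?thesis
    using discrepancy_nonneg by (auto intro: power2_le_imp_le)
qed

text \<open>Chebyshev's counting argument for the vector of ones: its image under
  \<open>centered\<close> is the normalised degree minus 1, which exceeds 1 at a bad vertex.\<close>

lemma card_not_good_le: "real (card ({1..N} - good)) \<le> real N * discrepancy"
proof -
  have c: "(\<Sum>j\<in>{1..N}. centered i j * 1) = (\<Sum>j\<in>{1..N}. a i j) / d - 1" if "i \<in> {1..N}" for i
  proof -
    have "(\<Sum>j\<in>{1..N}. centered i j * 1) = (\<Sum>j\<in>{1..N} - {i}. a i j / d - 1 / (real N - 1))"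
      using that by (subst sum.remove[of _ i]) (auto simp: centered_def intro!: sum.cong)
    also have "\<dots> = (\<Sum>j\<in>{1..N} - {i}. a i j / d) - 1"
      using that N2 by (simp add: sum_subtractf)
    also have "(\<Sum>j\<in>{1..N} - {i}. a i j / d) = (\<Sum>j\<in>{1..N}. a i j / d)"
      using that by (subst (2) sum.remove[of _ i]) (auto simp: a_diag)
    finally show ?thesis
      by (simp add: sum_divide_distrib)
  qed
  have "real (card ({1..N} - good)) = (\<Sum>i\<in>{1..N} - good. 1)"
    by simp
  also have "\<dots> \<le> (\<Sum>i\<in>{1..N} - good. (\<Sum>j\<in>{1..N}. centered i j * 1)\<^sup>2)"
  proof (rule sum_mono)
    fix i assume i: "i \<in> {1..N} - good"
    then have "2 * d < (\<Sum>j\<in>{1..N}. a i j)"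
      by (auto simp: good_def)
    then have "1 \<le> (\<Sum>j\<in>{1..N}. a i j) / d - 1"
      using d_pos by (simp add: field_simps)
    then show "1 \<le> (\<Sum>j\<in>{1..N}. centered i j * 1)\<^sup>2"
      using i c[of i] by (simp add: one_le_power)
  qed
  also have "\<dots> \<le> (\<Sum>i\<in>{1..N}. (\<Sum>j\<in>{1..N}. centered i j * 1)\<^sup>2)"
    by (intro sum_mono2) auto
  also have "\<dots> \<le> real N * discrepancy"
    by (rule quadratic_form_le) simp
  finally show ?thesis .
qed

lemma average_good_average_le:
  assumes "\<And>i. i \<in> {1..N} \<Longrightarrow> norm (v i) \<le> 1"
  shows "norm (average N v - good_average v) \<le> discrepancy"
proof -
  have "(\<Sum>i\<in>{1..N}. v i) = (\<Sum>i\<in>{1..N} - good. v i) + (\<Sum>i\<in>good. v i)"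
    using good_subset by (simp add: sum.subset_diff)
  then have "average N v - good_average v = (1 / real N) *\<^sub>R (\<Sum>i\<in>{1..N} - good. v i)"
    by (simp add: average_def good_average_def scaleR_add_right)
  moreover have "norm (\<Sum>i\<in>{1..N} - good. v i) \<le> real (card ({1..N} - good)) * 1"
    using assms by (intro sum_norm_bound) auto
  ultimately show ?thesis
    using card_not_good_le N2 by (simp add: field_simps)
qed

lemma good_average_norm_le:
  assumes "\<And>i. i \<in> {1..N} \<Longrightarrow> norm (v i) \<le> 1"
  shows "norm (good_average v) \<le> 1"
proof -
  have "norm (\<Sum>i\<in>good. v i) \<le> real (card good) * 1"
    using assms good_subset by (intro sum_norm_bound) auto
  also have "\<dots> \<le> real N"
    using card_mono[OF _ good_subset] by simp
  finally show ?thesis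
    using N2 by (simp add: good_average_def field_simps)
qed

text \<open>Coordinates in \<open>[0, 1]\<close> are assumed instead of membership in
  \<open>Delta\<close>, in order to cover clipped vectors.\<close>

lemma local_density_in_cbox:
  fixes v :: "nat \<Rightarrow> real^'s"
  assumes "\<And>j s. j \<in> {1..N} \<Longrightarrow> 0 \<le> v j $ s \<and> v j $ s \<le> 1"
    and "(\<Sum>j\<in>{1..N}. a i j) \<le> r * d" and i: "i \<in> {1..N}"
  shows "local_density N d a v i \<in> cbox 0 (vec r)"
proof -
  have "0 \<le> local_density N d a v i $ s" for s
    using assms(1) a_nonneg[OF i] d_pos
    by (auto simp: local_density_def intro!: divide_nonneg_pos sum_nonneg)
  moreover have "local_density N d a v i $ s \<le> r" for s
  proof -
    have "(\<Sum>j\<in>{1..N}. a i j * v j $ s) \<le> (\<Sum>j\<in>{1..N}. a i j)"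
      using assms(1) a_nonneg[OF i] by (intro sum_mono) (simp add: mult_left_le)
    also have "\<dots> \<le> r * d" by fact
    finally show ?thesis
      using d_pos by (simp add: local_density_def field_simps)
  qed
  ultimately show ?thesis
    by (simp add: mem_box_cart)
qed

lemma good_density_in_cbox:
  assumes "\<And>j. j \<in> {1..N} \<Longrightarrow> v j \<in> Delta" "i \<in> good"
  shows "local_density N d a v i \<in> cbox 0 (vec 2)"
  using assms by (intro local_density_in_cbox) (auto simp: good_def Delta_component)

text \<open>In each coordinate the deviation is the image of \<open>v\<close> under
  \<open>centered\<close>, up to a correction for the vertex itself: \<open>centered\<close>
  compares with the mean over the other \<open>N - 1\<close> vertices, \<open>average\<close> runs
  over all \<open>N\<close>.\<close>

lemma local_density_average_le:
  fixes v :: "nat \<Rightarrow> real^'s"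
  assumes v: "\<And>j. j \<in> {1..N} \<Longrightarrow> v j \<in> Delta"
  shows "(\<Sum>i\<in>{1..N}. norm (local_density N d a v i - average N v))
    \<le> real N * (real CARD('s) * (sqrt discrepancy + 2 / real N))"
proof -
  have le: "\<bar>(local_density N d a v i - average N v) $ s\<bar>
      \<le> \<bar>\<Sum>j\<in>{1..N}. centered i j * v j $ s\<bar> + 2 / real N" if i: "i \<in> {1..N}" for i s
  proof -
    let ?x = "\<lambda>j. v j $ s"
    have x: "0 \<le> ?x j \<and> ?x j \<le> 1" if "j \<in> {1..N}" for j
      using Delta_component[OF v[OF that]] .
    have split: "(\<Sum>j\<in>{1..N}. f j) = f i + (\<Sum>j\<in>{1..N}-{i}. f j)" for f :: "nat \<Rightarrow> real"
      using i by (simp add: sum.remove)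
    \<comment> \<open>The mass at the other vertices. Exchanging \<open>R / (N - 1)\<close> for
      \<open>R / N\<close> and accounting for the state of \<open>i\<close> itself cost at most
      \<open>1 / N\<close> each.\<close>
    define R where "R = (\<Sum>j\<in>{1..N}-{i}. ?x j)"
    have R: "0 \<le> R" "R \<le> real N - 1"
    proof -
      show "0 \<le> R" unfolding R_def using x by (intro sum_nonneg) auto
      have "R \<le> (\<Sum>j\<in>{1..N}-{i}. 1)" unfolding R_def using x by (intro sum_mono) auto
      then show "R \<le> real N - 1" using i N2 by simp
    qed
    have "(local_density N d a v i - average N v) $ s
        = (\<Sum>j\<in>{1..N}. a i j * ?x j) / d - (\<Sum>j\<in>{1..N}. ?x j) / real N"
      by (simp add: local_density_def average_def)
    also have "\<dots> = (\<Sum>j\<in>{1..N}-{i}. a i j * ?x j) / d - (?x i + R) / real N"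
      unfolding split[of "\<lambda>j. a i j * ?x j"] split[of ?x] by (simp add: a_diag R_def)
    finally have 1: "(local_density N d a v i - average N v) $ s
      = (\<Sum>j\<in>{1..N}-{i}. a i j * ?x j) / d - (?x i + R) / real N" .
    have "(\<Sum>j\<in>{1..N}. centered i j * ?x j)
        = (\<Sum>j\<in>{1..N}-{i}. (a i j / d - 1 / (real N - 1)) * ?x j)"
      unfolding split by (auto simp: centered_def intro!: sum.cong)
    also have "\<dots> = (\<Sum>j\<in>{1..N}-{i}. a i j * ?x j) / d - R / (real N - 1)"
      by (simp add: R_def left_diff_distrib sum_subtractf sum_divide_distrib)
    finally have 2: "(local_density N d a v i - average N v) $ s
      = (\<Sum>j\<in>{1..N}. centered i j * ?x j) + (R / (real N - 1) - R / real N) - ?x i / real N"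
      using 1 by (simp add: add_divide_distrib)
    have "R / (real N - 1) - R / real N = R / (real N - 1) * (1 / real N)"
      using N2 by (simp add: field_simps)
    also have "\<dots> \<le> 1 * (1 / real N)"
      using R N2 by (intro mult_right_mono) (auto simp: field_simps)
    finally have 3: "R / (real N - 1) - R / real N \<le> 1 / real N" by simp
    have 4: "0 \<le> R / (real N - 1) - R / real N"
      using R N2 by (simp add: field_simps)
    have 5: "0 \<le> ?x i / real N" "?x i / real N \<le> 1 / real N"
      using x[OF i] by (auto intro: divide_right_mono)
    show ?thesis unfolding 2 using 3 4 5 by linarith
  qed
  have "(\<Sum>i\<in>{1..N}. norm (local_density N d a v i - average N v))
    \<le> (\<Sum>i\<in>{1..N}. \<Sum>s\<in>UNIV. \<bar>\<Sum>j\<in>{1..N}. centered i j * v j $ s\<bar> + 2 / real N)"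
    by (intro sum_mono order_trans[OF norm_le_l1_cart] le)
  also have "\<dots> = (\<Sum>s\<in>UNIV. (\<Sum>i\<in>{1..N}. \<bar>\<Sum>j\<in>{1..N}. centered i j * v j $ s\<bar>) + real N * (2 / real N))"
    by (subst sum.swap) (simp add: sum.distrib)
  also have "\<dots> \<le> (\<Sum>s\<in>(UNIV::'s set). real N * sqrt discrepancy + real N * (2 / real N))"
    using Delta_component[OF v] by (intro sum_mono add_mono mean_linear_form_le) auto
  also have "\<dots> = real N * (real CARD('s) * (sqrt discrepancy + 2 / real N))"
    unfolding sum_constant by (simp only: distrib_left mult_ac)
  finally show ?thesis .
qed

lemma good_drift_norm_le:
  assumes "rate_bound Q 2 C" "\<And>j. j \<in> {1..N} \<Longrightarrow> v j \<in> Delta"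
  shows "norm (good_drift Q v) \<le> C"
proof -
  have "norm (\<Sum>i\<in>good. Q (local_density N d a v i) *v v i) \<le> real (card good) * C"
  proof (rule sum_norm_bound)
    fix i assume i: "i \<in> good"
    have "norm (Q (local_density N d a v i) *v v i) \<le> C * norm (v i)"
      using rate_boundD(3)[OF assms(1) good_density_in_cbox[of v i]] assms(2) i by blast
    also have "\<dots> \<le> C"
      using rate_boundD(1)[OF assms(1)] assms(2)[of i] i good_subset
      by (simp add: Delta_norm_le mult_left_le subset_iff)
    finally show "norm (Q (local_density N d a v i) *v v i) \<le> C" .
  qed
  also have "\<dots> \<le> real N * C"
    using card_mono[OF _ good_subset] rate_boundD(1)[OF assms(1)] by (intro mult_right_mono) auto
  finally show ?thesis
    using N2 by (simp add: good_drift_def field_simps)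
qed

text \<open>Replacing the local densities by \<open>u\<close> makes the field linear in
  \<open>v\<close> and leaves \<open>Q u\<close> applied to \<open>good_average v - u\<close>. The
  cost of the replacement is measured along the chain from local density through
  \<open>average\<close> and \<open>good_average\<close> to \<open>u\<close>. Each of the two parts
  contributes one \<open>C\<close>.\<close>

lemma good_drift_error:
  fixes v :: "nat \<Rightarrow> real^'s"
  assumes Q: "rate_bound Q 2 C" and v: "\<And>j. j \<in> {1..N} \<Longrightarrow> v j \<in> Delta" and u: "u \<in> Delta"
  shows "norm (good_drift Q v - Q u *v u)
    \<le> 2 * C * (norm (good_average v - u) + mf_error (real CARD('s)) N discrepancy)"
proof -
  let ?\<phi> = "local_density N d a v"
  let ?g = "norm (good_average v - u)"
  have uK: "u \<in> cbox 0 (vec 2)"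
    using Delta_subset_cbox[of 2] u by auto
  have C: "0 \<le> C" using rate_boundD(1)[OF Q] .
  have "(\<Sum>i\<in>good. Q u *v v i) = Q u *v (\<Sum>i\<in>good. v i)"
    by (simp add: linear_sum[OF matrix_vector_mul_linear])
  then have eq: "good_drift Q v - Q u *v u = (1 / real N) *\<^sub>R (\<Sum>i\<in>good. Q (?\<phi> i) *v v i - Q u *v v i)
      + Q u *v (good_average v - u)"
    by (simp add: good_drift_def good_average_def sum_subtractf scaleR_diff_right
        matrix_vector_mult_diff_distrib matrix_vector_mult_scaleR)
  have vu: "norm (average N v - u) \<le> ?g + discrepancy"
    using average_good_average_le[of v] v
      norm_triangle_ineq[of "average N v - good_average v" "good_average v - u"]
    by (simp add: Delta_norm_le)
  have "norm (\<Sum>i\<in>good. Q (?\<phi> i) *v v i - Q u *v v i) \<le> (\<Sum>i\<in>good. C * norm (?\<phi> i - u))"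
  proof (rule sum_norm_le)
    fix i assume i: "i \<in> good"
    then have "norm (v i) \<le> 1"
      using v good_subset Delta_norm_le by blast
    then have "C * norm (?\<phi> i - u) * norm (v i) \<le> C * norm (?\<phi> i - u)"
      using C by (simp add: mult_left_le)
    then show "norm (Q (?\<phi> i) *v v i - Q u *v v i) \<le> C * norm (?\<phi> i - u)"
      using rate_boundD(4)[OF Q good_density_in_cbox[of v i] uK, of "v i"] v i by simp
  qed
  \<comment> \<open>No rate is left in the summands, so bad vertices may be included; the estimate
    for local densities is a sum over all vertices.\<close>
  also have "\<dots> \<le> (\<Sum>i\<in>{1..N}. C * norm (?\<phi> i - u))"
    using good_subset C by (intro sum_mono2) auto
  also have "\<dots> \<le> (\<Sum>i\<in>{1..N}. C * (norm (?\<phi> i - average N v) + (?g + discrepancy)))"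
  proof (intro sum_mono mult_left_mono C)
    fix i
    show "norm (?\<phi> i - u) \<le> norm (?\<phi> i - average N v) + (?g + discrepancy)"
      using vu norm_triangle_ineq[of "?\<phi> i - average N v" "average N v - u"] by simp
  qed
  also have "\<dots> = C * ((\<Sum>i\<in>{1..N}. norm (?\<phi> i - average N v)) + real N * (?g + discrepancy))"
    by (simp add: sum_distrib_left sum.distrib distrib_left)
  also have "\<dots> \<le> C * (real N * (real CARD('s) * (sqrt discrepancy + 2 / real N))
      + real N * (?g + discrepancy))"
    by (intro mult_left_mono add_right_mono local_density_average_le v C)
  also have "\<dots> = real N * (C * (?g + mf_error (real CARD('s)) N discrepancy))"
    by (simp add: mf_error_def algebra_simps)
  finally have "norm ((1 / real N) *\<^sub>R (\<Sum>i\<in>good. Q (?\<phi> i) *v v i - Q u *v v i))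
      \<le> C * (?g + mf_error (real CARD('s)) N discrepancy)"
    using N2 by (simp add: field_simps)
  moreover have "norm (Q u *v (good_average v - u)) \<le> C * ?g"
    using rate_boundD(3)[OF Q uK] .
  moreover have "0 \<le> mf_error (real CARD('s)) N discrepancy"
    using discrepancy_nonneg by (simp add: mf_error_def)
  then have "C * ?g \<le> C * (?g + mf_error (real CARD('s)) N discrepancy)"
    using C by (intro mult_left_mono) auto
  ultimately show ?thesis
    unfolding eq by (intro norm_triangle_le) simp
qed

text \<open>The square of the distance is used because it is differentiable also where the distance
  vanishes.\<close>

lemma NIMFA_close:
  fixes u :: "real \<Rightarrow> real^'s"
  assumes Q: "rate_bound Q 2 C" and z: "NIMFA_solution Q N d a z" and u: "mean_field_solution Q u"
    and "0 \<le> t"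
  shows "(norm (good_average (z t) - u t))\<^sup>2
    \<le> exp (6 * C * t) * ((norm (good_average (z 0) - u 0))\<^sup>2
          + (mf_error (real CARD('s)) N discrepancy)\<^sup>2)"
proof -
  let ?\<eta> = "mf_error (real CARD('s)) N discrepancy"
  let ?v = "\<lambda>t. good_average (z t) - u t"
  let ?v' = "\<lambda>t. good_drift Q (z t) - Q (u t) *v u t"
  have C: "0 \<le> C" using rate_boundD(1)[OF Q] .
  have zD: "z t i \<in> Delta" if "0 \<le> t" "i \<in> {1..N}" for t i
    using z that by (auto simp: NIMFA_solution_def)
  have uD: "u t \<in> Delta" if "0 \<le> t" for t
    using u that by (auto simp: mean_field_solution_def)
  have deriv: "(?v has_vector_derivative ?v' t) (at t within {0..})" if "0 \<le> t" for t
  proof (rule has_vector_derivative_diff)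
    show "((\<lambda>t. good_average (z t)) has_vector_derivative good_drift Q (z t)) (at t within {0..})"
      unfolding good_average_def good_drift_def
      using z that good_subset
      by (intro bounded_linear.has_vector_derivative[OF bounded_linear_scaleR_right] has_vector_derivative_sum)
        (auto simp: NIMFA_solution_def)
    show "(u has_vector_derivative Q (u t) *v u t) (at t within {0..})"
      using u that by (simp add: mean_field_solution_def)
  qed
  have "((\<lambda>t. ?v t \<bullet> ?v t) has_real_derivative 2 * (?v t \<bullet> ?v' t)) (at t within {0..})"
    if "0 \<le> t" for t
    unfolding has_field_derivative_def
    by (rule has_derivative_eq_rhs[OF has_derivative_inner[OF deriv[OF that, unfolded has_vector_derivative_def]
            deriv[OF that, unfolded has_vector_derivative_def]]])
      (auto simp: fun_eq_iff inner_commute)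
  \<comment> \<open>\<open>good_drift_error\<close> yields \<open>4 * C\<close> times the square of
    the distance and a cross term; the latter is split into \<open>2 * C\<close> times each of the
    two squares, and \<open>6 * C\<close> covers everything.\<close>
  moreover have "2 * (?v t \<bullet> ?v' t) \<le> 6 * C * (?v t \<bullet> ?v t + ?\<eta>\<^sup>2)" if "0 \<le> t" for t
  proof -
    let ?n = "norm (?v t)"
    have "?v t \<bullet> ?v' t \<le> ?n * norm (?v' t)"
      by (rule norm_cauchy_schwarz)
    also have "\<dots> \<le> ?n * (2 * C * (?n + ?\<eta>))"
      using good_drift_error[OF Q zD[OF that] uD[OF that]] by (intro mult_left_mono) auto
    finally have "2 * (?v t \<bullet> ?v' t) \<le> C * (4 * ?n\<^sup>2 + 2 * (2 * ?n * ?\<eta>))"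
      by (simp add: algebra_simps power2_eq_square)
    also have "\<dots> \<le> C * (4 * ?n\<^sup>2 + 2 * (?n\<^sup>2 + ?\<eta>\<^sup>2))"
      using sum_squares_bound[of ?n ?\<eta>] C by (intro mult_left_mono add_left_mono) auto
    also have "\<dots> \<le> 6 * C * (?v t \<bullet> ?v t + ?\<eta>\<^sup>2)"
      using C by (simp add: power2_norm_eq_inner algebra_simps)
    finally show ?thesis .
  qed
  ultimately have "?v t \<bullet> ?v t + ?\<eta>\<^sup>2 \<le> exp (6 * C * t) * (?v 0 \<bullet> ?v 0 + ?\<eta>\<^sup>2)"
    using \<open>0 \<le> t\<close> by (rule gronwall_scalar)
  then show ?thesis
    using zero_le_power2[of ?\<eta>] unfolding power2_norm_eq_inner by linarith
qed

end

section \<open>Measurability of the NIMFA solution\<close>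

primrec euler :: "((nat \<Rightarrow> 'b::real_vector) \<Rightarrow> nat \<Rightarrow> 'b) \<Rightarrow> real \<Rightarrow> (nat \<Rightarrow> 'b) \<Rightarrow> nat \<Rightarrow> nat \<Rightarrow> 'b" where
  "euler F h v 0 = v"
| "euler F h v (Suc k) = (\<lambda>i. euler F h v k i + h *\<^sub>R F (euler F h v k) i)"

text \<open>Stability plus consistency: the error summed over coordinates grows by the factor
  \<open>1 + \<Lambda> * h\<close> per step and receives a local error of order
  \<open>h\<^sup>2\<close>. The number of steps is \<open>Suc m\<close> to keep the step size well
  defined.\<close>

lemma euler_converges:
  fixes F :: "(nat \<Rightarrow> 'b::real_normed_vector) \<Rightarrow> nat \<Rightarrow> 'b"
  assumes I: "finite I" and \<Lambda>: "0 \<le> \<Lambda>"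
    and lip: "\<And>v w. (\<Sum>i\<in>I. norm (F v i - F w i)) \<le> \<Lambda> * (\<Sum>i\<in>I. norm (v i - w i))"
    and bd: "\<And>s i. 0 \<le> s \<Longrightarrow> i \<in> I \<Longrightarrow> norm (F (z s) i) \<le> B"
    and sol: "\<And>s i. 0 \<le> s \<Longrightarrow> i \<in> I \<Longrightarrow>
      ((\<lambda>r. z r i) has_vector_derivative F (z s) i) (at s within {0..})"
    and t: "0 \<le> t" and i: "i \<in> I"
  shows "(\<lambda>m. euler F (t / real (Suc m)) (z 0) (Suc m) i) \<longlonglongrightarrow> z t i"
proof -
  let ?c = "real (card I)"
  have B: "0 \<le> B" using bd[OF t i] norm_ge_zero order_trans by blast
  \<comment> \<open>The whole configuration moves with speed at most \<open>?c * B\<close>, so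
    within a step the field at one coordinate varies by at most
    \<open>\<Lambda> * (?c * B) * h\<close>; the outer \<open>?c\<close> sums over
    coordinates.\<close>
  define K where "K = ?c * (\<Lambda> * (?c * B))"
  have K0: "0 \<le> K" unfolding K_def using \<Lambda> B by simp
  have bound: "norm (euler F (t / real (Suc m)) (z 0) (Suc m) i - z t i)
      \<le> exp (\<Lambda> * t) * (t * K * (t / real (Suc m)))" for m
  proof -
    define h where "h = t / real (Suc m)"
    have h: "0 \<le> h" using t by (simp add: h_def)
    define e where "e k = (\<Sum>i\<in>I. norm (euler F h (z 0) k i - z (real k * h) i))" for k
    have step: "e (Suc k) \<le> (1 + \<Lambda> * h) * e k + K * h * h" for k
    proof -
      let ?s = "real k * h"
      have s: "0 \<le> ?s" using h by simp
      have loc: "norm (z (?s + h) j - z ?s j - h *\<^sub>R F (z ?s) j) \<le> (\<Lambda> * (?c * B)) * h * h"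
        if j: "j \<in> I" for j
      proof (rule euler_step_error[of "\<lambda>r. z r j" "\<lambda>r. F (z r) j", OF sol[OF _ j] s h])
        fix r assume r: "?s \<le> r" "r \<le> ?s + h"
        have "norm (F (z r) j - F (z ?s) j) \<le> (\<Sum>i\<in>I. norm (F (z r) i - F (z ?s) i))"
          using I j by (intro member_le_sum[of j I "\<lambda>j. norm (F (z r) j - F (z ?s) j)"]) auto
        also have "\<dots> \<le> \<Lambda> * (\<Sum>i\<in>I. norm (z r i - z ?s i))"
          by (rule lip)
        also have "\<dots> \<le> \<Lambda> * (\<Sum>i\<in>I. B * h)"
        proof (intro mult_left_mono sum_mono \<Lambda>)
          fix i assume i: "i \<in> I"
          have "norm (z (?s + (r - ?s)) i - z ?s i) \<le> B * (r - ?s)"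
            using sol[OF _ i] bd[OF _ i] s r by (intro vector_derivative_lipschitz[where f'="\<lambda>r. F (z r) i"]) auto
          also have "\<dots> \<le> B * h"
            using r B by (intro mult_left_mono) auto
          finally show "norm (z r i - z ?s i) \<le> B * h" by simp
        qed
        finally show "norm (F (z r) j - F (z ?s) j) \<le> (\<Lambda> * (?c * B)) * h"
          by (simp add: mult_ac)
      qed
      have nh: "norm (h *\<^sub>R y) = h * norm y" for y :: 'b
        using h by simp
      have "e (Suc k) \<le> (\<Sum>i\<in>I. norm (euler F h (z 0) k i - z ?s i)
          + h * norm (F (euler F h (z 0) k) i - F (z ?s) i) + (\<Lambda> * (?c * B)) * h * h)"
        unfolding e_def
      proof (rule sum_mono)
        fix j assume j: "j \<in> I"
        \<comment> \<open>Old error, difference of the field at the two configurations, and local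
          error of the exact solution.\<close>
        have eq: "euler F h (z 0) (Suc k) j - z (real (Suc k) * h) j
          = (euler F h (z 0) k j - z ?s j) + h *\<^sub>R (F (euler F h (z 0) k) j - F (z ?s) j)
            - (z (?s + h) j - z ?s j - h *\<^sub>R F (z ?s) j)"
          by (simp add: algebra_simps)
        have "norm (euler F h (z 0) (Suc k) j - z (real (Suc k) * h) j) \<le> norm (euler F h (z 0) k j - z ?s j)
          + norm (h *\<^sub>R (F (euler F h (z 0) k) j - F (z ?s) j))
          + norm (z (?s + h) j - z ?s j - h *\<^sub>R F (z ?s) j)"
          unfolding eq by (rule order_trans[OF norm_triangle_ineq4 add_right_mono[OF norm_triangle_ineq]])
        also have "\<dots> \<le> norm (euler F h (z 0) k j - z ?s j)
          + h * norm (F (euler F h (z 0) k) j - F (z ?s) j) + (\<Lambda> * (?c * B)) * h * h"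
          unfolding nh by (intro add_left_mono loc[OF j])
        finally show "norm (euler F h (z 0) (Suc k) j - z (real (Suc k) * h) j)
          \<le> norm (euler F h (z 0) k j - z ?s j)
          + h * norm (F (euler F h (z 0) k) j - F (z ?s) j) + (\<Lambda> * (?c * B)) * h * h" .
      qed
      also have "\<dots> = e k + h * (\<Sum>i\<in>I. norm (F (euler F h (z 0) k) i - F (z ?s) i)) + K * h * h"
        by (simp add: e_def sum.distrib sum_distrib_left K_def)
      also have "\<dots> \<le> e k + h * (\<Lambda> * e k) + K * h * h"
        unfolding e_def using h by (intro add_mono mult_left_mono lip order_refl)
      finally show ?thesis by (simp add: algebra_simps)
    qed
    have e0: "e 0 = 0" by (simp add: e_def)
    have "e (Suc m) \<le> exp (\<Lambda> * h * real (Suc m)) * (e 0 + real (Suc m) * (K * h * h))"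
      using \<Lambda> h K0 step by (intro recursive_bound) (auto simp: e0)
    also have "\<dots> = exp (\<Lambda> * t) * (t * K * (t / real (Suc m)))"
      by (simp add: e0 h_def del: of_nat_Suc)
    finally have "e (Suc m) \<le> exp (\<Lambda> * t) * (t * K * (t / real (Suc m)))" .
    moreover have "norm (euler F h (z 0) (Suc m) i - z (real (Suc m) * h) i) \<le> e (Suc m)"
      unfolding e_def using I i
      by (intro member_le_sum[where f="\<lambda>i. norm (euler F h (z 0) (Suc m) i - z (real (Suc m) * h) i)"]) auto
    moreover have "real (Suc m) * h = t" by (simp add: h_def del: of_nat_Suc)
    ultimately show ?thesis by (simp add: h_def del: euler.simps of_nat_Suc)
  qed
  have "(\<lambda>m. exp (\<Lambda> * t) * (t * K * (t / real (Suc m)))) \<longlonglongrightarrow> exp (\<Lambda> * t) * (t * K * 0)"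
    by (intro tendsto_mult tendsto_const LIMSEQ_Suc[OF lim_const_over_n])
  then have "(\<lambda>m. euler F (t / real (Suc m)) (z 0) (Suc m) i - z t i) \<longlonglongrightarrow> 0"
    using Lim_null_comparison[OF always_eventually[OF allI], OF bound] by simp
  then show ?thesis
    by (simp add: LIM_zero_iff)
qed

text \<open>
  Clipping to the unit cube does not change a NIMFA solution, but it makes the vector field globally
  Lipschitz, so that the Euler scheme converges from any initial condition. Measurability of the
  solution in \<open>\<omega>\<close> follows, since each Euler step is measurable.
\<close>

definition clip :: "real^'s \<Rightarrow> real^'s" where
  "clip v = (\<chi> s. max 0 (min 1 (v $ s)))"

definition clipped_field ::
    "(real^'s \<Rightarrow> real^'s^'s) \<Rightarrow> nat \<Rightarrow> real \<Rightarrow> (nat \<Rightarrow> nat \<Rightarrow> real) \<Rightarrow> (nat \<Rightarrow> real^'s) \<Rightarrow> nat \<Rightarrow> real^'s" where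
  "clipped_field Q N d a v i = Q (local_density N d a (\<lambda>j. clip (v j)) i) *v clip (v i)"

lemma clip_component: "0 \<le> clip v $ s \<and> clip v $ s \<le> 1"
  by (simp add: clip_def)

lemma clip_Delta: "v \<in> Delta \<Longrightarrow> clip v = v"
  using Delta_component[of v] by (simp add: clip_def vec_eq_iff)

lemma norm_clip_diff_le: "norm (clip v - clip w) \<le> norm (v - w)"
  by (rule norm_le_componentwise_cart) (auto simp: clip_def max_def min_def)

lemma norm_clip_le: "norm (clip v :: real^'s) \<le> real CARD('s)"
proof -
  have "norm (clip v) \<le> (\<Sum>s\<in>UNIV. \<bar>clip v $ s\<bar>)"
    by (rule norm_le_l1_cart)
  also have "\<dots> \<le> (\<Sum>s\<in>(UNIV::'s set). 1)"
    using clip_component[of v] by (intro sum_mono) simp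
  finally show ?thesis by simp
qed

text \<open>The constants may depend on the graph, because convergence is wanted for each graph
  separately.\<close>

lemma (in weighted_graph) NIMFA_euler_converges:
  fixes Q :: "real^'s \<Rightarrow> real^'s^'s"
  assumes Q: "\<And>k s. locally_lipschitz (\<lambda>\<phi>. Q \<phi> $ k $ s)"
    and z: "NIMFA_solution Q N d a z" and t: "0 \<le> t" and i: "i \<in> {1..N}"
  shows "(\<lambda>m. euler (clipped_field Q N d a) (t / real (Suc m)) (z 0) (Suc m) i) \<longlonglongrightarrow> z t i"
proof -
  let ?S = "real CARD('s)"
  let ?F = "clipped_field Q N d a"
  \<comment> \<open>The normalised total weight: crude, but a bound for the row sums at all
    vertices, good or bad.\<close>
  define r where "r = (\<Sum>i\<in>{1..N}. \<Sum>j\<in>{1..N}. a i j) / d"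
  have row: "(\<Sum>j\<in>{1..N}. a i j) \<le> r * d" if "i \<in> {1..N}" for i
  proof -
    have "(\<Sum>j\<in>{1..N}. a i j) \<le> (\<Sum>i\<in>{1..N}. \<Sum>j\<in>{1..N}. a i j)"
      using that a_nonneg by (intro member_le_sum[of i _ "\<lambda>i. \<Sum>j\<in>{1..N}. a i j"]) (auto intro: sum_nonneg)
    then show ?thesis using d_pos by (simp add: r_def)
  qed
  have r0: "0 \<le> r"
    using a_nonneg d_pos by (auto simp: r_def intro!: divide_nonneg_pos sum_nonneg)
  obtain C where C: "rate_bound Q r C"
    using rate_bound_exists[OF Q] by blast
  have C0: "0 \<le> C" using rate_boundD(1)[OF C] .
  let ?\<rho> = "\<lambda>v i. local_density N d a (\<lambda>j. clip (v j)) i"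
  have \<rho>: "?\<rho> v i \<in> cbox 0 (vec r)" if "i \<in> {1..N}" for i and v :: "nat \<Rightarrow> real^'s"
    by (intro local_density_in_cbox row clip_component that)
  have \<rho>_diff: "norm (?\<rho> v i - ?\<rho> w i) \<le> r * (\<Sum>j\<in>{1..N}. norm (v j - w j))"
    if i: "i \<in> {1..N}" for i and v w :: "nat \<Rightarrow> real^'s"
  proof -
    have "?\<rho> v i - ?\<rho> w i = (1 / d) *\<^sub>R (\<Sum>j\<in>{1..N}. a i j *\<^sub>R (clip (v j) - clip (w j)))"
      by (simp add: local_density_def scaleR_diff_right sum_subtractf)
    moreover have "norm (\<Sum>j\<in>{1..N}. a i j *\<^sub>R (clip (v j) - clip (w j)))
        \<le> (\<Sum>j\<in>{1..N}. (r * d) * norm (v j - w j))"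
    proof (rule sum_norm_le)
      fix j assume j: "j \<in> {1..N}"
      have "a i j \<le> (\<Sum>j\<in>{1..N}. a i j)"
        using j i a_nonneg by (intro member_le_sum) auto
      then have "a i j \<le> r * d" using row[OF i] by simp
      then show "norm (a i j *\<^sub>R (clip (v j) - clip (w j))) \<le> (r * d) * norm (v j - w j)"
        using a_nonneg[OF i j] norm_clip_diff_le[of "v j" "w j"] by (simp add: mult_mono')
    qed
    ultimately show ?thesis
      using d_pos by (simp add: field_simps flip: sum_distrib_left)
  qed
  show ?thesis
  \<comment> \<open>The first \<open>C\<close> is the effect of a vertex's own state. The second
    term is the effect of the local density: \<open>?S\<close> bounds a clipped vector,
    \<open>r\<close> the influence of the other states, and \<open>N\<close> comes from the sum over
    vertices.\<close>
  proof (rule euler_converges[OF finite_atLeastAtMost, where \<Lambda>="C + C * ?S * r * real N" and B="C * ?S"])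
    show "0 \<le> C + C * ?S * r * real N" using C0 r0 by simp
    fix v w :: "nat \<Rightarrow> real^'s"
    let ?D = "\<Sum>j\<in>{1..N}. norm (v j - w j)"
    have "(\<Sum>i\<in>{1..N}. norm (?F v i - ?F w i)) \<le> (\<Sum>i\<in>{1..N}. C * norm (v i - w i) + C * ?S * (r * ?D))"
    proof (rule sum_mono)
      fix i assume i: "i \<in> {1..N}"
      have "norm (?F v i - ?F w i)
          \<le> C * norm (clip (v i) - clip (w i)) + C * ?S * norm (?\<rho> v i - ?\<rho> w i)"
        unfolding clipped_field_def by (rule rate_field_lipschitz[OF C \<rho>[OF i] \<rho>[OF i] norm_clip_le])
      also have "\<dots> \<le> C * norm (v i - w i) + C * ?S * (r * ?D)"
        using C0 by (intro add_mono mult_left_mono norm_clip_diff_le \<rho>_diff i) auto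
      finally show "norm (?F v i - ?F w i) \<le> C * norm (v i - w i) + C * ?S * (r * ?D)" .
    qed
    also have "\<dots> = (C + C * ?S * r * real N) * ?D"
      by (simp add: sum.distrib sum_distrib_left[symmetric] algebra_simps)
    finally show "(\<Sum>i\<in>{1..N}. norm (?F v i - ?F w i)) \<le> (C + C * ?S * r * real N) * ?D" .
  next
    fix s i assume s: "0 \<le> (s::real)" and i: "i \<in> {1..N}"
    have "norm (?F (z s) i) \<le> C * norm (clip (z s i))"
      unfolding clipped_field_def by (rule rate_boundD(3)[OF C \<rho>[OF i]])
    also have "\<dots> \<le> C * ?S"
      using C0 norm_clip_le by (rule mult_left_mono[rotated])
    finally show "norm (?F (z s) i) \<le> C * ?S" .
    have "z s j \<in> Delta" if "j \<in> {1..N}" for j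
      using z s that by (simp add: NIMFA_solution_def)
    then have "?F (z s) i = Q (local_density N d a (z s) i) *v z s i"
      using i by (simp add: clipped_field_def clip_Delta local_density_def)
    then show "((\<lambda>r. z r i) has_vector_derivative ?F (z s) i) (at s within {0..})"
      using z s i by (simp add: NIMFA_solution_def)
  qed (use t i in auto)
qed

lemma locally_lipschitz_continuous:
  fixes f :: "'a::metric_space \<Rightarrow> real"
  assumes "locally_lipschitz f"
  shows "continuous_on UNIV f"
proof (rule continuous_at_imp_continuous_on, rule ballI)
  fix x :: 'a
  obtain r L where r: "r > 0" "L-lipschitz_on (cball x r) f"
    using assms unfolding locally_lipschitz_def by blast
  then have "continuous_on (ball x r) f"
    using lipschitz_on_continuous_on[of L "ball x r" f] lipschitz_on_subset[OF _ ball_subset_cball] by blast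
  then show "isCont f x"
    using r(1) by (simp add: continuous_on_eq_continuous_at)
qed

lemma rate_field_measurable:
  fixes Q :: "real^'s \<Rightarrow> real^'s^'s"
  assumes Q: "\<And>k s. locally_lipschitz (\<lambda>\<phi>. Q \<phi> $ k $ s)"
    and "f \<in> borel_measurable M" "g \<in> borel_measurable M"
  shows "(\<lambda>\<omega>. Q (f \<omega>) *v g \<omega>) \<in> borel_measurable M"
proof (rule borel_measurable_continuous_Pair[OF assms(2,3)])
  have "continuous_on UNIV (\<lambda>x :: (real^'s) \<times> (real^'s). Q (fst x) $ k $ s)" for k s
    using continuous_on_compose2[OF locally_lipschitz_continuous[OF Q[of k s]] continuous_on_fst[OF continuous_on_id]]
    by auto
  moreover have "continuous_on UNIV (\<lambda>x :: (real^'s) \<times> (real^'s). snd x $ s)" for s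
    by (intro continuous_intros)
  ultimately show "continuous_on UNIV (\<lambda>x :: (real^'s) \<times> (real^'s). Q (fst x) *v snd x)"
    unfolding matrix_vector_mult_def
    by (intro continuous_on_vec_lambda continuous_on_sum continuous_on_mult)
qed

lemma clip_measurable [measurable]: "clip \<in> borel_measurable borel"
  unfolding clip_def by (intro borel_measurable_continuous_onI continuous_intros)

lemma local_density_measurable:
  assumes "\<And>j. j \<in> {1..N} \<Longrightarrow> (\<lambda>\<omega>. a \<omega> i j) \<in> borel_measurable M"
    and "\<And>j. j \<in> {1..N} \<Longrightarrow> (\<lambda>\<omega>. v \<omega> j :: real^'s) \<in> borel_measurable M"
  shows "(\<lambda>\<omega>. local_density N d (a \<omega>) (v \<omega>) i) \<in> borel_measurable M"
  unfolding local_density_def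
  by (intro borel_measurable_scaleR borel_measurable_const borel_measurable_sum assms)

lemma clipped_field_measurable:
  fixes Q :: "real^'s \<Rightarrow> real^'s^'s"
  assumes Q: "\<And>k s. locally_lipschitz (\<lambda>\<phi>. Q \<phi> $ k $ s)"
    and a: "\<And>i j. i \<in> {1..N} \<Longrightarrow> j \<in> {1..N} \<Longrightarrow> (\<lambda>\<omega>. a \<omega> i j) \<in> borel_measurable M"
    and v: "\<And>i. i \<in> {1..N} \<Longrightarrow> (\<lambda>\<omega>. v \<omega> i) \<in> borel_measurable M"
    and i: "i \<in> {1..N}"
  shows "(\<lambda>\<omega>. clipped_field Q N d (a \<omega>) (v \<omega>) i) \<in> borel_measurable M"
proof -
  have "(\<lambda>\<omega>. clip (v \<omega> i)) \<in> borel_measurable M" if "i \<in> {1..N}" for i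
    using v[OF that] by measurable
  then show ?thesis
    unfolding clipped_field_def using i
    by (intro rate_field_measurable Q local_density_measurable a)
qed

text \<open>Only \<open>z 0\<close> is assumed to be measurable, while convergence in probability
  demands measurability of the supremum over time.\<close>

lemma NIMFA_measurable:
  fixes Q :: "real^'s \<Rightarrow> real^'s^'s"
  assumes Q: "\<And>k s. locally_lipschitz (\<lambda>\<phi>. Q \<phi> $ k $ s)"
    and graph: "\<And>\<omega>. \<omega> \<in> space M \<Longrightarrow> weighted_graph N d (a \<omega>)"
    and a: "\<And>i j. i \<in> {1..N} \<Longrightarrow> j \<in> {1..N} \<Longrightarrow> (\<lambda>\<omega>. a \<omega> i j) \<in> borel_measurable M"
    and z0: "\<And>i. i \<in> {1..N} \<Longrightarrow> (\<lambda>\<omega>. z 0 \<omega> i) \<in> borel_measurable M"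
    and z: "\<And>\<omega>. \<omega> \<in> space M \<Longrightarrow> NIMFA_solution Q N d (a \<omega>) (\<lambda>t. z t \<omega>)"
    and t: "0 \<le> t" and i: "i \<in> {1..N}"
  shows "(\<lambda>\<omega>. z t \<omega> i) \<in> borel_measurable M"
proof (rule borel_measurable_LIMSEQ_metric)
  have "(\<lambda>\<omega>. euler (clipped_field Q N d (a \<omega>)) h (z 0 \<omega>) k i) \<in> borel_measurable M"
    if "i \<in> {1..N}" for h k i
    using that
  proof (induction k arbitrary: i)
    case (Suc k)
    then show ?case
      unfolding euler.simps
      by (intro borel_measurable_add borel_measurable_scaleR borel_measurable_const Suc
          clipped_field_measurable Q a)
  qed (simp add: z0)
  then show "(\<lambda>\<omega>. euler (clipped_field Q N d (a \<omega>)) (t / real (Suc m)) (z 0 \<omega>) (Suc m) i)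
      \<in> borel_measurable M" for m
    using i .
  show "(\<lambda>m. euler (clipped_field Q N d (a \<omega>)) (t / real (Suc m)) (z 0 \<omega>) (Suc m) i) \<longlonglongrightarrow> z t \<omega> i"
    if "\<omega> \<in> space M" for \<omega>
    using weighted_graph.NIMFA_euler_converges[OF graph[OF that] Q z[OF that] t i] .
qed

section \<open>The random graph\<close>

text \<open>Cross terms vanish, so the second moment of the sum is at most
  \<open>n * v\<^sup>2\<close>, and its root bounds the mean absolute value.\<close>

lemma (in prob_space) integral_abs_orthogonal_sum_le:
  fixes P :: "'i \<Rightarrow> 'a \<Rightarrow> real"
  assumes I: "finite I" and meas: "\<And>i. i \<in> I \<Longrightarrow> P i \<in> borel_measurable M"
    and int: "\<And>i j. i \<in> I \<Longrightarrow> j \<in> I \<Longrightarrow> integrable M (\<lambda>\<omega>. P i \<omega> * P j \<omega>)"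
    and orth: "\<And>i j. i \<in> I \<Longrightarrow> j \<in> I \<Longrightarrow> i \<noteq> j \<Longrightarrow> (\<integral>\<omega>. P i \<omega> * P j \<omega> \<partial>M) = 0"
    and sq: "\<And>i. i \<in> I \<Longrightarrow> (\<integral>\<omega>. P i \<omega> * P i \<omega> \<partial>M) \<le> v\<^sup>2" and v: "0 < v"
    and n: "real (card I) \<le> n" "0 < n"
  shows "integrable M (\<lambda>\<omega>. \<Sum>i\<in>I. P i \<omega>)"
    and "(\<integral>\<omega>. \<bar>\<Sum>i\<in>I. P i \<omega>\<bar> \<partial>M) \<le> sqrt n * v"
proof -
  have intP: "integrable M (P i)" if "i \<in> I" for i
    using int[OF that that] meas[OF that] by (auto intro!: square_integrable_imp_integrable[of "P i"] simp: power2_eq_square)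
  show intS: "integrable M (\<lambda>\<omega>. \<Sum>i\<in>I. P i \<omega>)"
    using intP by auto
  have sq_eq: "(\<Sum>i\<in>I. P i \<omega>)\<^sup>2 = (\<Sum>i\<in>I. \<Sum>j\<in>I. P i \<omega> * P j \<omega>)" for \<omega>
    by (simp add: power2_eq_square sum_product)
  have int2: "integrable M (\<lambda>\<omega>. (\<Sum>i\<in>I. P i \<omega>)\<^sup>2)"
    unfolding sq_eq using int by auto
  have "(\<integral>\<omega>. (\<Sum>i\<in>I. P i \<omega>)\<^sup>2 \<partial>M) = (\<Sum>i\<in>I. \<Sum>j\<in>I. \<integral>\<omega>. P i \<omega> * P j \<omega> \<partial>M)"
    unfolding sq_eq using int by (simp add: Bochner_Integration.integral_sum)
  also have "\<dots> = (\<Sum>i\<in>I. \<integral>\<omega>. P i \<omega> * P i \<omega> \<partial>M)"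
  proof (rule sum.cong[OF refl])
    fix i assume i: "i \<in> I"
    have "(\<Sum>j\<in>I - {i}. \<integral>\<omega>. P i \<omega> * P j \<omega> \<partial>M) = 0"
      using orth i by (intro sum.neutral) auto
    then show "(\<Sum>j\<in>I. \<integral>\<omega>. P i \<omega> * P j \<omega> \<partial>M) = (\<integral>\<omega>. P i \<omega> * P i \<omega> \<partial>M)"
      using I i by (simp add: sum.remove)
  qed
  also have "\<dots> \<le> real (card I) * v\<^sup>2"
    using sum_bounded_above[of I "\<lambda>i. \<integral>\<omega>. P i \<omega> * P i \<omega> \<partial>M" "v\<^sup>2"] sq by simp
  also have "\<dots> \<le> n * v\<^sup>2"
    using n by (intro mult_right_mono) auto
  finally have E2: "(\<integral>\<omega>. (\<Sum>i\<in>I. P i \<omega>)\<^sup>2 \<partial>M) \<le> (sqrt n * v)\<^sup>2"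
    using n by (simp add: power_mult_distrib)
  \<comment> \<open>For every positive \<open>\<theta>\<close>, the absolute value of a number is at
    most its square over \<open>2 * \<theta>\<close> plus \<open>\<theta> / 2\<close>. This choice
    makes the mean of each term at most \<open>\<theta> / 2\<close>.\<close>
  define \<theta> where "\<theta> = sqrt n * v"
  have \<theta>: "0 < \<theta>" using n v by (simp add: \<theta>_def)
  have "(\<integral>\<omega>. \<bar>\<Sum>i\<in>I. P i \<omega>\<bar> \<partial>M) \<le> (\<integral>\<omega>. (\<Sum>i\<in>I. P i \<omega>)\<^sup>2 / (2 * \<theta>) + \<theta> / 2 \<partial>M)"
  proof (rule integral_mono)
    fix \<omega>
    let ?x = "\<bar>\<Sum>i\<in>I. P i \<omega>\<bar>"
    have "2 * ?x * \<theta> \<le> ?x\<^sup>2 + \<theta>\<^sup>2"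
      by (rule sum_squares_bound)
    then show "?x \<le> (\<Sum>i\<in>I. P i \<omega>)\<^sup>2 / (2 * \<theta>) + \<theta> / 2"
      using \<theta> by (simp add: field_simps power2_eq_square)
  qed (use intS int2 in auto)
  also have "\<dots> = (\<integral>\<omega>. (\<Sum>i\<in>I. P i \<omega>)\<^sup>2 \<partial>M) / (2 * \<theta>) + \<theta> / 2"
    using int2 by (simp add: prob_space)
  also have "\<dots> \<le> \<theta>\<^sup>2 / (2 * \<theta>) + \<theta> / 2"
    using E2 \<theta> by (intro add_right_mono divide_right_mono) (auto simp: \<theta>_def)
  also have "\<dots> = \<theta>"
    using \<theta> by (simp add: power2_eq_square)
  finally show "(\<integral>\<omega>. \<bar>\<Sum>i\<in>I. P i \<omega>\<bar> \<partial>M) \<le> sqrt n * v"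
    by (simp add: \<theta>_def)
qed

section \<open>Edge variables of the random graph and their moments\<close>

locale er_graph = prob_space M for M :: "'w measure" +
  fixes D :: "real measure" and p :: real and N :: nat and w b :: "nat \<Rightarrow> nat \<Rightarrow> 'w \<Rightarrow> real"
  assumes D: "weight_law D" and p: "0 < p" "p \<le> 1" and ER: "weighted_ER M D p N w b" and N2: "2 \<le> N"
begin

abbreviation "\<mu> \<equiv> (\<integral>x. x \<partial>D)"
abbreviation "m2 \<equiv> (\<integral>x. x\<^sup>2 \<partial>D)"
abbreviation "deg \<equiv> mean_degree D p N"
abbreviation "adj \<omega> \<equiv> (\<lambda>i j. edge_weight w b i j \<omega>)"

definition edge_var :: "nat \<times> nat \<Rightarrow> 'w \<Rightarrow> real" where
  "edge_var e \<omega> = w (fst e) (snd e) \<omega> * b (fst e) (snd e) \<omega>"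

definition pair_of :: "nat \<Rightarrow> nat \<Rightarrow> nat \<times> nat" where
  "pair_of i j = (min i j, max i j)"

lemma \<mu>_pos: "0 < \<mu>" and int_D: "integrable D (\<lambda>x. x)" and int_D2: "integrable D (\<lambda>x. x\<^sup>2)"
  and m2_pos: "0 < m2"
proof -
  interpret PD: prob_space D using D by (simp add: weight_law_def)
  show "0 < \<mu>" and i1: "integrable D (\<lambda>x. x)"
    using D by (auto simp: weight_law_def)
  have "integrable D (\<lambda>x. (x - \<mu>)\<^sup>2 + 2 * \<mu> * x - \<mu>\<^sup>2)"
    using D i1 by (auto simp: weight_law_def)
  then show i2: "integrable D (\<lambda>x. x\<^sup>2)"
    by (simp add: power2_diff algebra_simps power2_eq_square)
  have "0 \<le> PD.variance (\<lambda>x. x)"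
    by simp
  then have "\<mu>\<^sup>2 \<le> m2"
    using PD.variance_eq[of "\<lambda>x. x"] i1 i2 by simp
  then show "0 < m2"
    using \<open>0 < \<mu>\<close> by (smt (verit) zero_less_power)
qed

lemma deg_pos: "0 < deg"
  using N2 p \<mu>_pos by (simp add: mean_degree_def)

lemma edge_facts:
  assumes "e \<in> vertex_pairs N"
  shows "w (fst e) (snd e) \<in> borel_measurable M" "b (fst e) (snd e) \<in> borel_measurable M"
    and "distr M borel (w (fst e) (snd e)) = D"
    and "prob {\<omega> \<in> space M. b (fst e) (snd e) \<omega> = 1} = p"
    and "\<omega> \<in> space M \<Longrightarrow> 0 \<le> w (fst e) (snd e) \<omega>"
    and "\<omega> \<in> space M \<Longrightarrow> b (fst e) (snd e) \<omega> = 0 \<or> b (fst e) (snd e) \<omega> = 1"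
proof -
  have rv: "case_sum (\<lambda>(i, j). w i j) (\<lambda>(i, j). b i j) k \<in> borel_measurable M"
    if "k \<in> vertex_pairs N <+> vertex_pairs N" for k
    using ER that unfolding weighted_ER_def indep_vars_def by blast
  show "w (fst e) (snd e) \<in> borel_measurable M" "b (fst e) (snd e) \<in> borel_measurable M"
    using rv[of "Inl e"] rv[of "Inr e"] assms by (auto simp: case_prod_beta)
qed (use ER assms in \<open>auto simp: weighted_ER_def case_prod_beta\<close>)

lemma indep_factors:
  "indep_vars (\<lambda>_. borel) (case_sum (\<lambda>(i, j). w i j) (\<lambda>(i, j). b i j)) (vertex_pairs N <+> vertex_pairs N)"
  using ER by (simp add: weighted_ER_def)

text \<open>The factors of different edges form disjoint blocks \<open>{Inl e, Inr e}\<close> of the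
  independent family, and functions of disjoint blocks are independent.\<close>

lemma indep_edge_var: "indep_vars (\<lambda>_. borel) edge_var (vertex_pairs N)"
proof -
  let ?X = "case_sum (\<lambda>(i, j). w i j) (\<lambda>(i, j). b i j)"
  let ?K = "\<lambda>e. {Inl e, Inr e}"
  have "indep_vars (\<lambda>e. Pi\<^sub>M (?K e) (\<lambda>_. borel)) (\<lambda>e \<omega>. restrict (\<lambda>k. ?X k \<omega>) (?K e)) (vertex_pairs N)"
    by (rule indep_vars_restrict[OF indep_factors]) (auto simp: disjoint_family_on_def)
  then have "indep_vars (\<lambda>_. borel)
      (\<lambda>e \<omega>. (\<lambda>f. f (Inl e) * f (Inr e)) (restrict (\<lambda>k. ?X k \<omega>) (?K e))) (vertex_pairs N)"
    by (rule indep_vars_compose2) (auto intro!: borel_measurable_times measurable_component_singleton)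
  then show ?thesis
    by (rule indep_vars_cong[THEN iffD1, rotated -1]) (auto simp: edge_var_def case_prod_beta fun_eq_iff)
qed

text \<open>One computation for the powers 1 and 2. Positive powers of a 0/1 variable equal the
  variable, so the second moment is linear in \<open>p\<close>, not quadratic; this keeps
  \<open>dev_var\<close> of order \<open>1 / (N * deg)\<close>.\<close>

lemma edge_var_moments:
  assumes e: "e \<in> vertex_pairs N"
  shows "integrable M (edge_var e)" "expectation (edge_var e) = \<mu> * p"
    and "integrable M (\<lambda>\<omega>. (edge_var e \<omega>)\<^sup>2)" "expectation (\<lambda>\<omega>. (edge_var e \<omega>)\<^sup>2) = m2 * p"
proof -
  let ?X = "case_sum (\<lambda>(i, j). w i j) (\<lambda>(i, j). b i j)"
  let ?w = "w (fst e) (snd e)" and ?b = "b (fst e) (snd e)"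
  note [measurable] = edge_facts(1,2)[OF e]
  have iw: "integrable M (\<lambda>\<omega>. ?w \<omega> ^ n)" "expectation (\<lambda>\<omega>. ?w \<omega> ^ n) = (\<integral>x. x ^ n \<partial>D)"
    if "integrable D (\<lambda>x. x ^ n)" for n
    using that unfolding edge_facts(3)[OF e, symmetric]
    by (simp_all add: integrable_distr_eq integral_distr)
  have bn: "?b \<omega> ^ n = indicator {\<omega> \<in> space M. ?b \<omega> = 1} \<omega>" if "\<omega> \<in> space M" "0 < n" for \<omega> n
    using edge_facts(6)[OF e that(1)] that by (auto simp: indicator_def)
  have ib: "integrable M (\<lambda>\<omega>. ?b \<omega> ^ n) \<and> expectation (\<lambda>\<omega>. ?b \<omega> ^ n) = p"
    if "0 < n" for n
  proof -
    let ?A = "{\<omega> \<in> space M. ?b \<omega> = 1}"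
    have "?A \<in> events" by measurable
    then have "integrable M (indicat_real ?A)" "expectation (indicat_real ?A) = p"
      using edge_facts(4)[OF e] by (simp_all add: less_top[symmetric])
    then show ?thesis
      using that bn
      by (auto cong: Bochner_Integration.integrable_cong Bochner_Integration.integral_cong)
  qed
  have ind: "indep_vars (\<lambda>_. borel) (\<lambda>k \<omega>. ?X k \<omega> ^ n) {Inl e, Inr e}" for n
  proof -
    have "indep_vars (\<lambda>_. borel) ?X {Inl e, Inr e}"
      using e by (intro indep_vars_subset[OF indep_factors]) auto
    then show ?thesis
      by (rule indep_vars_compose2) measurable
  qed
  have int: "integrable M (\<lambda>\<omega>. ?X k \<omega> ^ n)" if "k \<in> {Inl e, Inr e}" "integrable D (\<lambda>x. x ^ n)" "0 < n" for k n
    using iw(1)[OF that(2)] ib[OF that(3)] that(1) by (auto simp: case_prod_beta)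
  have prod: "integrable M (\<lambda>\<omega>. (edge_var e \<omega>) ^ n)"
      "expectation (\<lambda>\<omega>. (edge_var e \<omega>) ^ n) = (\<integral>x. x ^ n \<partial>D) * p"
    if n: "integrable D (\<lambda>x. x ^ n)" "0 < n" for n
    using indep_vars_integrable[OF _ ind int[OF _ n]] indep_vars_lebesgue_integral[OF _ ind int[OF _ n]]
      iw(2)[OF n(1)] ib[OF n(2)]
    by (simp_all add: edge_var_def power_mult_distrib case_prod_beta)
  show "integrable M (edge_var e)" "expectation (edge_var e) = \<mu> * p"
    using prod[of 1] int_D by simp_all
  show "integrable M (\<lambda>\<omega>. (edge_var e \<omega>)\<^sup>2)" "expectation (\<lambda>\<omega>. (edge_var e \<omega>)\<^sup>2) = m2 * p"
    using prod[of 2] int_D2 by simp_all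
qed

definition dev :: "nat \<times> nat \<Rightarrow> 'w \<Rightarrow> real" where
  "dev e \<omega> = edge_var e \<omega> / deg - 1 / (real N - 1)"

text \<open>The bound \<open>m2 * p / deg\<^sup>2\<close> for the second moment of
  \<open>dev e\<close>, rewritten with \<open>\<mu> * p / deg = 1 / (N - 1)\<close>.\<close>

definition dev_var :: real where
  "dev_var = m2 / ((real N - 1) * \<mu> * deg)"

lemma dev_var_pos: "0 < dev_var"
  using m2_pos \<mu>_pos deg_pos N2 by (simp add: dev_var_def)

lemma indep_dev: "indep_vars (\<lambda>_. borel) dev (vertex_pairs N)"
  unfolding dev_def by (rule indep_vars_compose2[OF indep_edge_var]) measurable

lemma dev_moments:
  assumes e: "e \<in> vertex_pairs N"
  shows "integrable M (dev e)" "expectation (dev e) = 0"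
    and "integrable M (\<lambda>\<omega>. (dev e \<omega>)\<^sup>2)" "expectation (\<lambda>\<omega>. (dev e \<omega>)\<^sup>2) \<le> dev_var"
proof -
  note m = edge_var_moments[OF e]
  show "integrable M (dev e)"
    using m unfolding dev_def by auto
  have mp: "\<mu> * p / deg = 1 / (real N - 1)"
    using deg_pos \<mu>_pos p N2 by (simp add: mean_degree_def)
  show "expectation (dev e) = 0"
    using m mp unfolding dev_def by (simp add: prob_space)
  have eq: "(dev e \<omega>)\<^sup>2 = (edge_var e \<omega>)\<^sup>2 / deg\<^sup>2 - 2 / (real N - 1) / deg * edge_var e \<omega> + 1 / (real N - 1)\<^sup>2" for \<omega>
    by (simp add: dev_def power2_diff power_divide)
  show "integrable M (\<lambda>\<omega>. (dev e \<omega>)\<^sup>2)"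
    unfolding eq using m by auto
  have "expectation (\<lambda>\<omega>. (dev e \<omega>)\<^sup>2) = m2 * p / deg\<^sup>2 - 2 / (real N - 1) * (\<mu> * p / deg) + 1 / (real N - 1)\<^sup>2"
    unfolding eq using m by (simp add: prob_space)
  also have "\<dots> = m2 * p / deg\<^sup>2 - 1 / (real N - 1)\<^sup>2"
    unfolding mp by (simp add: power2_eq_square)
  also have "\<dots> \<le> m2 * p / deg\<^sup>2" by simp
  also have "\<dots> = m2 * (\<mu> * p / deg) / (\<mu> * deg)"
    using \<mu>_pos by (simp add: power2_eq_square)
  also have "\<dots> = dev_var"
    unfolding mp dev_var_def by simp
  finally show "expectation (\<lambda>\<omega>. (dev e \<omega>)\<^sup>2) \<le> dev_var" .
qed

lemma pair_of_in: "i \<in> {1..N} \<Longrightarrow> j \<in> {1..N} \<Longrightarrow> i \<noteq> j \<Longrightarrow> pair_of i j \<in> vertex_pairs N"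
  by (auto simp: pair_of_def vertex_pairs_def min_def max_def)

lemma pair_of_eq_iff: "pair_of i j = pair_of k l \<longleftrightarrow> i = k \<and> j = l \<or> i = l \<and> j = k"
  by (auto simp: pair_of_def min_def max_def split: if_splits)

lemma edge_weight_pair_of: "i \<noteq> j \<Longrightarrow> edge_weight w b i j \<omega> = edge_var (pair_of i j) \<omega>"
  by (auto simp: edge_weight_def edge_var_def pair_of_def)

lemma weighted_graph_adj:
  assumes "\<omega> \<in> space M" shows "weighted_graph N deg (adj \<omega>)"
proof
  fix i j assume ij: "i \<in> {1..N}" "j \<in> {1..N}"
  show "0 \<le> adj \<omega> i j"
  proof (cases "i = j")
    case False
    then show ?thesis
      using edge_facts(5,6)[OF pair_of_in[OF ij False] assms]
      by (auto simp: edge_weight_pair_of edge_var_def)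
  qed (simp add: edge_weight_def)
qed (auto simp: N2 deg_pos edge_weight_def)

lemma adj_measurable [measurable]:
  assumes "i \<in> {1..N}" "j \<in> {1..N}"
  shows "(\<lambda>\<omega>. adj \<omega> i j) \<in> borel_measurable M"
proof (cases "i = j")
  case False
  then show ?thesis
    using edge_var_moments(1)[OF pair_of_in[OF assms False]] by (simp add: edge_weight_pair_of)
qed (simp add: edge_weight_def)

section \<open>Expected discrepancy of the random graph\<close>

definition cent :: "nat \<Rightarrow> nat \<Rightarrow> 'w \<Rightarrow> real" where
  "cent i j \<omega> = (if i = j then 0 else dev (pair_of i j) \<omega>)"

lemma centered_eq: "\<omega> \<in> space M \<Longrightarrow> weighted_graph.centered N deg (adj \<omega>) i j = cent i j \<omega>"
  by (simp add: weighted_graph.centered_def[OF weighted_graph_adj] cent_def dev_def edge_weight_pair_of)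

text \<open>For \<open>i \<noteq> l\<close>, both outside \<open>{j, k}\<close>, the four pairs are
  the edges of a 4-cycle, hence distinct, and independence factors the mean into zeros. For
  \<open>i = l\<close> the product consists of the squares of two distinct edges, so second moments
  suffice.\<close>

lemma cent_prod_moments:
  assumes ij: "i \<in> {1..N}" "j \<in> {1..N}" "k \<in> {1..N}" "l \<in> {1..N}" and "j \<noteq> k"
  shows "integrable M (\<lambda>\<omega>. (cent i j \<omega> * cent i k \<omega>) * (cent l j \<omega> * cent l k \<omega>))"
    and "i \<noteq> l \<Longrightarrow> expectation (\<lambda>\<omega>. (cent i j \<omega> * cent i k \<omega>) * (cent l j \<omega> * cent l k \<omega>)) = 0"
    and "i = l \<Longrightarrow> expectation (\<lambda>\<omega>. (cent i j \<omega> * cent i k \<omega>) * (cent l j \<omega> * cent l k \<omega>)) \<le> dev_var\<^sup>2"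
proof -
  let ?P = "\<lambda>\<omega>. (cent i j \<omega> * cent i k \<omega>) * (cent l j \<omega> * cent l k \<omega>)"
  have "integrable M ?P \<and> (if i = l then expectation ?P \<le> dev_var\<^sup>2 else expectation ?P = 0)"
  \<comment> \<open>If \<open>i\<close> or \<open>l\<close> coincides with \<open>j\<close> or
    \<open>k\<close>, one factor lies on the diagonal and the product is zero.\<close>
  proof (cases "i \<in> {j, k} \<or> l \<in> {j, k}")
    case True
    then have eq: "?P = (\<lambda>\<omega>. 0)" by (auto simp: cent_def)
    show ?thesis unfolding eq by simp
  next
    case False
    let ?e1 = "pair_of i j" and ?e2 = "pair_of i k" and ?e3 = "pair_of l j" and ?e4 = "pair_of l k"
    have in_E: "?e1 \<in> vertex_pairs N" "?e2 \<in> vertex_pairs N" "?e3 \<in> vertex_pairs N" "?e4 \<in> vertex_pairs N"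
      using ij False by (auto intro!: pair_of_in)
    show ?thesis
    proof (cases "i = l")
      case True
      let ?E = "{?e1, ?e2}"
      have ne: "?e1 \<noteq> ?e2" using assms(5) False by (auto simp: pair_of_eq_iff)
      have sub: "?E \<subseteq> vertex_pairs N" using in_E by auto
      have ind: "indep_vars (\<lambda>_. borel) (\<lambda>e \<omega>. (dev e \<omega>)\<^sup>2) ?E"
        by (rule indep_vars_compose2[OF indep_vars_subset[OF indep_dev sub]]) measurable
      have int: "integrable M (\<lambda>\<omega>. (dev e \<omega>)\<^sup>2)" if "e \<in> ?E" for e
        using that sub by (intro dev_moments) auto
      have eq: "?P = (\<lambda>\<omega>. \<Prod>e\<in>?E. (dev e \<omega>)\<^sup>2)"
        using ne True False by (auto simp: cent_def power2_eq_square)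
      have "expectation ?P = expectation (\<lambda>\<omega>. (dev ?e1 \<omega>)\<^sup>2) * expectation (\<lambda>\<omega>. (dev ?e2 \<omega>)\<^sup>2)"
        unfolding eq using indep_vars_lebesgue_integral[OF _ ind int] ne by simp
      also have "\<dots> \<le> dev_var * dev_var"
        using dev_moments(4) in_E dev_var_pos by (intro mult_mono) auto
      finally have "expectation ?P \<le> dev_var\<^sup>2"
        by (simp add: power2_eq_square)
      moreover have "integrable M ?P"
        unfolding eq by (rule indep_vars_integrable[OF _ ind int]) simp_all
      ultimately show ?thesis using True by simp
    next
      case il: False
      let ?E = "{?e1, ?e2, ?e3, ?e4}"
      have ne: "?e1 \<noteq> ?e2" "?e1 \<noteq> ?e3" "?e1 \<noteq> ?e4" "?e2 \<noteq> ?e3" "?e2 \<noteq> ?e4" "?e3 \<noteq> ?e4"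
        using assms(5) False il by (auto simp: pair_of_eq_iff)
      have sub: "?E \<subseteq> vertex_pairs N" using in_E by auto
      have ind: "indep_vars (\<lambda>_. borel) dev ?E"
        by (rule indep_vars_subset[OF indep_dev sub])
      have int: "integrable M (dev e)" if "e \<in> ?E" for e
        using that sub by (intro dev_moments) auto
      have eq: "?P = (\<lambda>\<omega>. \<Prod>e\<in>?E. dev e \<omega>)"
        using ne False by (auto simp: cent_def)
      have "expectation ?P = (\<Prod>e\<in>?E. expectation (dev e))"
        unfolding eq using indep_vars_lebesgue_integral[OF _ ind int] by simp
      also have "\<dots> = 0"
        using dev_moments(2)[OF in_E(1)] by (intro prod_zero) auto
      finally have "expectation ?P = 0" .
      moreover have "integrable M ?P"
        unfolding eq by (rule indep_vars_integrable[OF _ ind int]) simp_all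
      ultimately show ?thesis using il by simp
    qed
  qed
  then show "integrable M ?P" "i \<noteq> l \<Longrightarrow> expectation ?P = 0" "i = l \<Longrightarrow> expectation ?P \<le> dev_var\<^sup>2"
    by (auto split: if_splits)
qed

lemma cent_measurable:
  assumes "i \<in> {1..N}" "j \<in> {1..N}"
  shows "cent i j \<in> borel_measurable M"
proof (cases "i = j")
  case False
  then show ?thesis
    using dev_moments(1)[OF pair_of_in[OF assms False]] by (simp add: cent_def[abs_def])
qed (simp add: cent_def[abs_def])

lemma cent_sum_off_diagonal:
  assumes jk: "j \<in> {1..N}" "k \<in> {1..N}" "j \<noteq> k"
  shows "integrable M (\<lambda>\<omega>. \<Sum>i\<in>{1..N}. cent i j \<omega> * cent i k \<omega>)"
    and "expectation (\<lambda>\<omega>. \<bar>\<Sum>i\<in>{1..N}. cent i j \<omega> * cent i k \<omega>\<bar>) \<le> sqrt (real N) * dev_var"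
proof -
  note m = cent_prod_moments[OF _ jk(1,2) _ jk(3)]
  have n: "real (card {1..N}) \<le> real N" "0 < real N" using N2 by auto
  have meas: "(\<lambda>\<omega>. cent i j \<omega> * cent i k \<omega>) \<in> borel_measurable M" if "i \<in> {1..N}" for i
    using that jk by (intro borel_measurable_times cent_measurable)
  show "integrable M (\<lambda>\<omega>. \<Sum>i\<in>{1..N}. cent i j \<omega> * cent i k \<omega>)"
    by (rule integral_abs_orthogonal_sum_le(1)[OF finite_atLeastAtMost meas m(1) m(2) m(3) dev_var_pos n]) auto
  show "expectation (\<lambda>\<omega>. \<bar>\<Sum>i\<in>{1..N}. cent i j \<omega> * cent i k \<omega>\<bar>) \<le> sqrt (real N) * dev_var"
    by (rule integral_abs_orthogonal_sum_le(2)[OF finite_atLeastAtMost meas m(1) m(2) m(3) dev_var_pos n]) auto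
qed

lemma cent_sum_diagonal:
  assumes j: "j \<in> {1..N}"
  shows "integrable M (\<lambda>\<omega>. \<Sum>i\<in>{1..N}. cent i j \<omega> * cent i j \<omega>)"
    and "expectation (\<lambda>\<omega>. \<bar>\<Sum>i\<in>{1..N}. cent i j \<omega> * cent i j \<omega>\<bar>) \<le> real N * dev_var"
proof -
  have c: "integrable M (\<lambda>\<omega>. cent i j \<omega> * cent i j \<omega>) \<and> expectation (\<lambda>\<omega>. cent i j \<omega> * cent i j \<omega>) \<le> dev_var"
    if i: "i \<in> {1..N}" for i
  proof (cases "i = j")
    case False
    then show ?thesis
      using dev_moments(3,4)[OF pair_of_in[OF i j False]] by (simp add: cent_def power2_eq_square)
  qed (use dev_var_pos in \<open>simp add: cent_def\<close>)
  then show "integrable M (\<lambda>\<omega>. \<Sum>i\<in>{1..N}. cent i j \<omega> * cent i j \<omega>)"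
    by auto
  have "expectation (\<lambda>\<omega>. \<bar>\<Sum>i\<in>{1..N}. cent i j \<omega> * cent i j \<omega>\<bar>)
      = (\<Sum>i\<in>{1..N}. expectation (\<lambda>\<omega>. cent i j \<omega> * cent i j \<omega>))"
    using c by (simp add: sum_nonneg Bochner_Integration.integral_sum)
  also have "\<dots> \<le> real (card {1..N}) * dev_var"
    using c by (intro sum_bounded_above) auto
  finally show "expectation (\<lambda>\<omega>. \<bar>\<Sum>i\<in>{1..N}. cent i j \<omega> * cent i j \<omega>\<bar>) \<le> real N * dev_var"
    by simp
qed

definition graph_disc :: "'w \<Rightarrow> real" where
  "graph_disc \<omega> = weighted_graph.discrepancy N deg (adj \<omega>)"

text \<open>After summation and division by \<open>N\<close> the off-diagonal entries dominate with
  \<open>N * sqrt N * dev_var\<close>. This is where the exponent 1/2 in the growth condition on the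
  mean degree comes from.\<close>

lemma graph_disc_expectation:
  shows "integrable M graph_disc" and "expectation graph_disc \<le> 4 * sqrt (real N) * m2 / (\<mu> * deg)"
proof -
  let ?s = "\<lambda>j k \<omega>. \<bar>\<Sum>i\<in>{1..N}. cent i j \<omega> * cent i k \<omega>\<bar>"
  have eq: "graph_disc \<omega> = (\<Sum>j\<in>{1..N}. \<Sum>k\<in>{1..N}. ?s j k \<omega>) / real N" if "\<omega> \<in> space M" for \<omega>
    using that by (simp add: graph_disc_def weighted_graph.discrepancy_def[OF weighted_graph_adj] centered_eq)
  have s: "integrable M (?s j k) \<and> expectation (?s j k) \<le> (if k = j then real N * dev_var else sqrt (real N) * dev_var)"
    if "j \<in> {1..N}" "k \<in> {1..N}" for j k
    using cent_sum_diagonal[OF that(1)] cent_sum_off_diagonal[OF that] by auto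
  have int: "integrable M (\<lambda>\<omega>. (\<Sum>j\<in>{1..N}. \<Sum>k\<in>{1..N}. ?s j k \<omega>) / real N)"
    by (intro integrable_divide Bochner_Integration.integrable_sum) (use s in blast)
  then show "integrable M graph_disc"
    using eq by (simp cong: Bochner_Integration.integrable_cong)
  have "expectation graph_disc = (\<Sum>j\<in>{1..N}. \<Sum>k\<in>{1..N}. expectation (?s j k)) / real N"
  proof -
    have "expectation graph_disc = expectation (\<lambda>\<omega>. (\<Sum>j\<in>{1..N}. \<Sum>k\<in>{1..N}. ?s j k \<omega>) / real N)"
      using eq by (rule Bochner_Integration.integral_cong[OF refl])
    also have "\<dots> = expectation (\<lambda>\<omega>. \<Sum>j\<in>{1..N}. \<Sum>k\<in>{1..N}. ?s j k \<omega>) / real N"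
      by (rule integral_divide_zero)
    also have "expectation (\<lambda>\<omega>. \<Sum>j\<in>{1..N}. \<Sum>k\<in>{1..N}. ?s j k \<omega>)
        = (\<Sum>j\<in>{1..N}. expectation (\<lambda>\<omega>. \<Sum>k\<in>{1..N}. ?s j k \<omega>))"
      by (intro Bochner_Integration.integral_sum Bochner_Integration.integrable_sum) (use s in blast)
    also have "\<dots> = (\<Sum>j\<in>{1..N}. \<Sum>k\<in>{1..N}. expectation (?s j k))"
      by (intro sum.cong refl Bochner_Integration.integral_sum) (use s in blast)
    finally show ?thesis .
  qed
  also have "\<dots> \<le> (\<Sum>j\<in>{1..N}. real N * dev_var + real N * (sqrt (real N) * dev_var)) / real N"
  proof (intro divide_right_mono sum_mono)
    fix j assume j: "j \<in> {1..N}"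
    have "(\<Sum>k\<in>{1..N}. expectation (?s j k))
        \<le> (\<Sum>k\<in>{1..N}. (if k = j then real N * dev_var else 0) + sqrt (real N) * dev_var)"
      using s[OF j] dev_var_pos by (intro sum_mono order_trans[OF conjunct2[OF s[OF j]]]) auto
    also have "\<dots> = real N * dev_var + real N * (sqrt (real N) * dev_var)"
      using j by (simp add: sum.distrib)
    finally show "(\<Sum>k\<in>{1..N}. expectation (?s j k)) \<le> real N * dev_var + real N * (sqrt (real N) * dev_var)" .
  qed simp
  also have "\<dots> = real N * (1 + sqrt (real N)) * dev_var"
    using N2 by (simp only: sum_constant card_atLeastAtMost) (simp add: field_simps)
  \<comment> \<open>\<open>N \<le> 2 * (N - 1)\<close> because \<open>N \<ge> 2\<close>, and
    \<open>1 + sqrt N \<le> 2 * sqrt N\<close>; the factor \<open>N - 1\<close> then cancels against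
    \<open>dev_var\<close>.\<close>
  also have "\<dots> \<le> (2 * (real N - 1)) * (2 * sqrt (real N)) * dev_var"
    using N2 dev_var_pos by (intro mult_right_mono mult_mono) auto
  also have "\<dots> = 4 * sqrt (real N) * m2 / (\<mu> * deg)"
    using N2 \<mu>_pos deg_pos by (simp add: dev_var_def field_simps)
  finally show "expectation graph_disc \<le> 4 * sqrt (real N) * m2 / (\<mu> * deg)" .
qed

lemma prob_graph_disc_gt:
  assumes "0 < \<delta>"
  shows "prob {\<omega> \<in> space M. graph_disc \<omega> > \<delta>} \<le> 4 * m2 / (\<mu> * \<delta>) * (sqrt (real N) / deg)"
proof -
  note g = graph_disc_expectation
  have [measurable]: "graph_disc \<in> borel_measurable M" using g(1) by auto
  have "prob {\<omega> \<in> space M. graph_disc \<omega> > \<delta>} \<le> prob {\<omega> \<in> space M. graph_disc \<omega> \<ge> \<delta>}"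
    by (intro finite_measure_mono) auto
  also have "\<dots> \<le> expectation graph_disc / \<delta>"
    using integral_Markov_inequality_measure[OF g(1), of "{}" \<delta>] assms
      weighted_graph.discrepancy_nonneg[OF weighted_graph_adj]
    unfolding graph_disc_def[abs_def] by simp
  also have "\<dots> \<le> (4 * sqrt (real N) * m2 / (\<mu> * deg)) / \<delta>"
    using g(2) assms by (intro divide_right_mono) auto
  finally show ?thesis
    using assms by (simp add: field_simps)
qed

end

section \<open>Markov chains and a maximal inequality\<close>

text \<open>\<open>R\<close> bounds the operator norm of \<open>L\<close> for the supremum norm. The
  induction keeps \<open>x\<close> general because the recursion multiplies from the left.\<close>

lemma matrix_power_on_sum_bound:
  assumes E: "finite E" and R: "\<And>x. x \<in> E \<Longrightarrow> (\<Sum>v\<in>E. \<bar>L x v\<bar>) \<le> R"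
    and g: "\<And>y. y \<in> E \<Longrightarrow> \<bar>g y\<bar> \<le> B" and x: "x \<in> E"
  shows "\<bar>\<Sum>y\<in>E. matrix_power_on E L n x y * g y\<bar> \<le> R ^ n * B"
  using x
proof (induction n arbitrary: x)
  case 0
  have "(\<Sum>y\<in>E. matrix_power_on E L 0 x y * g y) = (\<Sum>y\<in>E. if x = y then g y else 0)"
    by (intro sum.cong) auto
  then show ?case using E 0 g by simp
next
  case (Suc n)
  have "(\<Sum>y\<in>E. matrix_power_on E L (Suc n) x y * g y)
      = (\<Sum>v\<in>E. L x v * (\<Sum>y\<in>E. matrix_power_on E L n v y * g y))"
    by (simp add: sum_distrib_left sum_distrib_right mult.assoc) (rule sum.swap)
  also have "\<bar>\<dots>\<bar> \<le> (\<Sum>v\<in>E. \<bar>L x v\<bar> * (R ^ n * B))"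
    using Suc.IH by (intro order_trans[OF sum_abs] sum_mono) (simp add: abs_mult mult_left_mono)
  also have "\<dots> = (\<Sum>v\<in>E. \<bar>L x v\<bar>) * (R ^ n * B)"
    by (simp add: sum_distrib_right)
  also have "\<dots> \<le> R * (R ^ n * B)"
  proof (rule mult_right_mono[OF R[OF Suc.prems]])
    have "0 \<le> R" using R[OF Suc.prems] by (meson abs_ge_zero order_trans sum_nonneg)
    moreover have "0 \<le> B" using g[OF Suc.prems] by linarith
    ultimately show "0 \<le> R ^ n * B" by simp
  qed
  finally show ?case by simp
qed

text \<open>The exponential series is cut after its linear term; the tail is at most
  \<open>B\<close> times \<open>exp (t * R) - (1 + t * R)\<close>, which is quadratic as long as
  \<open>t * R \<le> 1\<close>.\<close>

lemma transition_prob_expansion: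
  assumes E: "finite E" and R: "\<And>x. x \<in> E \<Longrightarrow> (\<Sum>v\<in>E. \<bar>L x v\<bar>) \<le> R"
    and g: "\<And>y. y \<in> E \<Longrightarrow> \<bar>g y\<bar> \<le> B" and x: "x \<in> E" and t: "0 \<le> t" "t * R \<le> 1"
  shows "\<bar>(\<Sum>y\<in>E. transition_prob E L t x y * g y) - (g x + t * (\<Sum>y\<in>E. L x y * g y))\<bar> \<le> (t * R)\<^sup>2 * B"
proof -
  have R0: "0 \<le> R" using R[OF x] by (meson abs_ge_zero order_trans sum_nonneg)
  define s where "s n = (\<Sum>y\<in>E. matrix_power_on E L n x y * g y)" for n
  define f where "f n = t ^ n / fact n * s n" for n
  define G where "G n = (t * R) ^ n / fact n" for n
  have G: "summable G" "suminf G = exp (t * R)"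
    using summable_exp_generic[of "t * R"] by (simp_all add: G_def[abs_def] exp_def divide_inverse mult.commute)
  have mp: "\<bar>t ^ n / fact n * matrix_power_on E L n x y\<bar> \<le> G n" if "y \<in> E" for n y
  proof -
    \<comment> \<open>A single entry of a power is its action on the indicator of \<open>y\<close>,
      so the operator bound applies to it.\<close>
    have "(\<Sum>z\<in>E. matrix_power_on E L n x z * (if z = y then 1 else 0)) = (\<Sum>z\<in>E. if z = y then matrix_power_on E L n x z else 0)"
      by (intro sum.cong) auto
    then have eq: "(\<Sum>z\<in>E. matrix_power_on E L n x z * (if z = y then 1 else 0)) = matrix_power_on E L n x y"
      using E that by simp
    have "\<bar>\<Sum>z\<in>E. matrix_power_on E L n x z * (if z = y then 1 else 0)\<bar> \<le> R ^ n * 1"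
      by (rule matrix_power_on_sum_bound) (use E R x in auto)
    then have "\<bar>matrix_power_on E L n x y\<bar> \<le> R ^ n"
      unfolding eq by simp
    then show ?thesis
      using t by (simp add: G_def abs_mult power_mult_distrib mult_left_mono divide_right_mono)
  qed
  have summ: "summable (\<lambda>n. t ^ n / fact n * matrix_power_on E L n x y)" if "y \<in> E" for y
    by (rule summable_comparison_test'[OF G(1), of 0]) (use mp[OF that] in auto)
  have fle: "\<bar>f n\<bar> \<le> G n * B" for n
  proof -
    have "\<bar>f n\<bar> = t ^ n / fact n * \<bar>s n\<bar>" using t by (simp add: f_def abs_mult)
    also have "\<dots> \<le> t ^ n / fact n * (R ^ n * B)"
      using t unfolding s_def by (intro mult_left_mono matrix_power_on_sum_bound E R g x) auto
    finally show ?thesis by (simp add: G_def power_mult_distrib)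
  qed
  have GB: "summable (\<lambda>n. G n * B)" using G(1) by (rule summable_mult2)
  have f: "summable f"
    by (rule summable_comparison_test'[OF GB, of 0]) (use fle in auto)
  have "(\<Sum>y\<in>E. transition_prob E L t x y * g y)
      = (\<Sum>y\<in>E. \<Sum>n. t ^ n / fact n * matrix_power_on E L n x y * g y)"
    unfolding transition_prob_def by (intro sum.cong refl suminf_mult2 summ)
  also have "\<dots> = (\<Sum>n. \<Sum>y\<in>E. t ^ n / fact n * matrix_power_on E L n x y * g y)"
    by (intro suminf_sum[symmetric] summable_mult2 summ)
  also have "\<dots> = suminf f"
    by (simp add: f_def[abs_def] s_def sum_distrib_left mult.assoc)
  also have "\<dots> = (\<Sum>n. f (n + 2)) + (\<Sum>n<2. f n)"
    by (rule suminf_split_initial_segment[OF f])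
  also have "(\<Sum>n<2. f n) = g x + t * (\<Sum>y\<in>E. L x y * g y)"
  proof -
    have d: "(\<Sum>y\<in>E. (if z = y then 1 else 0) * h y) = h z" if "z \<in> E" for z and h :: "_ \<Rightarrow> real"
    proof -
      have "(\<Sum>y\<in>E. (if z = y then 1 else 0) * h y) = (\<Sum>y\<in>E. if z = y then h y else 0)"
        by (intro sum.cong) auto
      then show ?thesis using E that by simp
    qed
    have d2: "(\<Sum>v\<in>E. L x v * (if v = y then 1 else 0)) = L x y" if "y \<in> E" for y
      using d[OF that, of "L x"] by (simp add: mult.commute eq_commute[of y])
    have "s 0 = g x" using d[OF x] by (simp add: s_def)
    moreover have "s 1 = (\<Sum>y\<in>E. L x y * g y)"
      unfolding s_def by (intro sum.cong refl) (simp add: d2)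
    ultimately show ?thesis by (simp add: numeral_2_eq_2 f_def)
  qed
  finally have "(\<Sum>y\<in>E. transition_prob E L t x y * g y) - (g x + t * (\<Sum>y\<in>E. L x y * g y)) = (\<Sum>n. f (n + 2))"
    by simp
  also have "\<bar>\<dots>\<bar> \<le> (\<Sum>n. G (n + 2) * B)"
    using fle by (intro order_trans[OF summable_rabs suminf_le] summable_rabs_comparison_test
        summable_comparison_test'[OF summable_ignore_initial_segment[OF GB, of 2], of 0]
        summable_ignore_initial_segment[OF GB]) auto
  also have "\<dots> = (\<Sum>n. G (n + 2)) * B"
    by (intro suminf_mult2[symmetric] summable_ignore_initial_segment G(1))
  also have "(\<Sum>n. G (n + 2)) = exp (t * R) - (1 + t * R)"
    using suminf_split_initial_segment[OF G(1), of 2] by (simp add: G(2) numeral_2_eq_2 G_def)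
  also have "(exp (t * R) - (1 + t * R)) * B \<le> (t * R)\<^sup>2 * B"
  proof (rule mult_right_mono)
    show "exp (t * R) - (1 + t * R) \<le> (t * R)\<^sup>2"
      using exp_bound[of "t * R"] t R0 by simp
    show "0 \<le> B" using g[OF x] by linarith
  qed
  finally show ?thesis .
qed

section \<open>Histories and an integrated Markov property\<close>

lemma
  assumes G: "space G = space M" "sets G \<subseteq> sets M"
  shows space_history [simp]: "space (history M G X s) = space M"
    and sets_history: "sets (history M G X s) =
      sigma_sets (space M) (sets G \<union> {X r -` B \<inter> space M |r B. r \<in> {0..s}})"
    and sets_G_history: "sets G \<subseteq> sets (history M G X s)"
proof -
  have "sets G \<union> {X r -` B \<inter> space M |r B. r \<in> {0..s}} \<subseteq> Pow (space M)"
    using sets.space_closed[of G] G(1) by auto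
  then show "space (history M G X s) = space M" and
    eq: "sets (history M G X s) = sigma_sets (space M) (sets G \<union> {X r -` B \<inter> space M |r B. r \<in> {0..s}})"
    by (simp_all add: history_def space_measure_of sets_measure_of)
  show "sets G \<subseteq> sets (history M G X s)"
    unfolding eq by auto
qed

lemma history_mono:
  assumes G: "space G = space M" "sets G \<subseteq> sets M" and "s \<le> t"
  shows "sets (history M G X s) \<subseteq> sets (history M G X t)"
proof -
  have "{0..s} \<subseteq> {0..t}" using \<open>s \<le> t\<close> by auto
  then show ?thesis
    unfolding sets_history[OF G] by (intro sigma_sets_mono') blast
qed

lemma history_subset:
  assumes G: "space G = space M" "sets G \<subseteq> sets M"
    and X: "\<And>r. 0 \<le> r \<Longrightarrow> X r \<in> M \<rightarrow>\<^sub>M count_space E"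
  shows "sets (history M G X s) \<subseteq> sets M"
  unfolding sets_history[OF G]
proof (rule sets.sigma_sets_subset, safe)
  fix r B assume "r \<in> {0..s}"
  then have "X r \<in> M \<rightarrow>\<^sub>M count_space E" using X by auto
  \<comment> \<open>The sets \<open>B\<close> generating the history are arbitrary, while
    \<open>count_space E\<close> has only subsets of \<open>E\<close>; as the values lie in
    \<open>E\<close>, intersecting with \<open>E\<close> changes nothing.\<close>
  then have "X r -` (B \<inter> E) \<inter> space M \<in> sets M" and XE: "X r \<in> space M \<rightarrow> E"
    using measurable_sets[of "X r" M "count_space E" "B \<inter> E"] by (auto simp: measurable_def)
  moreover have "X r -` (B \<inter> E) \<inter> space M = X r -` B \<inter> space M"
    using XE by auto
  ultimately show "X r -` B \<inter> space M \<in> sets M" by (simp only:)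
qed (use G in auto)

lemma measurable_history:
  assumes G: "space G = space M" "sets G \<subseteq> sets M"
    and X: "X r \<in> M \<rightarrow>\<^sub>M count_space E" and r: "0 \<le> r" "r \<le> s"
  shows "X r \<in> history M G X s \<rightarrow>\<^sub>M count_space E"
proof (rule measurableI)
  show "X r \<omega> \<in> space (count_space E)" if "\<omega> \<in> space (history M G X s)" for \<omega>
    using that X G by (auto simp: measurable_def)
  show "X r -` A \<inter> space (history M G X s) \<in> sets (history M G X s)" for A
    unfolding sets_history[OF G] space_history[OF G] using r by (intro sigma_sets.Basic) auto
qed

lemma measurable_from_graph_history:
  assumes G: "space G = space M" "sets G \<subseteq> sets M" and f: "f \<in> G \<rightarrow>\<^sub>M N"
  shows "f \<in> history M G X s \<rightarrow>\<^sub>M N"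
  using measurable_mono[of N N G "history M G X s"] f sets_G_history[OF G] G by auto

text \<open>The observable \<open>g\<close> may depend on the graph: it is decomposed over the
  finitely many states, and each \<open>g y\<close>, being measurable in \<open>G\<close>, is pulled
  out of the conditional expectation. The bound by \<open>\<psi>\<close> is asked on
  \<open>A\<close> only, where graph and past are under control.\<close>

lemma (in prob_space) markov_step:
  assumes chain: "conditional_markov_chain M G E L X" and E: "finite E"
    and G: "space G = space M" "sets G \<subseteq> sets M" and st: "0 \<le> s" "0 \<le> t"
    and A: "A \<in> sets (history M G X s)"
    and g: "\<And>y. y \<in> E \<Longrightarrow> g y \<in> borel_measurable G"
    and B: "\<And>y \<omega>. y \<in> E \<Longrightarrow> \<omega> \<in> space M \<Longrightarrow> \<bar>g y \<omega>\<bar> \<le> B"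
    and \<psi>: "integrable M (\<lambda>\<omega>. indicator A \<omega> * \<psi> \<omega>)"
    and le: "\<And>\<omega>. \<omega> \<in> A \<Longrightarrow> (\<Sum>y\<in>E. transition_prob E (L \<omega>) t (X s \<omega>) y * g y \<omega>) \<le> \<psi> \<omega>"
  shows "(\<integral>\<omega>. indicator A \<omega> * g (X (s + t) \<omega>) \<omega> \<partial>M) \<le> (\<integral>\<omega>. indicator A \<omega> * \<psi> \<omega> \<partial>M)"
proof -
  let ?F = "history M G X s"
  define I where "I y = indicat_real {\<omega>\<in>space M. X (s + t) \<omega> = y}" for y
  define c where "c y = real_cond_exp M ?F (I y)" for y
  have X: "X r \<in> M \<rightarrow>\<^sub>M count_space E" if "0 \<le> r" for r
    using chain that by (simp add: conditional_markov_chain_def)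
  have sub: "subalgebra M ?F"
    using history_subset[where X=X and s=s, OF G X] space_history[where X=X and s=s, OF G] by (auto simp: subalgebra_def)
  interpret finite_measure_subalgebra M ?F
    by unfold_locales (rule sub)
  have XE: "X (s + t) \<omega> \<in> E" if "\<omega> \<in> space M" for \<omega>
    using X[of "s + t"] st that by (auto simp: measurable_def)
  have IE: "I y \<in> borel_measurable M" if "y \<in> E" for y
  proof -
    have "X (s + t) -` {y} \<inter> space M \<in> sets M"
      using X[of "s + t"] st that by (auto simp: measurable_def)
    moreover have "X (s + t) -` {y} \<inter> space M = {\<omega>\<in>space M. X (s + t) \<omega> = y}" by auto
    ultimately show ?thesis by (simp add: I_def)
  qed
  define f where "f y \<omega> = indicator A \<omega> * g y \<omega>" for y \<omega>
  have fF: "f y \<in> borel_measurable ?F" if "y \<in> E" for y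
    using A measurable_from_graph_history[OF G g[OF that]] unfolding f_def by measurable
  have AM: "A \<in> sets M" using A sub by (auto simp: subalgebra_def)
  have fI: "integrable M (\<lambda>\<omega>. f y \<omega> * I y \<omega>)" if "y \<in> E" for y
  proof (rule integrable_const_bound[of _ B])
    show "AE \<omega> in M. norm (f y \<omega> * I y \<omega>) \<le> B"
      using B[OF that] by (intro AE_I2) (auto simp: f_def I_def indicator_def intro: order_trans[OF abs_ge_zero])
    show "(\<lambda>\<omega>. f y \<omega> * I y \<omega>) \<in> borel_measurable M"
      using fF[OF that] IE[OF that] measurable_from_subalg[OF sub] by (intro borel_measurable_times) auto
  qed
  note ce = real_cond_exp_intg[OF fI fF IE]
  have "(\<integral>\<omega>. indicator A \<omega> * g (X (s + t) \<omega>) \<omega> \<partial>M) = (\<integral>\<omega>. (\<Sum>y\<in>E. f y \<omega> * I y \<omega>) \<partial>M)"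
  proof (rule Bochner_Integration.integral_cong[OF refl])
    fix \<omega> assume \<omega>: "\<omega> \<in> space M"
    have "(\<Sum>y\<in>E. f y \<omega> * I y \<omega>) = (\<Sum>y\<in>E. if X (s + t) \<omega> = y then f y \<omega> else 0)"
      using \<omega> by (intro sum.cong) (auto simp: I_def)
    then show "indicator A \<omega> * g (X (s + t) \<omega>) \<omega> = (\<Sum>y\<in>E. f y \<omega> * I y \<omega>)"
      using E XE[OF \<omega>] by (simp add: f_def)
  qed
  also have "\<dots> = (\<Sum>y\<in>E. \<integral>\<omega>. f y \<omega> * I y \<omega> \<partial>M)"
    by (intro Bochner_Integration.integral_sum fI)
  also have "\<dots> = (\<Sum>y\<in>E. \<integral>\<omega>. f y \<omega> * c y \<omega> \<partial>M)"
    unfolding c_def using ce(2) by simp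
  also have "\<dots> = (\<integral>\<omega>. (\<Sum>y\<in>E. f y \<omega> * c y \<omega>) \<partial>M)"
    unfolding c_def by (intro Bochner_Integration.integral_sum[symmetric] ce(1))
  also have "\<dots> \<le> (\<integral>\<omega>. indicator A \<omega> * \<psi> \<omega> \<partial>M)"
  proof (rule integral_mono_AE[OF _ \<psi>])
    show "integrable M (\<lambda>\<omega>. \<Sum>y\<in>E. f y \<omega> * c y \<omega>)"
      unfolding c_def by (intro Bochner_Integration.integrable_sum ce(1))
    have "AE \<omega> in M. \<forall>y\<in>E. c y \<omega> = transition_prob E (L \<omega>) t (X s \<omega>) y"
      unfolding c_def I_def using chain st E by (intro AE_finite_allI) (auto simp: conditional_markov_chain_def)
    then show "AE \<omega> in M. (\<Sum>y\<in>E. f y \<omega> * c y \<omega>) \<le> indicator A \<omega> * \<psi> \<omega>"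
    proof (rule AE_mp, intro AE_I2 impI)
      fix \<omega> assume c: "\<forall>y\<in>E. c y \<omega> = transition_prob E (L \<omega>) t (X s \<omega>) y"
      show "(\<Sum>y\<in>E. f y \<omega> * c y \<omega>) \<le> indicator A \<omega> * \<psi> \<omega>"
      proof (cases "\<omega> \<in> A")
        case True
        then show ?thesis using c le[OF True] by (simp add: f_def mult.commute)
      qed (simp add: f_def)
    qed
  qed
  finally show ?thesis .
qed

text \<open>
  Gronwall's inequality combined with the maximal inequality for nonnegative supermartingales:
  the process is stopped as soon as it exceeds \<open>\<epsilon>\<close>.
\<close>

lemma (in prob_space) maximal_inequality:
  fixes V :: "nat \<Rightarrow> 'a \<Rightarrow> real" and \<Omega>0 :: "'a set" and \<epsilon> :: real
  defines "A \<equiv> \<lambda>k. {\<omega> \<in> \<Omega>0. \<forall>j<k. V j \<omega> < \<epsilon>}"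
  assumes \<Omega>0: "\<Omega>0 \<in> events" and V: "\<And>k. V k \<in> borel_measurable M"
    and V0: "\<And>k \<omega>. 0 \<le> V k \<omega>" and VB: "\<And>k \<omega>. \<omega> \<in> space M \<Longrightarrow> V k \<omega> \<le> B"
    and step: "\<And>k. k < m \<Longrightarrow> (\<integral>\<omega>. indicator (A (Suc k)) \<omega> * V (Suc k) \<omega> \<partial>M)
        \<le> (1 + c) * (\<integral>\<omega>. indicator (A (Suc k)) \<omega> * V k \<omega> \<partial>M) + \<gamma>"
    and init: "\<And>\<omega>. \<omega> \<in> \<Omega>0 \<Longrightarrow> V 0 \<omega> \<le> v0" and "0 \<le> v0" "0 \<le> c" "0 \<le> \<gamma>" "0 < \<epsilon>"
  shows "\<epsilon> * prob {\<omega> \<in> \<Omega>0. \<exists>k\<le>m. \<epsilon> \<le> V k \<omega>} \<le> exp (c * real m) * (v0 + real m * \<gamma>)"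
proof -
  note [measurable] = \<Omega>0 V
  have A_eq: "A k = \<Omega>0 \<inter> {\<omega> \<in> space M. \<forall>j<k. V j \<omega> < \<epsilon>}" for k
    using sets.sets_into_space[OF \<Omega>0] by (auto simp: A_def)
  have A_Suc: "\<omega> \<in> A (Suc k) \<longleftrightarrow> \<omega> \<in> A k \<and> V k \<omega> < \<epsilon>" for k \<omega>
    by (auto simp: A_def less_Suc_eq)
  have A_sub: "A k \<subseteq> \<Omega>0" for k
    by (auto simp: A_def)
  have AM [measurable]: "A k \<in> events" for k
    unfolding A_eq by measurable
  have int: "integrable M (\<lambda>\<omega>. indicator S \<omega> * V k \<omega>)" if [measurable]: "S \<in> events" for S k
    using V0 VB by (intro integrable_const_bound[of _ "\<bar>B\<bar>"] AE_I2)
      (auto simp: indicator_def intro: order_trans[OF _ abs_ge_self])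
  have intI: "integrable M (\<lambda>\<omega>. \<epsilon> * indicator S \<omega>)" if "S \<in> events" for S
    using that by (simp add: less_top[symmetric])
  \<comment> \<open>The mean of the stopped process on \<open>\<Omega>0\<close>: a path still below
    \<open>\<epsilon>\<close> counts with its present value, a stopped one with
    \<open>\<epsilon>\<close>.\<close>
  define W where "W k = (\<integral>\<omega>. indicator (A k) \<omega> * V k \<omega> \<partial>M) + \<epsilon> * prob (\<Omega>0 - A k)" for k
  \<comment> \<open>A path stopped because of index \<open>k\<close> has a value of at least
    \<open>\<epsilon>\<close> there, so replacing the value by \<open>\<epsilon>\<close> does not
    increase the mean.\<close>
  have split: "(\<integral>\<omega>. indicator (A (Suc k)) \<omega> * V k \<omega> \<partial>M) + \<epsilon> * prob (\<Omega>0 - A (Suc k)) \<le> W k" for k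
  proof -
    have "(\<integral>\<omega>. indicator (A (Suc k)) \<omega> * V k \<omega> \<partial>M) + \<epsilon> * prob (\<Omega>0 - A (Suc k))
        = (\<integral>\<omega>. indicator (A (Suc k)) \<omega> * V k \<omega> + \<epsilon> * indicator (\<Omega>0 - A (Suc k)) \<omega> \<partial>M)"
      using int[OF AM] intI by simp
    also have "\<dots> \<le> (\<integral>\<omega>. indicator (A k) \<omega> * V k \<omega> + \<epsilon> * indicator (\<Omega>0 - A k) \<omega> \<partial>M)"
    proof (rule integral_mono)
      fix \<omega>
      show "indicator (A (Suc k)) \<omega> * V k \<omega> + \<epsilon> * indicator (\<Omega>0 - A (Suc k)) \<omega>
          \<le> indicator (A k) \<omega> * V k \<omega> + \<epsilon> * indicator (\<Omega>0 - A k) \<omega>"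
        using V0[of k \<omega>] A_Suc[of \<omega> k] A_sub[of k]
        by (cases "\<omega> \<in> A k"; cases "V k \<omega> < \<epsilon>") (auto simp: indicator_def)
    qed (use int[OF AM] intI in auto)
    also have "\<dots> = W k"
      using int[OF AM] intI by (simp add: W_def)
    finally show ?thesis .
  qed
  have "W (Suc k) \<le> (1 + c) * W k + \<gamma>" if "k < m" for k
  proof -
    \<comment> \<open>The stopped part does not grow; it is granted the factor \<open>1 + c\<close>
      so that \<open>W\<close> obeys a single recursion.\<close>
    have "W (Suc k) \<le> (1 + c) * (\<integral>\<omega>. indicator (A (Suc k)) \<omega> * V k \<omega> \<partial>M) + \<gamma>
        + (1 + c) * (\<epsilon> * prob (\<Omega>0 - A (Suc k)))"
      unfolding W_def using step[OF that] assms(8-) by (intro add_mono) (auto simp: distrib_right)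
    also have "\<dots> = (1 + c) * ((\<integral>\<omega>. indicator (A (Suc k)) \<omega> * V k \<omega> \<partial>M) + \<epsilon> * prob (\<Omega>0 - A (Suc k))) + \<gamma>"
      by (simp add: algebra_simps)
    also have "\<dots> \<le> (1 + c) * W k + \<gamma>"
      using split[of k] \<open>0 \<le> c\<close> by (intro add_right_mono mult_left_mono) auto
    finally show ?thesis .
  qed
  moreover have W0: "0 \<le> W 0" "W 0 \<le> v0"
  proof -
    have "A 0 = \<Omega>0" by (simp add: A_def)
    then have W0: "W 0 = (\<integral>\<omega>. indicator \<Omega>0 \<omega> * V 0 \<omega> \<partial>M)" by (simp add: W_def)
    show "0 \<le> W 0" unfolding W0 using V0 by (intro Bochner_Integration.integral_nonneg) auto
    have "W 0 \<le> (\<integral>\<omega>. v0 \<partial>M)"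
      unfolding W0 using init \<open>0 \<le> v0\<close> int[OF \<Omega>0] by (intro integral_mono) (auto simp: indicator_def)
    then show "W 0 \<le> v0" by (simp add: prob_space)
  qed
  ultimately have "W m \<le> exp (c * real m) * (W 0 + real m * \<gamma>)"
    using assms(8-) by (intro recursive_bound) auto
  also have "\<dots> \<le> exp (c * real m) * (v0 + real m * \<gamma>)"
    using W0 by (intro mult_left_mono) auto
  finally have Wm: "W m \<le> exp (c * real m) * (v0 + real m * \<gamma>)" .
  have "{\<omega> \<in> \<Omega>0. \<exists>k\<le>m. \<epsilon> \<le> V k \<omega>} = \<Omega>0 - A (Suc m)"
    by (auto simp: A_def less_Suc_eq_le not_less)
  moreover have "0 \<le> (\<integral>\<omega>. indicator (A (Suc m)) \<omega> * V m \<omega> \<partial>M)"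
    using V0 by (intro Bochner_Integration.integral_nonneg) auto
  ultimately show ?thesis
    using split[of m] Wm by simp
qed

section \<open>The generator of the local density-dependent process\<close>

lemma finite_configs: "finite (configs N :: (nat \<Rightarrow> 's::finite) set)"
  unfolding configs_def by (intro finite_PiE) auto

lemma configs_upd: "\<eta> \<in> configs N \<Longrightarrow> i \<in> {1..N} \<Longrightarrow> \<eta>(i := k) \<in> configs N"
  by (auto simp: configs_def PiE_iff extensional_def)

text \<open>The diagonal entry turns the sum into differences, and each vertex with a new state
  selects exactly one other configuration.\<close>

lemma generator_sum:
  fixes g :: "(nat \<Rightarrow> 's::finite) \<Rightarrow> real"
  assumes \<eta>: "\<eta> \<in> configs N"
  shows "(\<Sum>y\<in>configs N. generator Q N d a \<eta> y * g y)
    = (\<Sum>i\<in>{1..N}. \<Sum>k\<in>UNIV - {\<eta> i}.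
        Q (local_density N d a (state_indicator \<eta>) i) $ k $ \<eta> i * (g (\<eta>(i := k)) - g \<eta>))"
proof -
  let ?E = "configs N"
  let ?q = "\<lambda>i k. Q (local_density N d a (state_indicator \<eta>) i) $ k $ \<eta> i"
  let ?j = "jump_rate Q N d a \<eta>"
  have "(\<Sum>y\<in>?E. generator Q N d a \<eta> y * g y)
      = generator Q N d a \<eta> \<eta> * g \<eta> + (\<Sum>y\<in>?E - {\<eta>}. generator Q N d a \<eta> y * g y)"
    using finite_configs \<eta> by (rule sum.remove)
  also have "(\<Sum>y\<in>?E - {\<eta>}. generator Q N d a \<eta> y * g y) = (\<Sum>y\<in>?E - {\<eta>}. ?j y * g y)"
    by (intro sum.cong) (auto simp: generator_def)
  also have "generator Q N d a \<eta> \<eta> * g \<eta> + \<dots> = (\<Sum>y\<in>?E - {\<eta>}. ?j y * (g y - g \<eta>))"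
    by (simp add: generator_def sum_subtractf right_diff_distrib sum_distrib_right)
  also have "\<dots> = (\<Sum>y\<in>?E - {\<eta>}. \<Sum>i\<in>{1..N}. \<Sum>k\<in>UNIV - {\<eta> i}.
      if y = \<eta>(i := k) then ?q i k * (g y - g \<eta>) else 0)"
    unfolding jump_rate_def sum_distrib_right by (intro sum.cong refl) auto
  also have "\<dots> = (\<Sum>i\<in>{1..N}. \<Sum>k\<in>UNIV - {\<eta> i}. \<Sum>y\<in>?E - {\<eta>}.
      if y = \<eta>(i := k) then ?q i k * (g y - g \<eta>) else 0)"
    by (subst sum.swap, intro sum.cong refl, rule sum.swap)
  also have "\<dots> = (\<Sum>i\<in>{1..N}. \<Sum>k\<in>UNIV - {\<eta> i}. ?q i k * (g (\<eta>(i := k)) - g \<eta>))"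
  proof (intro sum.cong refl)
    fix i k assume ik: "i \<in> {1..N}" "k \<in> UNIV - {\<eta> i}"
    then have "\<eta>(i := k) \<in> ?E - {\<eta>}"
      using configs_upd[OF \<eta> ik(1)] by (auto dest: fun_cong[of _ _ i])
    then show "(\<Sum>y\<in>?E - {\<eta>}. if y = \<eta>(i := k) then ?q i k * (g y - g \<eta>) else 0)
        = ?q i k * (g (\<eta>(i := k)) - g \<eta>)"
      using finite_configs[of N] by (subst sum.delta) auto
  qed
  finally show ?thesis .
qed

text \<open>The mean jump out of state \<open>s\<close> is column \<open>s\<close> of the rate
  matrix; this connects the jump rates with \<open>good_drift\<close>.\<close>

lemma rate_column:
  assumes "rate_function Q"
  shows "Q \<phi> *v axis s 1 = (\<Sum>k\<in>UNIV - {s}. Q \<phi> $ k $ s *\<^sub>R (axis k 1 - axis s 1))"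
proof (rule vec_eq_iff[THEN iffD2], rule allI)
  fix r
  have l: "(Q \<phi> *v axis s 1) $ r = Q \<phi> $ r $ s"
    by (simp add: matrix_vector_mult_basis column_def)
  have Qss: "Q \<phi> $ s $ s = - (\<Sum>k\<in>UNIV - {s}. Q \<phi> $ k $ s)"
    using assms by (simp add: rate_function_def)
  show "(Q \<phi> *v axis s 1) $ r = (\<Sum>k\<in>UNIV - {s}. Q \<phi> $ k $ s *\<^sub>R (axis k 1 - axis s 1)) $ r"
  proof (cases "r = s")
    case True
    have ax: "axis s (1::real) $ s = 1" by (simp add: axis_def)
    have "(\<Sum>k\<in>UNIV - {s}. Q \<phi> $ k $ s * ((axis k 1 :: real^'a) $ s - 1)) = (\<Sum>k\<in>UNIV - {s}. - (Q \<phi> $ k $ s))"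
      by (intro sum.cong) (auto simp: axis_def)
    then show ?thesis
      using True l[unfolded True] ax by (simp add: Qss sum_negf)
  next
    case False
    have "(\<Sum>k\<in>UNIV - {s}. Q \<phi> $ k $ s * (axis k 1 $ r - axis s 1 $ r))
        = (\<Sum>k\<in>UNIV - {s}. if k = r then Q \<phi> $ r $ s else 0)"
      using False by (intro sum.cong) (auto simp: axis_def)
    then show ?thesis
      using False by (simp add: l)
  qed
qed

lemma state_indicator_Delta: "state_indicator \<eta> j \<in> Delta"
  by (simp add: state_indicator_def axis_in_Delta)

section \<open>The generator acting on the squared distance to the mean-field solution\<close>

context weighted_graph
begin

text \<open>Jumps at bad vertices leave \<open>good_average\<close> where it is, which is how their
  rates drop out of the generator estimate.\<close>

lemma good_average_upd:
  assumes i: "i \<in> {1..N}"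
  shows "good_average (state_indicator (\<eta>(i := k)))
    = good_average (state_indicator \<eta>)
      + (if i \<in> good then (1 / real N) *\<^sub>R (axis k 1 - axis (\<eta> i) 1) else 0 :: real^'s)"
proof -
  have "(\<Sum>j\<in>good - {i}. state_indicator (\<eta>(i := k)) j :: real^'s) = (\<Sum>j\<in>good - {i}. state_indicator \<eta> j)"
    by (intro sum.cong) (auto simp: state_indicator_def)
  moreover have "(\<Sum>j\<in>good. f j) = (if i \<in> good then f i else 0) + (\<Sum>j\<in>good - {i}. f j)" for f :: "nat \<Rightarrow> real^'s"
    using finite_good by (auto simp: sum.remove)
  ultimately show ?thesis
    by (simp add: good_average_def state_indicator_def algebra_simps)
qed

text \<open>A jump changes the square by a linear and a quadratic term. The linear terms add up to
  the drift. The quadratic ones stem from at most \<open>N\<close> vertices with at most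
  \<open>CARD('s)\<close> targets each, at rate at most \<open>C\<close> and with squared jump
  length at most \<open>4 / N\<^sup>2\<close>.\<close>

lemma generator_quadratic:
  fixes Q :: "real^'s \<Rightarrow> real^'s^'s"
  assumes rf: "rate_function Q" and Q: "rate_bound Q 2 C" and \<eta>: "\<eta> \<in> configs N"
  shows "(\<Sum>y\<in>configs N. generator Q N d a \<eta> y * (norm (good_average (state_indicator y) - c))\<^sup>2)
    \<le> 2 * (good_drift Q (state_indicator \<eta>) \<bullet> (good_average (state_indicator \<eta>) - c))
      + 4 * real CARD('s) * C / real N"
proof -
  let ?\<phi> = "local_density N d a (state_indicator \<eta>)"
  let ?m = "good_average (state_indicator \<eta>) - c"
  let ?g = "\<lambda>y. (norm (good_average (state_indicator y) - c))\<^sup>2"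
  let ?x = "\<lambda>i k. axis k 1 - axis (\<eta> i) 1 :: real^'s"
  have C: "0 \<le> C" using rate_boundD(1)[OF Q] .
  have upd: "?g (\<eta>(i := k)) - ?g \<eta> = (if i \<in> good then 2 / real N * (?x i k \<bullet> ?m) + (norm (?x i k))\<^sup>2 / (real N)\<^sup>2 else 0)"
    if i: "i \<in> {1..N}" for i k
  proof -
    have quad: "(norm (m + \<alpha> *\<^sub>R x))\<^sup>2 - (norm m)\<^sup>2 = 2 * \<alpha> * (x \<bullet> m) + \<alpha>\<^sup>2 * (norm x)\<^sup>2"
      for m x :: "real^'s" and \<alpha>
      unfolding power2_norm_eq_inner
      by (simp add: inner_add_left inner_add_right inner_commute[of m x] algebra_simps power2_eq_square)
    have eq: "good_average (state_indicator \<eta>) + (1 / real N) *\<^sub>R ?x i k - c = ?m + (1 / real N) *\<^sub>R ?x i k"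
      by simp
    show ?thesis
      using quad[of ?m "1 / real N" "?x i k"]
      by (simp only: good_average_upd[OF i] eq if_True if_False split: if_split) (simp add: power_divide)
  qed
  have "(\<Sum>y\<in>configs N. generator Q N d a \<eta> y * ?g y)
      = (\<Sum>i\<in>{1..N}. \<Sum>k\<in>UNIV - {\<eta> i}. Q (?\<phi> i) $ k $ \<eta> i * (?g (\<eta>(i := k)) - ?g \<eta>))"
    by (rule generator_sum[OF \<eta>])
  also have "\<dots> = (\<Sum>i\<in>{1..N}. if i \<in> good then \<Sum>k\<in>UNIV - {\<eta> i}. Q (?\<phi> i) $ k $ \<eta> i *
      (2 / real N * (?x i k \<bullet> ?m) + (norm (?x i k))\<^sup>2 / (real N)\<^sup>2) else 0)"
    by (intro sum.cong refl) (simp add: upd)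
  also have "\<dots> = (\<Sum>i\<in>good. \<Sum>k\<in>UNIV - {\<eta> i}. Q (?\<phi> i) $ k $ \<eta> i *
      (2 / real N * (?x i k \<bullet> ?m) + (norm (?x i k))\<^sup>2 / (real N)\<^sup>2))"
    using good_subset by (subst sum.inter_restrict[symmetric]) (auto simp: Int_absorb1)
  also have "\<dots> = (\<Sum>i\<in>good. \<Sum>k\<in>UNIV - {\<eta> i}. 2 / real N * ((Q (?\<phi> i) $ k $ \<eta> i *\<^sub>R ?x i k) \<bullet> ?m)
      + Q (?\<phi> i) $ k $ \<eta> i * (norm (?x i k))\<^sup>2 / (real N)\<^sup>2)"
    by (intro sum.cong refl) (simp add: algebra_simps)
  also have "\<dots> \<le> (\<Sum>i\<in>good. \<Sum>k\<in>UNIV - {\<eta> i}. 2 / real N * ((Q (?\<phi> i) $ k $ \<eta> i *\<^sub>R ?x i k) \<bullet> ?m)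
      + C * 4 / (real N)\<^sup>2)"
  proof (intro sum_mono add_left_mono divide_right_mono mult_mono C)
    fix i k assume i: "i \<in> good"
    then have \<phi>: "?\<phi> i \<in> cbox 0 (vec 2)"
      by (intro good_density_in_cbox state_indicator_Delta)
    show "Q (?\<phi> i) $ k $ \<eta> i \<le> C"
      using rate_boundD(2)[OF Q \<phi>, of k "\<eta> i"] by simp
    have "norm (?x i k) \<le> 1 + 1"
      using norm_triangle_ineq4[of "axis k 1 :: real^'s" "axis (\<eta> i) 1"] by simp
    then show "(norm (?x i k))\<^sup>2 \<le> 4"
      using power_mono[of "norm (?x i k)" 2 2] by simp
  qed auto
  also have "\<dots> = (\<Sum>i\<in>good. 2 / real N * ((Q (?\<phi> i) *v state_indicator \<eta> i) \<bullet> ?m)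
      + (\<Sum>k\<in>UNIV - {\<eta> i}. C * 4 / (real N)\<^sup>2))"
    unfolding state_indicator_def[of _ "_ :: nat"] rate_column[OF rf] inner_sum_left sum.distrib sum_distrib_left ..
  also have "\<dots> \<le> (\<Sum>i\<in>good. 2 / real N * ((Q (?\<phi> i) *v state_indicator \<eta> i) \<bullet> ?m)
      + real CARD('s) * (C * 4 / (real N)\<^sup>2))"
  proof (intro sum_mono add_left_mono)
    fix i
    have "(\<Sum>k\<in>UNIV - {\<eta> i}. C * 4 / (real N)\<^sup>2) \<le> (\<Sum>k\<in>(UNIV::'s set). C * 4 / (real N)\<^sup>2)"
      using C by (intro sum_mono2) auto
    then show "(\<Sum>k\<in>UNIV - {\<eta> i}. C * 4 / (real N)\<^sup>2) \<le> real CARD('s) * (C * 4 / (real N)\<^sup>2)"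
      by simp
  qed
  also have "\<dots> = 2 * (good_drift Q (state_indicator \<eta>) \<bullet> ?m) + real (card good) * (real CARD('s) * (C * 4 / (real N)\<^sup>2))"
    by (simp add: sum.distrib good_drift_def inner_sum_left sum_distrib_left)
  also have "\<dots> \<le> 2 * (good_drift Q (state_indicator \<eta>) \<bullet> ?m) + real N * (real CARD('s) * (C * 4 / (real N)\<^sup>2))"
    using card_mono[OF _ good_subset] C by (intro add_left_mono mult_right_mono) auto
  also have "real N * (real CARD('s) * (C * 4 / (real N)\<^sup>2)) = 4 * real CARD('s) * C / real N"
    using N2 by (simp add: power2_eq_square)
  finally show ?thesis .
qed

text \<open>The semigroup and \<open>u\<close> are both expanded to first order, and
  \<open>good_drift_error\<close> compares the first-order terms. \<open>R\<close> bounds the rates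
  at all vertices, bad ones included, and multiplies \<open>h\<^sup>2\<close> only.\<close>

lemma one_step:
  fixes Q :: "real^'s \<Rightarrow> real^'s^'s"
  assumes rf: "rate_function Q" and Q: "rate_bound Q 2 C" and \<eta>: "\<eta> \<in> configs N"
    and u: "mean_field_solution Q u" and t: "0 \<le> t" and h: "0 \<le> h" "h * R \<le> 1"
    and R: "\<And>\<zeta>. \<zeta> \<in> configs N \<Longrightarrow> (\<Sum>y\<in>configs N. \<bar>generator Q N d a \<zeta> y\<bar>) \<le> R"
    and err: "mf_error (real CARD('s)) N discrepancy \<le> \<eta>0"
  shows "(\<Sum>y\<in>configs N. transition_prob (configs N) (generator Q N d a) h \<eta> y
            * (norm (good_average (state_indicator y) - u (t + h)))\<^sup>2)
    \<le> (1 + 6 * C * h) * (norm (good_average (state_indicator \<eta>) - u t))\<^sup>2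
      + h * (2 * C * \<eta>0\<^sup>2 + 4 * real CARD('s) * C / real N) + (11 * C\<^sup>2 + 4 * R\<^sup>2) * h\<^sup>2"
proof -
  let ?S = "real CARD('s)"
  let ?g = "\<lambda>y. (norm (good_average (state_indicator y) - u (t + h)))\<^sup>2"
  let ?F = "\<lambda>s. Q (u s) *v u s"
  let ?b = "good_drift Q (state_indicator \<eta>)"
  define e where "e = good_average (state_indicator \<eta>) - u t"
  define \<delta> where "\<delta> = u (t + h) - u t"
  have C: "0 \<le> C" using rate_boundD(1)[OF Q] .
  have uD: "u s \<in> Delta" if "0 \<le> s" for s
    using u that by (simp add: mean_field_solution_def)
  have uK: "u s \<in> cbox 0 (vec 2)" if "0 \<le> s" for s
    using uD[OF that] Delta_subset_cbox[of 2] by auto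
  have un: "norm (u s) \<le> 1" if "0 \<le> s" for s
    using uD[OF that] by (rule Delta_norm_le)
  have ud: "(u has_vector_derivative ?F s) (at s within {0..})" if "0 \<le> s" for s
    using u that by (simp add: mean_field_solution_def)
  have F: "norm (?F s) \<le> C" if "0 \<le> s" for s
  proof -
    have "norm (?F s) \<le> C * norm (u s)" using rate_boundD(3)[OF Q uK[OF that]] .
    also have "\<dots> \<le> C" using un[OF that] C by (simp add: mult_left_le)
    finally show ?thesis .
  qed
  have lip: "norm (u (s + r) - u s) \<le> C * r" if "0 \<le> s" "0 \<le> r" for s r
    using ud that F by (rule vector_derivative_lipschitz)
  have \<delta>: "norm \<delta> \<le> C * h" unfolding \<delta>_def using t h by (intro lip)
  have rem: "norm (\<delta> - h *\<^sub>R ?F t) \<le> (2 * C\<^sup>2 * h) * h"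
    unfolding \<delta>_def
  proof (rule euler_step_error[OF ud t h(1)])
    fix s assume s: "t \<le> s" "s \<le> t + h"
    have "norm (?F s - ?F t) \<le> C * norm (u s - u t) + C * 1 * norm (u s - u t)"
      using s t by (intro rate_field_lipschitz[OF Q] uK un) auto
    also have "\<dots> \<le> C * (C * h) + C * 1 * (C * h)"
    proof -
      have "norm (u s - u t) \<le> C * (s - t)" using lip[OF t, of "s - t"] s by simp
      also have "\<dots> \<le> C * h" using s C by (intro mult_left_mono) auto
      finally show ?thesis using C by (intro add_mono mult_left_mono) auto
    qed
    finally show "norm (?F s - ?F t) \<le> 2 * C\<^sup>2 * h"
      by (simp add: power2_eq_square)
  qed auto
  have si: "norm (state_indicator y j :: real^'s) \<le> 1" for y j
    by (rule Delta_norm_le[OF state_indicator_Delta])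
  have gn: "norm (good_average (state_indicator y) :: real^'s) \<le> 1" for y
    by (intro good_average_norm_le si)
  have en: "norm e \<le> 2"
    unfolding e_def using norm_triangle_ineq4[of "good_average (state_indicator \<eta>)" "u t"] gn[of \<eta>] un[OF t] by linarith
  have g4: "\<bar>?g y\<bar> \<le> 4" for y
  proof -
    have "norm (good_average (state_indicator y) - u (t + h)) \<le> 2"
      using norm_triangle_ineq4[of "good_average (state_indicator y)" "u (t + h)"] gn[of y] un[of "t + h"] t h by linarith
    then show ?thesis using power_mono[of _ 2 2] by force
  qed
  have bn: "norm ?b \<le> C"
    by (intro good_drift_norm_le Q state_indicator_Delta)
  have bF: "norm (?b - ?F t) \<le> 2 * C * (norm e + \<eta>0)"
  proof -
    have "norm (?b - ?F t) \<le> 2 * C * (norm e + mf_error ?S N discrepancy)"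
      unfolding e_def by (intro good_drift_error Q state_indicator_Delta uD t)
    also have "\<dots> \<le> 2 * C * (norm e + \<eta>0)"
      using err C by (intro mult_left_mono) auto
    finally show ?thesis .
  qed
  have "(\<Sum>y\<in>configs N. transition_prob (configs N) (generator Q N d a) h \<eta> y * ?g y)
      \<le> ?g \<eta> + h * (\<Sum>y\<in>configs N. generator Q N d a \<eta> y * ?g y) + (h * R)\<^sup>2 * 4"
  proof -
    have "\<bar>(\<Sum>y\<in>configs N. transition_prob (configs N) (generator Q N d a) h \<eta> y * ?g y)
        - (?g \<eta> + h * (\<Sum>y\<in>configs N. generator Q N d a \<eta> y * ?g y))\<bar> \<le> (h * R)\<^sup>2 * 4"
      by (rule transition_prob_expansion[OF finite_configs _ _ \<eta> h]) (use R g4 in auto)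
    then show ?thesis by linarith
  qed
  also have "\<dots> \<le> ?g \<eta> + h * (2 * (?b \<bullet> (e - \<delta>)) + 4 * ?S * C / real N) + (h * R)\<^sup>2 * 4"
    using generator_quadratic[OF rf Q \<eta>, of "u (t + h)"] h
    by (intro add_right_mono add_left_mono mult_left_mono) (auto simp: e_def \<delta>_def)
  also have "?g \<eta> = (norm (e - \<delta>))\<^sup>2"
    by (simp add: e_def \<delta>_def)
  \<comment> \<open>The mixed term of the square is split at the tangent
    \<open>h *\<^sub>R ?F t\<close>: its main part joins the drift of the chain, the rest is of
    order \<open>h\<^sup>2\<close>.\<close>
  also have "(norm (e - \<delta>))\<^sup>2 + h * (2 * (?b \<bullet> (e - \<delta>)) + 4 * ?S * C / real N) + (h * R)\<^sup>2 * 4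
      = (norm e)\<^sup>2 + 2 * h * ((?b - ?F t) \<bullet> e) - 2 * ((\<delta> - h *\<^sub>R ?F t) \<bullet> e) + (norm \<delta>)\<^sup>2 - 2 * h * (?b \<bullet> \<delta>)
        + h * (4 * ?S * C / real N) + (h * R)\<^sup>2 * 4"
    by (simp add: power2_norm_eq_inner algebra_simps inner_commute)
  \<comment> \<open>In units of \<open>C\<^sup>2 * h\<^sup>2\<close>: 8 from the remainder of
    \<open>u\<close> against \<open>e\<close> of norm at most 2, 1 from \<open>\<delta>\<close>
    squared, 2 from the drift against \<open>\<delta>\<close>; together 11. The last term is the
    tail of the semigroup on an observable bounded by 4.\<close>
  also have "\<dots> \<le> (norm e)\<^sup>2 + h * (C * (6 * (norm e)\<^sup>2 + 2 * \<eta>0\<^sup>2)) + 8 * C\<^sup>2 * h\<^sup>2 + C\<^sup>2 * h\<^sup>2 + 2 * C\<^sup>2 * h\<^sup>2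
        + h * (4 * ?S * C / real N) + (h * R)\<^sup>2 * 4"
  proof -
    have "(?b - ?F t) \<bullet> e \<le> norm (?b - ?F t) * norm e"
      by (rule norm_cauchy_schwarz)
    also have "\<dots> \<le> 2 * C * (norm e + \<eta>0) * norm e"
      using bF by (intro mult_right_mono) auto
    finally have "2 * ((?b - ?F t) \<bullet> e) \<le> C * (4 * (norm e)\<^sup>2 + 2 * (2 * norm e * \<eta>0))"
      by (simp add: algebra_simps power2_eq_square)
    also have "\<dots> \<le> C * (4 * (norm e)\<^sup>2 + 2 * ((norm e)\<^sup>2 + \<eta>0\<^sup>2))"
      using sum_squares_bound[of "norm e" \<eta>0] C by (intro mult_left_mono add_left_mono) auto
    finally have "h * (2 * ((?b - ?F t) \<bullet> e)) \<le> h * (C * (6 * (norm e)\<^sup>2 + 2 * \<eta>0\<^sup>2))"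
      using h by (intro mult_left_mono) (auto simp: algebra_simps)
    then have 1: "2 * h * ((?b - ?F t) \<bullet> e) \<le> h * (C * (6 * (norm e)\<^sup>2 + 2 * \<eta>0\<^sup>2))"
      by (simp add: algebra_simps)
    have "\<bar>(\<delta> - h *\<^sub>R ?F t) \<bullet> e\<bar> \<le> norm (\<delta> - h *\<^sub>R ?F t) * norm e"
      by (rule Cauchy_Schwarz_ineq2)
    also have "\<dots> \<le> ((2 * C\<^sup>2 * h) * h) * 2"
      by (rule mult_mono[OF rem en _ norm_ge_zero]) (simp add: h(1) mult_nonneg_nonneg[OF mult_nonneg_nonneg])
    finally have 2: "- (2 * ((\<delta> - h *\<^sub>R ?F t) \<bullet> e)) \<le> 8 * C\<^sup>2 * h\<^sup>2"
      by (simp add: power2_eq_square abs_le_iff)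
    have 3: "(norm \<delta>)\<^sup>2 \<le> C\<^sup>2 * h\<^sup>2"
      using power_mono[OF \<delta>, of 2] by (simp add: power_mult_distrib)
    have "\<bar>?b \<bullet> \<delta>\<bar> \<le> norm ?b * norm \<delta>"
      by (rule Cauchy_Schwarz_ineq2)
    also have "\<dots> \<le> C * (C * h)"
      using bn \<delta> C by (intro mult_mono) auto
    finally have "h * (- (?b \<bullet> \<delta>)) \<le> h * (C * (C * h))"
      using h by (intro mult_left_mono) (auto simp: abs_le_iff)
    moreover have "h * (C * (C * h)) = C\<^sup>2 * h\<^sup>2"
      by (simp add: power2_eq_square)
    ultimately have 4: "- (2 * h * (?b \<bullet> \<delta>)) \<le> 2 * C\<^sup>2 * h\<^sup>2"
      by linarith
    have arith: "x0 + x1 - x2 + x3 - x4 + x5 + x6 \<le> x0 + y1 + y2 + y3 + y4 + x5 + x6"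
      if "x1 \<le> y1" "- x2 \<le> y2" "x3 \<le> y3" "- x4 \<le> y4" for x0 x1 x2 x3 x4 x5 x6 y1 y2 y3 y4 :: real
      using that by linarith
    show ?thesis by (rule arith[OF 1 2 3 4])
  qed
  also have "\<dots> = (1 + 6 * C * h) * (norm e)\<^sup>2
      + h * (2 * C * \<eta>0\<^sup>2 + 4 * ?S * C / real N) + (11 * C\<^sup>2 + 4 * R\<^sup>2) * h\<^sup>2"
    by (simp add: algebra_simps power2_eq_square)
  finally show ?thesis
    by (simp add: e_def)
qed

end

section \<open>The process on a time grid\<close>

lemma (in prob_space) tail_prob_tendsto_0:
  fixes f :: "'a \<Rightarrow> real"
  assumes [measurable]: "f \<in> borel_measurable M"
  shows "(\<lambda>r. prob {\<omega> \<in> space M. f \<omega> > real r}) \<longlonglongrightarrow> 0"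
proof -
  let ?A = "\<lambda>r. {\<omega> \<in> space M. f \<omega> > real r}"
  have "(\<lambda>r. prob (?A r)) \<longlonglongrightarrow> prob (\<Inter>r. ?A r)"
    by (rule finite_Lim_measure_decseq) (auto simp: decseq_def)
  moreover have "(\<Inter>r. ?A r) = {}"
  proof -
    have "\<exists>r. \<not> f \<omega> > real r" for \<omega>
      using real_arch_simple[of "f \<omega>"] by (auto simp: not_less)
    then show ?thesis by auto
  qed
  ultimately show ?thesis by simp
qed

text \<open>The error per unit time in \<open>one_step\<close> apart from the terms in
  \<open>h\<^sup>2\<close>: mean-field error and jump noise.\<close>

definition mf_rate :: "real \<Rightarrow> real \<Rightarrow> nat \<Rightarrow> real \<Rightarrow> real" where
  "mf_rate C c N \<delta> = 2 * C * (mf_error c N \<delta>)\<^sup>2 + 4 * c * C / real N"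

section \<open>The process, its filtration and its observables\<close>

locale er_chain = er_graph M D p N w b
  for M :: "'w measure" and D p N w b +
  fixes Q :: "real^'s \<Rightarrow> real^'s^'s" and X :: "real \<Rightarrow> 'w \<Rightarrow> nat \<Rightarrow> 's" and u :: "real \<Rightarrow> real^'s" and C :: real
  assumes rf: "rate_function Q" and lip: "\<And>k s. locally_lipschitz (\<lambda>\<phi>. Q \<phi> $ k $ s)"
    and Qb: "rate_bound Q 2 C"
    and process: "local_density_process M Q N (mean_degree D p N) (edge_weight w b) X"
    and u: "mean_field_solution Q u"
begin

abbreviation "G \<equiv> graph_algebra M N (edge_weight w b)"
abbreviation "F s \<equiv> history M G X s"
abbreviation "gavg \<omega> \<eta> \<equiv> weighted_graph.good_average N deg (adj \<omega>) (state_indicator \<eta>) :: real^'s"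

definition V :: "real \<Rightarrow> 'w \<Rightarrow> real" where
  "V s \<omega> = (norm (gavg \<omega> (X s \<omega>) - u s))\<^sup>2"

text \<open>A finite bound for all rows of the generator at once that depends on the graph alone. It
  is truncated at a level \<open>R\<close>, which takes the place of a deterministic bound on the
  rates at bad vertices.\<close>

definition rate_sum :: "'w \<Rightarrow> real" where
  "rate_sum \<omega> = (\<Sum>\<eta>\<in>configs N. \<Sum>y\<in>configs N. \<bar>generator Q N deg (adj \<omega>) \<eta> y\<bar>)"

lemma chain: "conditional_markov_chain M G (configs N) (\<lambda>\<omega>. generator Q N deg (adj \<omega>)) X"
  using process by (simp add: local_density_process_def)

lemma C_nonneg: "0 \<le> C"
  using rate_boundD(1)[OF Qb] .

lemma u_Delta: "0 \<le> t \<Longrightarrow> u t \<in> Delta"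
  using u by (simp add: mean_field_solution_def)

lemma X_measurable: "0 \<le> t \<Longrightarrow> X t \<in> M \<rightarrow>\<^sub>M count_space (configs N)"
  using chain by (simp add: conditional_markov_chain_def)

lemma X_configs: "0 \<le> t \<Longrightarrow> \<omega> \<in> space M \<Longrightarrow> X t \<omega> \<in> configs N"
  using X_measurable[of t] by (auto simp: measurable_def)

lemma
  shows space_G: "space G = space M" and sets_G: "sets G \<subseteq> sets M"
    and adj_G: "i \<in> {1..N} \<Longrightarrow> j \<in> {1..N} \<Longrightarrow> (\<lambda>\<omega>. adj \<omega> i j) \<in> borel_measurable G"
proof -
  let ?gen = "{edge_weight w b i j -` B \<inter> space M |i j B. i \<in> {1..N} \<and> j \<in> {1..N} \<and> B \<in> sets borel}"
  have sub: "?gen \<subseteq> Pow (space M)" by auto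
  then show sp: "space G = space M"
    by (simp add: graph_algebra_def space_measure_of)
  have s: "sets G = sigma_sets (space M) ?gen"
    using sub by (simp add: graph_algebra_def sets_measure_of)
  show "sets G \<subseteq> sets M"
    unfolding s
  proof (rule sets.sigma_sets_subset, safe)
    fix i j and B :: "real set" assume "i \<in> {1..N}" "j \<in> {1..N}" "B \<in> sets borel"
    then show "edge_weight w b i j -` B \<inter> space M \<in> events"
      using measurable_sets[OF adj_measurable] by blast
  qed
  show "(\<lambda>\<omega>. adj \<omega> i j) \<in> borel_measurable G" if "i \<in> {1..N}" "j \<in> {1..N}"
  proof (rule measurableI)
    fix B :: "real set" assume "B \<in> sets borel"
    then show "(\<lambda>\<omega>. adj \<omega> i j) -` B \<inter> space G \<in> sets G"
      unfolding s sp using that by (intro sigma_sets.Basic) auto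
  qed simp
qed

lemmas G = space_G sets_G

lemma good_measurable:
  assumes "i \<in> {1..N}"
  shows "{\<omega> \<in> space G. i \<in> weighted_graph.good N deg (adj \<omega>)} \<in> sets G"
proof -
  have "(\<lambda>\<omega>. \<Sum>j\<in>{1..N}. adj \<omega> i j) \<in> borel_measurable G"
    using adj_G assms by (intro borel_measurable_sum)
  then have "{\<omega> \<in> space G. (\<Sum>j\<in>{1..N}. adj \<omega> i j) \<le> 2 * deg} \<in> sets G"
    by measurable
  also have "{\<omega> \<in> space G. (\<Sum>j\<in>{1..N}. adj \<omega> i j) \<le> 2 * deg}
      = {\<omega> \<in> space G. i \<in> weighted_graph.good N deg (adj \<omega>)}"
    using assms by (auto simp: space_G weighted_graph.good_def[OF weighted_graph_adj])
  finally show ?thesis .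
qed

text \<open>For a fixed configuration the only randomness is the set of good vertices, which the
  graph determines; \<open>markov_step\<close> asks for measurability in \<open>G\<close>.\<close>

lemma gavg_measurable: "(\<lambda>\<omega>. gavg \<omega> \<eta>) \<in> borel_measurable G"
proof -
  let ?g = "\<lambda>\<omega>. (1 / real N) *\<^sub>R (\<Sum>i\<in>{1..N}. if i \<in> weighted_graph.good N deg (adj \<omega>)
      then axis (\<eta> i) 1 else 0 :: real^'s)"
  have "?g \<in> borel_measurable G"
    by (intro borel_measurable_scaleR borel_measurable_const borel_measurable_sum measurable_If good_measurable) auto
  moreover have "gavg \<omega> \<eta> = ?g \<omega>" if "\<omega> \<in> space G" for \<omega>
  proof -
    interpret weighted_graph N deg "adj \<omega>"
      using weighted_graph_adj that by (simp add: space_G)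
    have "(\<Sum>i\<in>{1..N}. if i \<in> good then axis (\<eta> i) 1 else 0 :: real^'s) = (\<Sum>i\<in>good. axis (\<eta> i) 1)"
      using good_subset by (subst sum.inter_restrict[symmetric]) (auto simp: Int_absorb1)
    then show ?thesis
      by (simp add: good_average_def state_indicator_def)
  qed
  ultimately show ?thesis
    by (simp cong: measurable_cong)
qed

lemma graph_disc_measurable: "graph_disc \<in> borel_measurable G"
proof -
  let ?c = "\<lambda>\<omega> i j. if i = j then 0 else adj \<omega> i j / deg - 1 / (real N - 1)"
  let ?g = "\<lambda>\<omega>. (\<Sum>j\<in>{1..N}. \<Sum>k\<in>{1..N}. \<bar>\<Sum>i\<in>{1..N}. ?c \<omega> i j * ?c \<omega> i k\<bar>) / real N"
  have "(\<lambda>\<omega>. ?c \<omega> i j) \<in> borel_measurable G" if "i \<in> {1..N}" "j \<in> {1..N}" for i j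
    using adj_G[OF that] by (cases "i = j") auto
  then have "?g \<in> borel_measurable G"
    by (intro borel_measurable_divide borel_measurable_sum borel_measurable_abs borel_measurable_times
        borel_measurable_const)
  moreover have "graph_disc \<omega> = ?g \<omega>" if "\<omega> \<in> space G" for \<omega>
    using weighted_graph_adj[of \<omega>] that
    by (simp add: space_G graph_disc_def weighted_graph.discrepancy_def weighted_graph.centered_def)
  ultimately show ?thesis
    by (simp cong: measurable_cong)
qed

lemma rate_sum_measurable: "rate_sum \<in> borel_measurable G"
proof -
  have Qm: "(\<lambda>\<omega>. Q (local_density N deg (adj \<omega>) (state_indicator \<eta>) i) $ k $ s) \<in> borel_measurable G"
    if "i \<in> {1..N}" for \<eta> i k s
  proof (rule borel_measurable_continuous_on[OF locally_lipschitz_continuous[OF lip]])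
    show "(\<lambda>\<omega>. local_density N deg (adj \<omega>) (state_indicator \<eta>) i) \<in> borel_measurable G"
      using that by (intro local_density_measurable adj_G borel_measurable_const)
  qed
  have "(\<lambda>\<omega>. jump_rate Q N deg (adj \<omega>) \<eta> y) \<in> borel_measurable G" for \<eta> y
    unfolding jump_rate_def
  proof (intro borel_measurable_sum)
    fix i k assume "i \<in> {1..N}"
    then show "(\<lambda>\<omega>. if y = \<eta>(i := k) then Q (local_density N deg (adj \<omega>) (state_indicator \<eta>) i) $ k $ \<eta> i else 0)
        \<in> borel_measurable G"
      using Qm by (cases "y = \<eta>(i := k)") auto
  qed
  then have "(\<lambda>\<omega>. generator Q N deg (adj \<omega>) \<eta> y) \<in> borel_measurable G" for \<eta> y
    unfolding generator_def by (cases "\<eta> = y") auto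
  then show ?thesis
    unfolding rate_sum_def[abs_def] by (intro borel_measurable_sum borel_measurable_abs)
qed

lemma X_history: "0 \<le> r \<Longrightarrow> r \<le> s \<Longrightarrow> X r \<in> F s \<rightarrow>\<^sub>M count_space (configs N)"
  by (intro measurable_history G X_measurable)

lemma G_history: "f \<in> G \<rightarrow>\<^sub>M K \<Longrightarrow> f \<in> F s \<rightarrow>\<^sub>M K"
  by (rule measurable_from_graph_history[OF G])

lemma space_F: "space (F s) = space M"
  by (rule space_history[OF G])

lemma F_subalgebra: "subalgebra M (F s)"
  using history_subset[where X=X and s=s, OF G X_measurable] space_F[of s] by (auto simp: subalgebra_def)

lemma V_history:
  assumes "0 \<le> r" "r \<le> s"
  shows "V r \<in> borel_measurable (F s)"
proof -
  have "(\<lambda>\<omega>. gavg \<omega> (X r \<omega>)) \<in> borel_measurable (F s)"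
    by (rule measurable_compose_countable'[OF G_history[OF gavg_measurable] X_history[OF assms]])
      (simp add: countable_finite finite_configs)
  then show ?thesis
    unfolding V_def[abs_def] by measurable
qed

lemma V_measurable: "0 \<le> r \<Longrightarrow> V r \<in> borel_measurable M"
  using measurable_from_subalg[OF F_subalgebra V_history[of r r]] by simp

lemma norm_gavg_diff_le:
  assumes "\<omega> \<in> space M" "0 \<le> t"
  shows "norm (gavg \<omega> \<eta> - u t) \<le> 2"
proof -
  have "norm (gavg \<omega> \<eta>) \<le> 1"
    by (intro weighted_graph.good_average_norm_le[OF weighted_graph_adj] assms Delta_norm_le state_indicator_Delta)
  then show ?thesis
    using norm_triangle_ineq4[of "gavg \<omega> \<eta>" "u t"] Delta_norm_le[OF u_Delta[OF assms(2)]] by linarith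
qed

lemma norm_gavg_diff_sq_le: "\<omega> \<in> space M \<Longrightarrow> 0 \<le> t \<Longrightarrow> (norm (gavg \<omega> \<eta> - u t))\<^sup>2 \<le> 4"
  using power_mono[OF norm_gavg_diff_le[of \<omega> t \<eta>], of 2] by simp

text \<open>\<open>A\<close> is taken from the history up to \<open>t\<close> because it will be the
  event that the path has not been stopped at any grid time up to \<open>t\<close>.\<close>

lemma V_step:
  assumes t: "0 \<le> t" and h: "0 \<le> h" "h * R \<le> 1" and A: "A \<in> sets (F t)"
    and A_le: "\<And>\<omega>. \<omega> \<in> A \<Longrightarrow> rate_sum \<omega> \<le> R \<and> mf_error (real CARD('s)) N (graph_disc \<omega>) \<le> \<eta>0"
  shows "(\<integral>\<omega>. indicator A \<omega> * V (t + h) \<omega> \<partial>M)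
    \<le> (1 + 6 * C * h) * (\<integral>\<omega>. indicator A \<omega> * V t \<omega> \<partial>M)
      + (h * (2 * C * \<eta>0\<^sup>2 + 4 * real CARD('s) * C / real N) + (11 * C\<^sup>2 + 4 * R\<^sup>2) * h\<^sup>2)"
proof -
  define \<kappa> where "\<kappa> = h * (2 * C * \<eta>0\<^sup>2 + 4 * real CARD('s) * C / real N) + (11 * C\<^sup>2 + 4 * R\<^sup>2) * h\<^sup>2"
  have \<kappa>0: "0 \<le> \<kappa>"
    unfolding \<kappa>_def using h C_nonneg by (intro add_nonneg_nonneg mult_nonneg_nonneg divide_nonneg_nonneg) auto
  have AM: "A \<in> events" and Asp: "A \<subseteq> space M"
    using A F_subalgebra[of t] sets.sets_into_space[OF A] by (auto simp: subalgebra_def space_F)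
  have int: "integrable M (\<lambda>\<omega>. indicator A \<omega> * V t \<omega>)"
  proof (rule integrable_const_bound[of _ 4])
    show "AE \<omega> in M. norm (indicator A \<omega> * V t \<omega>) \<le> 4"
      using norm_gavg_diff_sq_le[OF _ t] by (intro AE_I2) (auto simp: V_def indicator_def)
    show "(\<lambda>\<omega>. indicator A \<omega> * V t \<omega>) \<in> borel_measurable M"
      using V_measurable[OF t] AM by measurable
  qed
  have int1: "integrable M (indicat_real A)"
    using AM by (simp add: less_top[symmetric])
  have eq: "indicator A \<omega> * ((1 + 6 * C * h) * V t \<omega> + \<kappa>)
      = (1 + 6 * C * h) * (indicator A \<omega> * V t \<omega>) + \<kappa> * indicator A \<omega>" for \<omega>
    by (simp add: algebra_simps)
  have "(\<integral>\<omega>. indicator A \<omega> * (norm (gavg \<omega> (X (t + h) \<omega>) - u (t + h)))\<^sup>2 \<partial>M)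
      \<le> (\<integral>\<omega>. indicator A \<omega> * ((1 + 6 * C * h) * V t \<omega> + \<kappa>) \<partial>M)"
  proof (rule markov_step[where g="\<lambda>y \<omega>. (norm (gavg \<omega> y - u (t + h)))\<^sup>2" and B=4, OF chain finite_configs G t h(1) A])
    show "(\<lambda>\<omega>. (norm (gavg \<omega> y - u (t + h)))\<^sup>2) \<in> borel_measurable G" for y
      using gavg_measurable[of y] by measurable
    show "\<bar>(norm (gavg \<omega> y - u (t + h)))\<^sup>2\<bar> \<le> 4" if "\<omega> \<in> space M" for y \<omega>
      using norm_gavg_diff_sq_le[OF that, of "t + h"] t h by simp
    show "integrable M (\<lambda>\<omega>. indicator A \<omega> * ((1 + 6 * C * h) * V t \<omega> + \<kappa>))"
      unfolding eq using int int1 by auto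
    fix \<omega> assume \<omega>A: "\<omega> \<in> A"
    then have \<omega>: "\<omega> \<in> space M" using Asp by auto
    interpret weighted_graph N deg "adj \<omega>" using weighted_graph_adj[OF \<omega>] .
    have R: "(\<Sum>y\<in>configs N. \<bar>generator Q N deg (adj \<omega>) \<zeta> y\<bar>) \<le> R" if "\<zeta> \<in> configs N" for \<zeta>
    proof -
      have "(\<Sum>y\<in>configs N. \<bar>generator Q N deg (adj \<omega>) \<zeta> y\<bar>) \<le> rate_sum \<omega>"
        unfolding rate_sum_def using that
        by (intro member_le_sum[where f="\<lambda>\<zeta>. \<Sum>y\<in>configs N. \<bar>generator Q N deg (adj \<omega>) \<zeta> y\<bar>"])
          (auto simp: finite_configs intro: sum_nonneg)
      then show ?thesis using A_le[OF \<omega>A] by simp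
    qed
    show "(\<Sum>y\<in>configs N. transition_prob (configs N) (generator Q N deg (adj \<omega>)) h (X t \<omega>) y
        * (norm (gavg \<omega> y - u (t + h)))\<^sup>2) \<le> (1 + 6 * C * h) * V t \<omega> + \<kappa>"
      using one_step[OF rf Qb X_configs[OF t \<omega>] u t h R, of \<eta>0] A_le[OF \<omega>A]
      by (simp add: V_def \<kappa>_def graph_disc_def)
  qed
  also have "\<dots> = (1 + 6 * C * h) * (\<integral>\<omega>. indicator A \<omega> * V t \<omega> \<partial>M) + \<kappa> * prob A"
    unfolding eq using int int1 AM by simp
  also have "\<dots> \<le> (1 + 6 * C * h) * (\<integral>\<omega>. indicator A \<omega> * V t \<omega> \<partial>M) + \<kappa>"
    using \<kappa>0 by (intro add_left_mono) (simp add: mult_left_le)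
  finally show ?thesis
    by (simp add: V_def \<kappa>_def)
qed

text \<open>The initial event for \<open>maximal_inequality\<close>, decided at time 0:
  \<open>\<delta>\<close> controls the graph and the initial state, \<open>R\<close> the total
  rate.\<close>

definition start :: "real \<Rightarrow> real \<Rightarrow> 'w set" where
  "start R \<delta> = {\<omega> \<in> space M. graph_disc \<omega> \<le> \<delta> \<and> rate_sum \<omega> \<le> R
      \<and> norm (average N (state_indicator (X 0 \<omega>)) - u 0) \<le> \<delta>}"

lemma start_history: "start R \<delta> \<in> sets (F 0)"
proof -
  have [measurable]: "graph_disc \<in> borel_measurable (F 0)" "rate_sum \<in> borel_measurable (F 0)"
    by (intro G_history graph_disc_measurable rate_sum_measurable)+
  have "(\<lambda>\<omega>. average N (state_indicator (X 0 \<omega>)) :: real^'s) \<in> borel_measurable (F 0)"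
    by (rule measurable_compose[OF X_history[of 0 0]]) auto
  then have [measurable]: "(\<lambda>\<omega>. norm (average N (state_indicator (X 0 \<omega>)) - u 0)) \<in> borel_measurable (F 0)"
    by measurable
  have "{\<omega> \<in> space (F 0). graph_disc \<omega> \<le> \<delta> \<and> rate_sum \<omega> \<le> R
      \<and> norm (average N (state_indicator (X 0 \<omega>)) - u 0) \<le> \<delta>} \<in> sets (F 0)"
    by measurable
  then show ?thesis
    by (simp add: start_def space_F)
qed

lemma mf_error_mono: "0 \<le> x \<Longrightarrow> x \<le> y \<Longrightarrow> 0 \<le> c \<Longrightarrow> mf_error c N x \<le> mf_error c N y"
  unfolding mf_error_def by (intro add_mono mult_left_mono) auto

text \<open>On the right-hand side \<open>R\<close> occurs only together with the mesh
  \<open>T / m\<close>, so that the mesh can be refined for fixed \<open>R\<close>. The term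
  \<open>4 * \<delta>\<^sup>2\<close> comes from two errors of size \<open>\<delta>\<close> at time
  0: \<open>average\<close> against \<open>u\<close>, and \<open>good_average\<close> against
  \<open>average\<close>.\<close>

lemma V_grid:
  assumes T: "0 < T" and \<delta>: "0 \<le> \<delta>" and \<epsilon>: "0 < \<epsilon>" and m: "0 < m" and R: "T / real m * R \<le> 1"
  shows "\<epsilon> * prob {\<omega> \<in> start R \<delta>. \<exists>k\<le>m. \<epsilon> \<le> V (real k * (T / real m)) \<omega>}
    \<le> exp (6 * C * T) * (4 * \<delta>\<^sup>2 + T * (mf_rate C (real CARD('s)) N \<delta> + (11 * C\<^sup>2 + 4 * R\<^sup>2) * (T / real m)))"
proof -
  define h where "h = T / real m"
  define \<gamma> where "\<gamma> = h * mf_rate C (real CARD('s)) N \<delta> + (11 * C\<^sup>2 + 4 * R\<^sup>2) * h\<^sup>2"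
  define U where "U k = V (real k * h)" for k
  have h: "0 \<le> h" "h * R \<le> 1" using T m R by (auto simp: h_def)
  have rt: "0 \<le> mf_rate C (real CARD('s)) N \<delta>"
    unfolding mf_rate_def using C_nonneg by auto
  have "\<epsilon> * prob {\<omega> \<in> start R \<delta>. \<exists>k\<le>m. \<epsilon> \<le> U k \<omega>} \<le> exp ((6 * C * h) * real m) * (4 * \<delta>\<^sup>2 + real m * \<gamma>)"
  proof (rule maximal_inequality[where B=4])
    show "start R \<delta> \<in> events"
      using start_history F_subalgebra[of 0] by (auto simp: subalgebra_def)
    show "U k \<in> borel_measurable M" for k
      unfolding U_def using h by (intro V_measurable) auto
    show "0 \<le> U k \<omega>" for k \<omega> by (simp add: U_def V_def)
    show "U k \<omega> \<le> 4" if "\<omega> \<in> space M" for k \<omega>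
      unfolding U_def V_def using that h by (intro norm_gavg_diff_sq_le) auto
    show "U 0 \<omega> \<le> 4 * \<delta>\<^sup>2" if \<omega>: "\<omega> \<in> start R \<delta>" for \<omega>
    proof -
      have sp: "\<omega> \<in> space M" and d: "graph_disc \<omega> \<le> \<delta>"
        and x0: "norm (average N (state_indicator (X 0 \<omega>)) - u 0) \<le> \<delta>"
        using \<omega> by (auto simp: start_def)
      interpret weighted_graph N deg "adj \<omega>" using weighted_graph_adj[OF sp] .
      have "norm (average N (state_indicator (X 0 \<omega>)) - gavg \<omega> (X 0 \<omega>)) \<le> \<delta>"
        using average_good_average_le[of "state_indicator (X 0 \<omega>)"] d Delta_norm_le[OF state_indicator_Delta]
        unfolding graph_disc_def by (meson order_trans)
      then have "norm (gavg \<omega> (X 0 \<omega>) - u 0) \<le> 2 * \<delta>"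
        using x0 norm_triangle_ineq4[of "average N (state_indicator (X 0 \<omega>)) - u 0"
            "average N (state_indicator (X 0 \<omega>)) - gavg \<omega> (X 0 \<omega>)"] by simp
      then show ?thesis
        using power_mono[of "norm (gavg \<omega> (X 0 \<omega>) - u 0)" "2 * \<delta>" 2] by (simp add: U_def V_def power_mult_distrib)
    qed
    fix k assume k: "k < m"
    define A where "A = {\<omega> \<in> start R \<delta>. \<forall>j<Suc k. U j \<omega> < \<epsilon>}"
    have kh: "0 \<le> real k * h" using h by simp
    have "start R \<delta> \<in> sets (F (real k * h))"
      using start_history history_mono[OF G kh, of X] by blast
    moreover have "(\<Inter>j\<in>{..k}. {\<omega> \<in> space (F (real k * h)). U j \<omega> < \<epsilon>}) \<in> sets (F (real k * h))"
    proof (intro sets.finite_INT)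
      fix j assume "j \<in> {..k}"
      then have [measurable]: "U j \<in> borel_measurable (F (real k * h))"
        unfolding U_def using h by (intro V_history) (auto intro: mult_right_mono)
      show "{\<omega> \<in> space (F (real k * h)). U j \<omega> < \<epsilon>} \<in> sets (F (real k * h))" by measurable
    qed auto
    moreover have "A = start R \<delta> \<inter> (\<Inter>j\<in>{..k}. {\<omega> \<in> space (F (real k * h)). U j \<omega> < \<epsilon>})"
      unfolding A_def space_F by (auto simp: start_def less_Suc_eq_le)
    ultimately have A: "A \<in> sets (F (real k * h))" by simp
    have "(\<integral>\<omega>. indicator A \<omega> * V (real k * h + h) \<omega> \<partial>M)
        \<le> (1 + 6 * C * h) * (\<integral>\<omega>. indicator A \<omega> * V (real k * h) \<omega> \<partial>M) + \<gamma>"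
      unfolding \<gamma>_def mf_rate_def
    proof (rule V_step[OF kh h A])
      fix \<omega> assume "\<omega> \<in> A"
      then have sp: "\<omega> \<in> space M" and "graph_disc \<omega> \<le> \<delta>" "rate_sum \<omega> \<le> R" by (auto simp: A_def start_def)
      moreover have "0 \<le> graph_disc \<omega>"
        using weighted_graph.discrepancy_nonneg[OF weighted_graph_adj[OF sp]] by (simp add: graph_disc_def)
      ultimately show "rate_sum \<omega> \<le> R \<and> mf_error (real CARD('s)) N (graph_disc \<omega>) \<le> mf_error (real CARD('s)) N \<delta>"
        using mf_error_mono by auto
    qed
    then show "(\<integral>\<omega>. indicator {\<omega> \<in> start R \<delta>. \<forall>j<Suc k. U j \<omega> < \<epsilon>} \<omega> * U (Suc k) \<omega> \<partial>M)
        \<le> (1 + 6 * C * h) * (\<integral>\<omega>. indicator {\<omega> \<in> start R \<delta>. \<forall>j<Suc k. U j \<omega> < \<epsilon>} \<omega> * U k \<omega> \<partial>M) + \<gamma>"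
      unfolding A_def by (simp add: U_def algebra_simps)
  qed (use \<delta> \<epsilon> h rt C_nonneg in \<open>auto simp: \<gamma>_def\<close>)
  also have "(6 * C * h) * real m = 6 * C * T" using m by (simp add: h_def)
  also have "real m * \<gamma> = T * (mf_rate C (real CARD('s)) N \<delta> + (11 * C\<^sup>2 + 4 * R\<^sup>2) * h)"
    using m by (simp add: \<gamma>_def h_def power2_eq_square algebra_simps)
  finally show ?thesis
    unfolding U_def h_def .
qed

end

section \<open>Suprema over time\<close>

text \<open>The levels are nested and all contain \<open>T\<close>, the one time that cannot be
  approximated from the right inside the interval.\<close>

definition dyadic :: "real \<Rightarrow> real set" where
  "dyadic T = (\<Union>n. (\<lambda>k. real k * (T / 2 ^ n)) ` {..2 ^ n})"

lemma countable_dyadic: "countable (dyadic T)"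
  unfolding dyadic_def by auto

lemma dyadic_subset: "0 < T \<Longrightarrow> dyadic T \<subseteq> {0..T}"
proof -
  assume T: "0 < T"
  have "real k * (T / 2 ^ n) \<le> T" if "k \<le> 2 ^ n" for k n
  proof -
    have "real k \<le> 2 ^ n" using that by (metis of_nat_le_iff of_nat_numeral of_nat_power)
    then show ?thesis using T by (simp add: field_simps)
  qed
  then show ?thesis using T by (auto simp: dyadic_def)
qed

lemma zero_in_dyadic: "0 \<in> dyadic T"
  by (force simp: dyadic_def)

lemma right_continuous_le_from_dyadic:
  fixes f :: "real \<Rightarrow> real"
  assumes T: "0 < T" and t: "t \<in> {0..T}"
    and cont: "\<And>t. t \<in> {0..<T} \<Longrightarrow> continuous (at t within {t..}) f"
    and le: "\<And>s. s \<in> dyadic T \<Longrightarrow> f s \<le> c"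
  shows "f t \<le> c"
proof (cases "t = T")
  case True
  have "T \<in> dyadic T"
    unfolding dyadic_def by (rule UN_I[of 0]) (auto intro!: image_eqI[of _ _ 1])
  then show ?thesis using le True by simp
next
  case False
  then have tT: "0 \<le> t" "t < T" using t by auto
  \<comment> \<open>Index of the first grid point of level \<open>n\<close> that is not before
    \<open>t\<close>; these points converge to \<open>t\<close> from the right.\<close>
  define k where "k n = nat \<lceil>t * 2 ^ n / T\<rceil>" for n
  define s where "s n = real (k n) * (T / 2 ^ n)" for n
  have k1: "t * 2 ^ n / T \<le> real (k n)" for n
    unfolding k_def by (rule real_nat_ceiling_ge)
  have "0 \<le> t * 2 ^ n / T" for n using tT by simp
  then have k2: "real (k n) \<le> t * 2 ^ n / T + 1" for n
    unfolding k_def using of_int_ceiling_le_add_one[of "t * 2 ^ n / T"] by simp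
  have k3: "k n \<le> 2 ^ n" for n
  proof -
    have "t * 2 ^ n / T \<le> of_int (2 ^ n)" using tT T by (simp add: field_simps)
    then have "\<lceil>t * 2 ^ n / T\<rceil> \<le> 2 ^ n" by (simp only: ceiling_le_iff)
    then show ?thesis unfolding k_def by (simp add: nat_le_iff)
  qed
  have s1: "t \<le> s n" for n
    using k1[of n] T by (simp add: s_def field_simps)
  have s2: "s n \<le> t + T / 2 ^ n" for n
    using k2[of n] T by (simp add: s_def field_simps)
  have "(\<lambda>n. T / 2 ^ n) \<longlonglongrightarrow> 0"
    using tendsto_mult[OF tendsto_const[of T] LIMSEQ_inverse_realpow_zero[of 2]] by (simp add: divide_inverse)
  then have "(\<lambda>n. t + T / 2 ^ n) \<longlonglongrightarrow> t"
    using tendsto_add[OF tendsto_const[of t]] by fastforce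
  then have "s \<longlonglongrightarrow> t"
    by (rule tendsto_sandwich[OF always_eventually[OF allI] always_eventually[OF allI] tendsto_const, rotated 2])
      (use s1 s2 in auto)
  then have "(f \<circ> s) \<longlonglongrightarrow> f t"
    using cont[of t] tT s1 unfolding continuous_within_sequentially by auto
  moreover have "f (s n) \<le> c" for n
  proof (rule le)
    show "s n \<in> dyadic T"
      unfolding dyadic_def s_def using k3 by blast
  qed
  ultimately show ?thesis
    by (intro LIMSEQ_le_const2) auto
qed

lemma SUP_le_from_dyadic:
  fixes f :: "real \<Rightarrow> real"
  assumes "0 < T" "\<And>t. t \<in> {0..<T} \<Longrightarrow> continuous (at t within {t..}) f"
    and "\<And>s. s \<in> dyadic T \<Longrightarrow> f s \<le> c"
  shows "(SUP t\<in>{0..T}. f t) \<le> c"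
proof (rule cSUP_least)
  fix t assume "t \<in> {0..T}"
  from right_continuous_le_from_dyadic[OF assms(1) this assms(2,3)] show "f t \<le> c" .
qed (use assms(1) in simp)

text \<open>Right-continuity reduces the supremum to the countable set \<open>dyadic T\<close>. The
  bound \<open>B\<close> makes the real-valued suprema meaningful.\<close>

lemma SUP_measurable:
  fixes f :: "real \<Rightarrow> 'w \<Rightarrow> real"
  assumes T: "0 < T" and meas: "\<And>t. t \<in> {0..T} \<Longrightarrow> f t \<in> borel_measurable M"
    and bd: "\<And>t \<omega>. \<omega> \<in> space M \<Longrightarrow> t \<in> {0..T} \<Longrightarrow> f t \<omega> \<le> B"
    and cont: "\<And>t \<omega>. \<omega> \<in> space M \<Longrightarrow> t \<in> {0..<T} \<Longrightarrow> continuous (at t within {t..}) (\<lambda>t. f t \<omega>)"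
  shows "(\<lambda>\<omega>. SUP t\<in>{0..T}. f t \<omega>) \<in> borel_measurable M"
proof -
  have "(\<lambda>\<omega>. SUP t\<in>dyadic T. f t \<omega>) \<in> borel_measurable M"
    using meas bd dyadic_subset[OF T] by (intro borel_measurable_cSUP countable_dyadic) (auto intro!: bdd_aboveI[of _ B])
  moreover have "(SUP t\<in>{0..T}. f t \<omega>) = (SUP t\<in>dyadic T. f t \<omega>)" if \<omega>: "\<omega> \<in> space M" for \<omega>
  proof (rule antisym)
    have bdd: "bdd_above ((\<lambda>t. f t \<omega>) ` {0..T})"
      using bd[OF \<omega>] by (auto intro!: bdd_aboveI[of _ B])
    then have bdd': "bdd_above ((\<lambda>t. f t \<omega>) ` dyadic T)"
      using dyadic_subset[OF T] by (meson bdd_above_mono image_mono)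
    show "(SUP t\<in>{0..T}. f t \<omega>) \<le> (SUP t\<in>dyadic T. f t \<omega>)"
      by (rule SUP_le_from_dyadic[OF T cont[OF \<omega>]]) (auto intro: cSUP_upper bdd')
    show "(SUP t\<in>dyadic T. f t \<omega>) \<le> (SUP t\<in>{0..T}. f t \<omega>)"
      using zero_in_dyadic[of T] bdd dyadic_subset[OF T] by (intro cSUP_subset_mono) auto
  qed
  ultimately show ?thesis
    by (simp cong: measurable_cong)
qed

lemma SUP_nonneg:
  fixes f :: "real \<Rightarrow> real"
  assumes "0 < T" "\<And>t. t \<in> {0..T} \<Longrightarrow> 0 \<le> f t \<and> f t \<le> B"
  shows "0 \<le> (SUP t\<in>{0..T}. f t)"
proof -
  have "bdd_above (f ` {0..T})"
    using assms(2) by (auto intro!: bdd_aboveI[of _ B])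
  then have "f 0 \<le> (SUP t\<in>{0..T}. f t)"
    using assms(1) by (intro cSUP_upper) auto
  then show ?thesis
    using assms(1) assms(2)[of 0] by simp
qed

lemma mean_field_continuous:
  assumes "mean_field_solution Q u" "0 \<le> t"
  shows "continuous (at t within {t..}) u"
proof -
  have "(u has_vector_derivative Q (u t) *v u t) (at t within {0..})"
    using assms by (simp add: mean_field_solution_def)
  then have "continuous (at t within {0..}) u"
    by (rule has_vector_derivative_continuous)
  then show ?thesis
    by (rule continuous_within_subset) (use assms in auto)
qed

lemma continuous_norm1: "continuous F f \<Longrightarrow> continuous F (\<lambda>t. norm1 (f t :: real^'s))"
  unfolding norm1_def by (intro continuous_intros)

lemma norm1_measurable [measurable]: "norm1 \<in> borel_measurable borel"
  unfolding norm1_def[abs_def]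
  by (intro borel_measurable_continuous_onI continuous_intros)

lemma norm1_Delta_diff_le:
  assumes "norm v \<le> 1" "u \<in> (Delta :: (real^'s) set)"
  shows "norm1 (v - u) \<le> 2 * real CARD('s)"
proof -
  have "norm (v - u) \<le> 2"
    using norm_triangle_ineq4[of v u] assms(1) Delta_norm_le[OF assms(2)] by linarith
  then have "real CARD('s) * norm (v - u) \<le> real CARD('s) * 2"
    by (intro mult_left_mono) auto
  then show ?thesis
    using norm1_le[of "v - u"] by linarith
qed

lemma norm1_nonneg: "0 \<le> norm1 v"
  unfolding norm1_def by (intro sum_nonneg) auto

lemma average_norm_le:
  assumes "1 \<le> N" "\<And>i. i \<in> {1..N} \<Longrightarrow> norm (v i) \<le> 1"
  shows "norm (average N v) \<le> 1"
proof -
  have "norm (\<Sum>i\<in>{1..N}. v i) \<le> real (card {1..N}) * 1"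
    using assms(2) by (intro sum_norm_bound) auto
  then show ?thesis
    using assms(1) by (simp add: average_def field_simps)
qed

section \<open>From grids to all times\<close>

context er_chain
begin

lemma X_right_continuous:
  assumes \<omega>: "\<omega> \<in> space M" and t: "0 \<le> t"
  shows "continuous (at t within {t..}) (\<lambda>t. norm1 (average N (state_indicator (X t \<omega>)) - u t))"
proof -
  obtain \<delta> where \<delta>: "\<delta> > 0" "\<And>r. r \<in> {t..<t + \<delta>} \<Longrightarrow> X r \<omega> = X t \<omega>"
    using conjunct1[OF conjunct2[OF chain[unfolded conditional_markov_chain_def]]] \<omega> t by blast
  have "continuous (at t within {t..}) (\<lambda>r. average N (state_indicator (X r \<omega>)) :: real^'s)"
    unfolding continuous_within
  proof (rule tendsto_eventually)
    show "\<forall>\<^sub>F r in at t within {t..}. average N (state_indicator (X r \<omega>)) = (average N (state_indicator (X t \<omega>)) :: real^'s)"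
      unfolding eventually_at
    proof (rule exI[of _ \<delta>], intro conjI ballI impI \<delta>(1))
      fix r assume "r \<in> {t..}" "r \<noteq> t \<and> dist r t < \<delta>"
      then have "X r \<omega> = X t \<omega>"
        by (intro \<delta>(2)) (simp add: dist_real_def)
      then show "average N (state_indicator (X r \<omega>)) = (average N (state_indicator (X t \<omega>)) :: real^'s)"
        by simp
    qed
  qed
  then show ?thesis
    using mean_field_continuous[OF u t] by (intro continuous_norm1 continuous_diff)
qed

definition exceed :: "real \<Rightarrow> real \<Rightarrow> nat \<Rightarrow> 'w set" where
  "exceed T \<epsilon> n = {\<omega> \<in> space M. \<exists>k\<le>2 ^ n. \<epsilon> \<le> V (real k * (T / 2 ^ n)) \<omega>}"

lemma exceed_events:
  assumes "0 < T" shows "exceed T \<epsilon> n \<in> events"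
proof -
  have "exceed T \<epsilon> n = (\<Union>k\<in>{..2 ^ n}. {\<omega> \<in> space M. \<epsilon> \<le> V (real k * (T / 2 ^ n)) \<omega>})"
    by (auto simp: exceed_def)
  moreover have "{\<omega> \<in> space M. \<epsilon> \<le> V (real k * (T / 2 ^ n)) \<omega>} \<in> events" for k
  proof -
    have [measurable]: "V (real k * (T / 2 ^ n)) \<in> borel_measurable M"
      using assms by (intro V_measurable) auto
    show ?thesis by measurable
  qed
  ultimately show ?thesis by auto
qed

lemma incseq_exceed: "incseq (exceed T \<epsilon>)"
proof (rule incseq_SucI, rule subsetI)
  fix n \<omega> assume "\<omega> \<in> exceed T \<epsilon> n"
  then obtain k where k: "\<omega> \<in> space M" "k \<le> 2 ^ n" "\<epsilon> \<le> V (real k * (T / 2 ^ n)) \<omega>"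
    by (auto simp: exceed_def)
  \<comment> \<open>The grid point with index \<open>k\<close> has index \<open>2 * k\<close> on the
    next level.\<close>
  moreover have "real (2 * k) * (T / 2 ^ Suc n) = real k * (T / 2 ^ n)"
    by simp
  ultimately have "2 * k \<le> 2 ^ Suc n \<and> \<epsilon> \<le> V (real (2 * k) * (T / 2 ^ Suc n)) \<omega>"
    by simp
  then show "\<omega> \<in> exceed T \<epsilon> (Suc n)"
    unfolding exceed_def using k(1) by blast
qed

lemma graph_disc_measurable_M [measurable]: "graph_disc \<in> borel_measurable M"
  and rate_sum_measurable_M [measurable]: "rate_sum \<in> borel_measurable M"
  using measurable_from_subalg[of M G] space_G sets_G graph_disc_measurable rate_sum_measurable
  by (auto simp: subalgebra_def)

lemma average_X_measurable: "0 \<le> t \<Longrightarrow> (\<lambda>\<omega>. average N (state_indicator (X t \<omega>)) :: real^'s) \<in> borel_measurable M"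
  by (rule measurable_compose[OF X_measurable]) auto

text \<open>The mesh tends to 0 with \<open>R\<close> fixed: the step condition on \<open>R\<close>
  holds from some level on, and the term with \<open>R\<^sup>2\<close> disappears.\<close>

lemma prob_exceed_start:
  assumes T: "0 < T" and \<delta>: "0 \<le> \<delta>" and \<epsilon>: "0 < \<epsilon>"
  shows "\<epsilon> * prob (start R \<delta> \<inter> (\<Union>n. exceed T \<epsilon> n))
    \<le> exp (6 * C * T) * (4 * \<delta>\<^sup>2 + T * mf_rate C (real CARD('s)) N \<delta>)"
proof -
  let ?r = "mf_rate C (real CARD('s)) N \<delta>"
  have st: "start R \<delta> \<in> events"
    using start_history F_subalgebra[of 0] by (auto simp: subalgebra_def)
  have h0: "(\<lambda>n. T / 2 ^ n) \<longlonglongrightarrow> 0"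
    using tendsto_mult[OF tendsto_const[of T] LIMSEQ_inverse_realpow_zero[of 2]] by (simp add: divide_inverse)
  have "(\<lambda>n. prob (start R \<delta> \<inter> exceed T \<epsilon> n)) \<longlonglongrightarrow> prob (\<Union>n. start R \<delta> \<inter> exceed T \<epsilon> n)"
  proof (rule finite_Lim_measure_incseq)
    show "range (\<lambda>n. start R \<delta> \<inter> exceed T \<epsilon> n) \<subseteq> events"
      using st exceed_events[OF T] by auto
    show "incseq (\<lambda>n. start R \<delta> \<inter> exceed T \<epsilon> n)"
      using incseq_exceed[of T \<epsilon>] unfolding incseq_def by blast
  qed
  then have l: "(\<lambda>n. \<epsilon> * prob (start R \<delta> \<inter> exceed T \<epsilon> n)) \<longlonglongrightarrow> \<epsilon> * prob (start R \<delta> \<inter> (\<Union>n. exceed T \<epsilon> n))"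
    by (intro tendsto_mult tendsto_const) simp
  have "(\<lambda>n. exp (6 * C * T) * (4 * \<delta>\<^sup>2 + T * (?r + (11 * C\<^sup>2 + 4 * R\<^sup>2) * (T / 2 ^ n))))
      \<longlonglongrightarrow> exp (6 * C * T) * (4 * \<delta>\<^sup>2 + T * (?r + (11 * C\<^sup>2 + 4 * R\<^sup>2) * 0))"
    by (intro tendsto_intros h0)
  then have r: "(\<lambda>n. exp (6 * C * T) * (4 * \<delta>\<^sup>2 + T * (?r + (11 * C\<^sup>2 + 4 * R\<^sup>2) * (T / 2 ^ n))))
      \<longlonglongrightarrow> exp (6 * C * T) * (4 * \<delta>\<^sup>2 + T * ?r)"
    by simp
  have "(\<lambda>n. T / 2 ^ n * R) \<longlonglongrightarrow> 0 * R"
    by (intro tendsto_mult h0 tendsto_const)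
  then have "\<forall>\<^sub>F n in sequentially. T / 2 ^ n * R < 1"
    by (rule order_tendstoD) simp
  then have "\<forall>\<^sub>F n in sequentially. \<epsilon> * prob (start R \<delta> \<inter> exceed T \<epsilon> n)
      \<le> exp (6 * C * T) * (4 * \<delta>\<^sup>2 + T * (?r + (11 * C\<^sup>2 + 4 * R\<^sup>2) * (T / 2 ^ n)))"
  proof (rule eventually_mono)
    fix n assume n: "T / 2 ^ n * R < 1"
    have "start R \<delta> \<inter> exceed T \<epsilon> n = {\<omega> \<in> start R \<delta>. \<exists>k\<le>2 ^ n. \<epsilon> \<le> V (real k * (T / real (2 ^ n))) \<omega>}"
      by (auto simp: start_def exceed_def)
    then show "\<epsilon> * prob (start R \<delta> \<inter> exceed T \<epsilon> n)
      \<le> exp (6 * C * T) * (4 * \<delta>\<^sup>2 + T * (?r + (11 * C\<^sup>2 + 4 * R\<^sup>2) * (T / 2 ^ n)))"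
      using V_grid[OF T \<delta> \<epsilon>, of "2 ^ n" R] n by simp
  qed
  then show ?thesis
    by (rule tendsto_le[OF sequentially_bot r l])
qed

text \<open>The bound on \<open>start R \<delta>\<close> is now free of \<open>R\<close>, so the
  truncation can be removed: for fixed \<open>N\<close> the total rate is a finite random variable
  with vanishing tail.\<close>

lemma prob_exceed:
  assumes T: "0 < T" and \<delta>: "0 \<le> \<delta>" and \<epsilon>: "0 < \<epsilon>"
  shows "prob (\<Union>n. exceed T \<epsilon> n)
    \<le> exp (6 * C * T) * (4 * \<delta>\<^sup>2 + T * mf_rate C (real CARD('s)) N \<delta>) / \<epsilon>
      + prob {\<omega> \<in> space M. graph_disc \<omega> > \<delta>}
      + prob {\<omega> \<in> space M. dist (average N (state_indicator (X 0 \<omega>))) (u 0) > \<delta>}"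
proof -
  let ?b = "exp (6 * C * T) * (4 * \<delta>\<^sup>2 + T * mf_rate C (real CARD('s)) N \<delta>) / \<epsilon>"
  let ?D = "{\<omega> \<in> space M. graph_disc \<omega> > \<delta>}"
  let ?X = "{\<omega> \<in> space M. dist (average N (state_indicator (X 0 \<omega>))) (u 0) > \<delta>}"
  let ?E = "\<Union>n. exceed T \<epsilon> n"
  have [measurable]: "(\<lambda>\<omega>. average N (state_indicator (X 0 \<omega>)) :: real^'s) \<in> borel_measurable M"
    by (rule average_X_measurable) simp
  have D: "?D \<in> events" and XM: "?X \<in> events" and RM: "{\<omega> \<in> space M. rate_sum \<omega> > r} \<in> events" for r
    by measurable
  have st: "start R \<delta> \<in> events" for R
    using start_history F_subalgebra[of 0] by (auto simp: subalgebra_def)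
  have E: "?E \<in> events" using exceed_events[OF T] by auto
  have "prob ?E \<le> ?b + prob ?D + prob ?X + prob {\<omega> \<in> space M. rate_sum \<omega> > real r}" for r
  proof -
    let ?R = "{\<omega> \<in> space M. rate_sum \<omega> > real r}"
    have "?E \<subseteq> ((start (real r) \<delta> \<inter> ?E) \<union> ?D) \<union> (?X \<union> ?R)"
      by (auto simp: start_def exceed_def dist_norm not_less not_le)
    then have "prob ?E \<le> prob (((start (real r) \<delta> \<inter> ?E) \<union> ?D) \<union> (?X \<union> ?R))"
      using D XM RM st E by (intro finite_measure_mono) auto
    also have "\<dots> \<le> prob ((start (real r) \<delta> \<inter> ?E) \<union> ?D) + prob (?X \<union> ?R)"
      using D XM RM st E by (intro measure_Un_le) auto
    also have "\<dots> \<le> (prob (start (real r) \<delta> \<inter> ?E) + prob ?D) + (prob ?X + prob ?R)"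
      using D XM RM st E by (intro add_mono measure_Un_le) auto
    also have "prob (start (real r) \<delta> \<inter> ?E) \<le> ?b"
      using prob_exceed_start[OF T \<delta> \<epsilon>, of "real r"] \<epsilon> by (simp add: field_simps)
    finally show ?thesis by simp
  qed
  moreover have "(\<lambda>r. ?b + prob ?D + prob ?X + prob {\<omega> \<in> space M. rate_sum \<omega> > real r})
      \<longlonglongrightarrow> ?b + prob ?D + prob ?X + 0"
    by (intro tendsto_add tendsto_const tail_prob_tendsto_0 rate_sum_measurable_M)
  ultimately show ?thesis
    by (intro LIMSEQ_le_const[of _ "?b + prob ?D + prob ?X"]) auto
qed

text \<open>The threshold for \<open>V\<close> reflects the factor \<open>CARD('s)\<close> of
  \<open>norm1_le\<close> and a division of \<open>\<epsilon>\<close> into halves, one for the good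
  average and one for the bad vertices. The graph event is counted twice: in
  \<open>prob_exceed\<close>, and for the bad vertices at all grid times.\<close>

lemma prob_sup_X:
  assumes T: "0 < T" and \<delta>: "0 \<le> \<delta>" and \<epsilon>: "0 < \<epsilon>" and \<delta>\<epsilon>: "real CARD('s) * \<delta> \<le> \<epsilon> / 2"
  defines "err \<equiv> \<lambda>\<omega>. SUP t\<in>{0..T}. norm1 (average N (state_indicator (X t \<omega>)) - u t)"
  shows "err \<in> borel_measurable M"
    and "prob {\<omega> \<in> space M. dist (err \<omega>) 0 > \<epsilon>}
      \<le> exp (6 * C * T) * (4 * \<delta>\<^sup>2 + T * mf_rate C (real CARD('s)) N \<delta>) / (\<epsilon> / (2 * real CARD('s)))\<^sup>2
        + 2 * prob {\<omega> \<in> space M. graph_disc \<omega> > \<delta>}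
        + prob {\<omega> \<in> space M. dist (average N (state_indicator (X 0 \<omega>))) (u 0) > \<delta>}"
proof -
  let ?S = "real CARD('s)"
  let ?f = "\<lambda>t \<omega>. norm1 (average N (state_indicator (X t \<omega>)) - u t)"
  let ?\<epsilon> = "(\<epsilon> / (2 * ?S))\<^sup>2"
  let ?E = "\<Union>n. exceed T ?\<epsilon> n"
  have f: "?f t \<omega> \<le> 2 * ?S" if "0 \<le> t" for t \<omega>
    using that N2 by (intro norm1_Delta_diff_le average_norm_le u_Delta Delta_norm_le state_indicator_Delta) auto
  show err: "err \<in> borel_measurable M"
    unfolding err_def
  proof (rule SUP_measurable[OF T, where B="2 * ?S"])
    show "(\<lambda>\<omega>. ?f t \<omega>) \<in> borel_measurable M" if "t \<in> {0..T}" for t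
    proof -
      have [measurable]: "(\<lambda>\<omega>. average N (state_indicator (X t \<omega>)) :: real^'s) \<in> borel_measurable M"
        using that by (intro average_X_measurable) simp
      show ?thesis by measurable
    qed
  qed (use f X_right_continuous in auto)
  have "{\<omega> \<in> space M. dist (err \<omega>) 0 > \<epsilon>} \<subseteq> ?E \<union> {\<omega> \<in> space M. graph_disc \<omega> > \<delta>}"
  proof (rule subsetI, rule ccontr)
    fix \<omega> assume "\<omega> \<in> {\<omega> \<in> space M. dist (err \<omega>) 0 > \<epsilon>}"
      and n: "\<omega> \<notin> ?E \<union> {\<omega> \<in> space M. graph_disc \<omega> > \<delta>}"
    then have \<omega>: "\<omega> \<in> space M" and gt: "\<bar>err \<omega>\<bar> > \<epsilon>" and d: "graph_disc \<omega> \<le> \<delta>" by auto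
    interpret weighted_graph N deg "adj \<omega>" using weighted_graph_adj[OF \<omega>] .
    have "?f s \<omega> \<le> \<epsilon>" if s: "s \<in> dyadic T" for s
    proof -
      obtain m k where mk: "k \<le> 2 ^ m" "s = real k * (T / 2 ^ m)"
        using s by (auto simp: dyadic_def)
      have "\<not> ?\<epsilon> \<le> V s \<omega>"
        using n \<omega> mk by (auto simp: exceed_def)
      then have "norm (gavg \<omega> (X s \<omega>) - u s) < \<epsilon> / (2 * ?S)"
        unfolding V_def not_le using \<epsilon> by (auto intro: power_less_imp_less_base)
      moreover have "norm (average N (state_indicator (X s \<omega>)) - gavg \<omega> (X s \<omega>)) \<le> \<delta>"
        using average_good_average_le[of "state_indicator (X s \<omega>)"] d Delta_norm_le[OF state_indicator_Delta]
        unfolding graph_disc_def by (meson order_trans)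
      ultimately have "norm (average N (state_indicator (X s \<omega>)) - u s) \<le> \<delta> + \<epsilon> / (2 * ?S)"
        using norm_triangle_ineq[of "average N (state_indicator (X s \<omega>)) - gavg \<omega> (X s \<omega>)" "gavg \<omega> (X s \<omega>) - u s"]
        by simp
      then have "?S * norm (average N (state_indicator (X s \<omega>)) - u s) \<le> ?S * (\<delta> + \<epsilon> / (2 * ?S))"
        by (intro mult_left_mono) auto
      also have "\<dots> = ?S * \<delta> + \<epsilon> / 2" by (simp add: field_simps)
      finally show ?thesis
        using norm1_le[of "average N (state_indicator (X s \<omega>)) - u s"] \<delta>\<epsilon> by linarith
    qed
    then have "err \<omega> \<le> \<epsilon>"
      unfolding err_def using X_right_continuous[OF \<omega>] by (intro SUP_le_from_dyadic[OF T]) auto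
    moreover have "0 \<le> err \<omega>"
      unfolding err_def using f by (intro SUP_nonneg[OF T, where B="2 * ?S"]) (auto simp: norm1_nonneg)
    ultimately show False using gt by simp
  qed
  then have "prob {\<omega> \<in> space M. dist (err \<omega>) 0 > \<epsilon>} \<le> prob (?E \<union> {\<omega> \<in> space M. graph_disc \<omega> > \<delta>})"
    using exceed_events[OF T] by (intro finite_measure_mono) auto
  also have "\<dots> \<le> prob ?E + prob {\<omega> \<in> space M. graph_disc \<omega> > \<delta>}"
    using exceed_events[OF T] by (intro measure_Un_le) auto
  finally show "prob {\<omega> \<in> space M. dist (err \<omega>) 0 > \<epsilon>}
      \<le> exp (6 * C * T) * (4 * \<delta>\<^sup>2 + T * mf_rate C ?S N \<delta>) / ?\<epsilon>
        + 2 * prob {\<omega> \<in> space M. graph_disc \<omega> > \<delta>}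
        + prob {\<omega> \<in> space M. dist (average N (state_indicator (X 0 \<omega>))) (u 0) > \<delta>}"
    using prob_exceed[OF T \<delta>, of ?\<epsilon>] \<epsilon> by simp
qed

end

section \<open>Convergence in probability\<close>

text \<open>\<open>c\<close> converts the Euclidean norm to \<open>norm1\<close>, the first
  \<open>\<delta>\<close> pays for the bad vertices, and the square root is the bound of
  \<open>NIMFA_close\<close> with initial distance at most \<open>2 * \<delta>\<close>.\<close>

definition NIMFA_bound :: "real \<Rightarrow> real \<Rightarrow> real \<Rightarrow> nat \<Rightarrow> real \<Rightarrow> real" where
  "NIMFA_bound C c T N \<delta> = c * (\<delta> + sqrt (exp (6 * C * T) * (4 * \<delta>\<^sup>2 + (mf_error c N \<delta>)\<^sup>2)))"

lemma NIMFA_continuous: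
  assumes "NIMFA_solution Q N d a z" "mean_field_solution Q u" "0 \<le> t"
  shows "continuous (at t within {t..}) (\<lambda>t. norm1 (average N (z t) - u t))"
proof -
  have "continuous (at t within {0..}) (\<lambda>r. z r i)" if "i \<in> {1..N}" for i
    using assms(1,3) that unfolding NIMFA_solution_def by (meson has_vector_derivative_continuous)
  then have "continuous (at t within {t..}) (\<lambda>r. z r i)" if "i \<in> {1..N}" for i
    using that assms(3) by (meson atLeast_iff continuous_within_subset order_trans subsetI)
  then have "continuous (at t within {t..}) (\<lambda>r. average N (z r))"
    unfolding average_def by (intro continuous_scaleR continuous_const continuous_sum)
  then show ?thesis
    using mean_field_continuous[OF assms(2,3)] by (intro continuous_norm1 continuous_diff)
qed

lemma (in weighted_graph) NIMFA_average_close: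
  fixes u :: "real \<Rightarrow> real^'s"
  assumes Q: "rate_bound Q 2 C" and z: "NIMFA_solution Q N d a z" and u: "mean_field_solution Q u"
    and t: "t \<in> {0..T}" and W: "discrepancy \<le> \<delta>" and y0: "norm (average N (z 0) - u 0) \<le> \<delta>"
  shows "norm1 (average N (z t) - u t) \<le> NIMFA_bound C (real CARD('s)) T N \<delta>"
proof -
  let ?S = "real CARD('s)"
  have C: "0 \<le> C" using rate_boundD(1)[OF Q] .
  have zn: "norm (z t i) \<le> 1" if "0 \<le> t" "i \<in> {1..N}" for t i
    using z that by (intro Delta_norm_le) (auto simp: NIMFA_solution_def)
  have g: "norm (average N (z t) - good_average (z t)) \<le> \<delta>" if "0 \<le> t" for t
    by (rule order_trans[OF average_good_average_le[of "z t", OF zn[OF that]] W])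
  have "norm (good_average (z 0) - u 0) \<le> 2 * \<delta>"
    using g[of 0] y0 norm_triangle_ineq4[of "average N (z 0) - u 0" "average N (z 0) - good_average (z 0)"] by simp
  then have g0: "(norm (good_average (z 0) - u 0))\<^sup>2 \<le> 4 * \<delta>\<^sup>2"
    using power_mono[of "norm (good_average (z 0) - u 0)" "2 * \<delta>" 2] by (simp add: power_mult_distrib)
  have "0 \<le> mf_error ?S N discrepancy" using discrepancy_nonneg by (simp add: mf_error_def)
  moreover have "mf_error ?S N discrepancy \<le> mf_error ?S N \<delta>"
    using W unfolding mf_error_def by (intro add_mono mult_left_mono) auto
  ultimately have m: "(mf_error ?S N discrepancy)\<^sup>2 \<le> (mf_error ?S N \<delta>)\<^sup>2"
    by (rule power_mono[rotated])
  have "(norm (good_average (z t) - u t))\<^sup>2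
      \<le> exp (6 * C * t) * ((norm (good_average (z 0) - u 0))\<^sup>2 + (mf_error ?S N discrepancy)\<^sup>2)"
    using t by (intro NIMFA_close[OF Q z u]) simp
  also have "\<dots> \<le> exp (6 * C * T) * (4 * \<delta>\<^sup>2 + (mf_error ?S N \<delta>)\<^sup>2)"
    using g0 m t C by (intro mult_mono add_mono) (auto intro: mult_left_mono)
  finally have "norm (good_average (z t) - u t) \<le> sqrt (exp (6 * C * T) * (4 * \<delta>\<^sup>2 + (mf_error ?S N \<delta>)\<^sup>2))"
    by (rule real_le_rsqrt)
  then have "norm (average N (z t) - u t) \<le> \<delta> + sqrt (exp (6 * C * T) * (4 * \<delta>\<^sup>2 + (mf_error ?S N \<delta>)\<^sup>2))"
    using g[of t] t norm_triangle_ineq[of "average N (z t) - good_average (z t)" "good_average (z t) - u t"] by simp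
  then have "?S * norm (average N (z t) - u t) \<le> NIMFA_bound C ?S T N \<delta>"
    unfolding NIMFA_bound_def by (intro mult_left_mono) auto
  then show ?thesis
    using norm1_le[of "average N (z t) - u t"] by linarith
qed

text \<open>Given the graph and the initial values NIMFA is deterministic, so outside two
  exceptional events the bound is pathwise and no maximal inequality is involved.\<close>

lemma (in er_graph) prob_sup_NIMFA:
  fixes Q :: "real^'s \<Rightarrow> real^'s^'s" and z :: "real \<Rightarrow> 'w \<Rightarrow> nat \<Rightarrow> real^'s"
  assumes lip: "\<And>k s. locally_lipschitz (\<lambda>\<phi>. Q \<phi> $ k $ s)" and Q: "rate_bound Q 2 C"
    and u: "mean_field_solution Q u"
    and z0: "\<And>i. i \<in> {1..N} \<Longrightarrow> (\<lambda>\<omega>. z 0 \<omega> i) \<in> borel_measurable M"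
    and z: "\<And>\<omega>. \<omega> \<in> space M \<Longrightarrow> NIMFA_solution Q N deg (adj \<omega>) (\<lambda>t. z t \<omega>)"
    and T: "0 < T"
  defines "err \<equiv> \<lambda>\<omega>. SUP t\<in>{0..T}. norm1 (average N (z t \<omega>) - u t)"
  shows "err \<in> borel_measurable M"
    and "NIMFA_bound C (real CARD('s)) T N \<delta> \<le> \<epsilon> \<Longrightarrow> prob {\<omega> \<in> space M. dist (err \<omega>) 0 > \<epsilon>}
      \<le> prob {\<omega> \<in> space M. graph_disc \<omega> > \<delta>} + prob {\<omega> \<in> space M. dist (average N (z 0 \<omega>)) (u 0) > \<delta>}"
proof -
  let ?S = "real CARD('s)"
  have avg: "(\<lambda>\<omega>. average N (z t \<omega>)) \<in> borel_measurable M" if "0 \<le> t" for t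
    unfolding average_def
    by (intro borel_measurable_scaleR borel_measurable_const borel_measurable_sum
        NIMFA_measurable[OF lip weighted_graph_adj adj_measurable z0 z that])
  have f: "norm1 (average N (z t \<omega>) - u t) \<le> 2 * ?S" if "\<omega> \<in> space M" "0 \<le> t" for t \<omega>
    using that N2 z[OF that(1)] u
    by (intro norm1_Delta_diff_le average_norm_le Delta_norm_le)
      (auto simp: NIMFA_solution_def mean_field_solution_def)
  show err: "err \<in> borel_measurable M"
    unfolding err_def
  proof (rule SUP_measurable[OF T, where B="2 * ?S"])
    show "(\<lambda>\<omega>. norm1 (average N (z t \<omega>) - u t)) \<in> borel_measurable M" if "t \<in> {0..T}" for t
    proof -
      have [measurable]: "(\<lambda>\<omega>. average N (z t \<omega>)) \<in> borel_measurable M"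
        using that by (intro avg) simp
      show ?thesis by measurable
    qed
  qed (use f NIMFA_continuous[OF z u] in auto)
  assume b: "NIMFA_bound C ?S T N \<delta> \<le> \<epsilon>"
  have [measurable]: "graph_disc \<in> borel_measurable M" "(\<lambda>\<omega>. average N (z 0 \<omega>)) \<in> borel_measurable M"
    using graph_disc_expectation(1) avg[of 0] by auto
  let ?D = "{\<omega> \<in> space M. graph_disc \<omega> > \<delta>}"
  let ?Y = "{\<omega> \<in> space M. dist (average N (z 0 \<omega>)) (u 0) > \<delta>}"
  have "{\<omega> \<in> space M. dist (err \<omega>) 0 > \<epsilon>} \<subseteq> ?D \<union> ?Y"
  proof (rule subsetI, rule ccontr)
    fix \<omega> assume "\<omega> \<in> {\<omega> \<in> space M. dist (err \<omega>) 0 > \<epsilon>}" and "\<omega> \<notin> ?D \<union> ?Y"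
    then have \<omega>: "\<omega> \<in> space M" and gt: "\<bar>err \<omega>\<bar> > \<epsilon>"
      and d: "weighted_graph.discrepancy N deg (adj \<omega>) \<le> \<delta>" "norm (average N (z 0 \<omega>) - u 0) \<le> \<delta>"
      by (auto simp: graph_disc_def dist_norm)
    have "err \<omega> \<le> NIMFA_bound C ?S T N \<delta>"
      unfolding err_def using T
      by (intro cSUP_least weighted_graph.NIMFA_average_close[OF weighted_graph_adj[OF \<omega>] Q z[OF \<omega>] u _ d]) auto
    moreover have "0 \<le> err \<omega>"
      unfolding err_def using f[OF \<omega>] by (intro SUP_nonneg[OF T, where B="2 * ?S"]) (auto simp: norm1_nonneg)
    ultimately show False using gt b by simp
  qed
  then have "prob {\<omega> \<in> space M. dist (err \<omega>) 0 > \<epsilon>} \<le> prob (?D \<union> ?Y)"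
    by (intro finite_measure_mono) measurable
  also have "\<dots> \<le> prob ?D + prob ?Y"
    by (intro measure_Un_le) measurable
  finally show "prob {\<omega> \<in> space M. dist (err \<omega>) 0 > \<epsilon>} \<le> prob ?D + prob ?Y" .
qed

section \<open>Limits in N and choice of the tolerance\<close>

lemma mf_error_limit: "(\<lambda>N. mf_error c N \<delta>) \<longlonglongrightarrow> c * sqrt \<delta> + \<delta>"
proof -
  have "(\<lambda>N. c * (sqrt \<delta> + 2 / real N) + \<delta>) \<longlonglongrightarrow> c * (sqrt \<delta> + 0) + \<delta>"
    by (intro tendsto_intros lim_const_over_n)
  then show ?thesis by (simp add: mf_error_def)
qed

lemma NIMFA_bound_limit:
  "(\<lambda>N. NIMFA_bound C c T N \<delta>) \<longlonglongrightarrow> c * (\<delta> + sqrt (exp (6 * C * T) * (4 * \<delta>\<^sup>2 + (c * sqrt \<delta> + \<delta>)\<^sup>2)))"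
  unfolding NIMFA_bound_def by (intro tendsto_intros mf_error_limit)

lemma mf_rate_limit: "(\<lambda>N. mf_rate C c N \<delta>) \<longlonglongrightarrow> 2 * C * (c * sqrt \<delta> + \<delta>)\<^sup>2"
proof -
  have "(\<lambda>N. 2 * C * (mf_error c N \<delta>)\<^sup>2 + 4 * c * C / real N) \<longlonglongrightarrow> 2 * C * (c * sqrt \<delta> + \<delta>)\<^sup>2 + 0"
    by (intro tendsto_intros mf_error_limit lim_const_over_n)
  then show ?thesis by (simp add: mf_rate_def)
qed

lemma small_positive_parameter:
  fixes \<Phi> :: "real \<Rightarrow> real"
  assumes "(\<Phi> \<longlongrightarrow> 0) (at_right 0)" "0 < \<kappa>" "0 < \<eta>"
  obtains \<delta> where "0 < \<delta>" "\<delta> \<le> \<eta>" "\<Phi> \<delta> < \<kappa>"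
proof -
  have "\<forall>\<^sub>F \<delta> in at_right 0. \<Phi> \<delta> < \<kappa>"
    using assms(1,2) by (rule order_tendstoD)
  moreover have "\<forall>\<^sub>F \<delta> in at_right 0. 0 < \<delta> \<and> \<delta> < \<eta>"
    using assms(3) by (auto simp: eventually_at_right)
  ultimately have "\<forall>\<^sub>F \<delta> in at_right 0. \<Phi> \<delta> < \<kappa> \<and> 0 < \<delta> \<and> \<delta> < \<eta>"
    by (rule eventually_conj)
  then have "\<exists>\<delta>. \<Phi> \<delta> < \<kappa> \<and> 0 < \<delta> \<and> \<delta> < \<eta>"
    by (rule eventually_happens'[OF trivial_limit_at_right_real])
  then show ?thesis using that by (auto intro: less_imp_le)
qed

text \<open>Encodes an iterated limit: \<open>q\<close> may depend on a parameter chosen for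
  \<open>\<kappa>\<close>, and its limit in \<open>N\<close> has to be below \<open>\<kappa>\<close>
  only.\<close>

lemma tendsto_0_by_bounds:
  fixes P :: "nat \<Rightarrow> real"
  assumes "\<And>N. 0 \<le> P N" "\<And>\<kappa>. 0 < \<kappa> \<Longrightarrow> \<exists>q l. q \<longlonglongrightarrow> l \<and> l < \<kappa> \<and> (\<forall>\<^sub>F N in sequentially. P N \<le> q N)"
  shows "P \<longlonglongrightarrow> 0"
proof (rule order_tendstoI)
  fix \<kappa> :: real assume "0 < \<kappa>"
  then obtain q l where q: "q \<longlonglongrightarrow> l" "l < \<kappa>" "\<forall>\<^sub>F N in sequentially. P N \<le> q N"
    using assms(2) by blast
  from order_tendstoD(2)[OF q(1,2)] q(3) show "\<forall>\<^sub>F N in sequentially. P N < \<kappa>"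
    by eventually_elim simp
next
  fix \<kappa> :: real assume "\<kappa> < 0"
  then show "\<forall>\<^sub>F N in sequentially. \<kappa> < P N"
    using assms(1) by (intro always_eventually allI) (meson less_le_trans)
qed

lemma degree_growth:
  fixes d :: "nat \<Rightarrow> real"
  assumes "0 < c" "0 < e" "\<And>N. 2 \<le> N \<Longrightarrow> c * real N powr (1 / 2 + e) \<le> d N"
  shows "(\<lambda>N. sqrt (real N) / d N) \<longlonglongrightarrow> 0"
proof (rule tendsto_sandwich[OF _ _ tendsto_const])
  have "(\<lambda>N. real N powr (- e)) \<longlonglongrightarrow> 0"
    using assms(2) by (intro tendsto_neg_powr filterlim_real_sequentially) simp
  then show "(\<lambda>N. inverse c * real N powr (- e)) \<longlonglongrightarrow> 0"
    using tendsto_mult[OF tendsto_const] by fastforce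
  have pos: "0 < d N" if "2 \<le> N" for N
    by (rule less_le_trans[OF _ assms(3)[OF that]]) (use that assms(1) in simp)
  show "\<forall>\<^sub>F N in sequentially. 0 \<le> sqrt (real N) / d N"
    using pos by (intro eventually_sequentiallyI[of 2]) (auto intro: less_imp_le)
  show "\<forall>\<^sub>F N in sequentially. sqrt (real N) / d N \<le> inverse c * real N powr (- e)"
  proof (rule eventually_sequentiallyI[of 2])
    fix N :: nat assume N: "2 \<le> N"
    have "sqrt (real N) / d N \<le> sqrt (real N) / (c * real N powr (1 / 2 + e))"
      using assms N pos[OF N] by (intro divide_left_mono) auto
    also have "\<dots> = inverse c * real N powr (- e)"
    proof -
      have "real N powr (1 / 2 + e) = sqrt (real N) * real N powr e"
        by (simp only: powr_add) (simp add: powr_half_sqrt)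
      then show ?thesis
        using N by (simp add: powr_minus divide_simps)
    qed
    finally show "sqrt (real N) / d N \<le> inverse c * real N powr (- e)" .
  qed
qed

theorem theorem2:
  fixes M :: "nat \<Rightarrow> 'w measure"
    and D :: "real measure"
    and p :: "nat \<Rightarrow> real"
    and w b :: "nat \<Rightarrow> nat \<Rightarrow> nat \<Rightarrow> 'w \<Rightarrow> real"
    and Q :: "real^'s \<Rightarrow> real^'s^'s"
    and X :: "nat \<Rightarrow> real \<Rightarrow> 'w \<Rightarrow> nat \<Rightarrow> 's"
    and z :: "nat \<Rightarrow> real \<Rightarrow> 'w \<Rightarrow> nat \<Rightarrow> real^'s"
    and u :: "real \<Rightarrow> real^'s"
    and T :: real
  defines "a \<equiv> \<lambda>N. edge_weight (w N) (b N)"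
    and "d \<equiv> \<lambda>N. mean_degree D (p N) N"
    and "x \<equiv> \<lambda>N t \<omega>. average N (state_indicator (X N t \<omega>))"
    and "y \<equiv> \<lambda>N t \<omega>. average N (z N t \<omega>)"
  assumes "\<And>N. 2 \<le> N \<Longrightarrow> prob_space (M N)"
    and "weight_law D"
    and "\<And>N. 2 \<le> N \<Longrightarrow> 0 < p N \<and> p N \<le> 1"
    and "\<And>N. 2 \<le> N \<Longrightarrow> weighted_ER (M N) D (p N) N (w N) (b N)"
    and "rate_function Q"
    and "\<And>k s. locally_lipschitz (\<lambda>\<phi>. Q \<phi> $ k $ s)"
    and "\<And>N. 2 \<le> N \<Longrightarrow> local_density_process (M N) Q N (d N) (a N) (X N)"
    and "\<And>N i. 2 \<le> N \<Longrightarrow> i \<in> {1..N} \<Longrightarrow> (\<lambda>\<omega>. z N 0 \<omega> i) \<in> borel_measurable (M N)"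
    and "\<And>N \<omega>. 2 \<le> N \<Longrightarrow> \<omega> \<in> space (M N) \<Longrightarrow>
           NIMFA_solution Q N (d N) (\<lambda>i j. a N i j \<omega>) (\<lambda>t. z N t \<omega>)"
    and "mean_field_solution Q u"
    and "tendsto_in_prob M (\<lambda>N. x N 0) (u 0)"
    and "tendsto_in_prob M (\<lambda>N. y N 0) (u 0)"
    and "((\<forall>k s. globally_lipschitz (\<lambda>\<phi>. Q \<phi> $ k $ s)) \<and>
            (\<exists>c>0. \<exists>\<epsilon>>0. \<forall>N\<ge>2. c * real N powr (1 / 2 + \<epsilon>) \<le> d N)) \<or>
         ((\<forall>N\<ge>2. p N = 1) \<and> (\<exists>s>0. integrable D (\<lambda>v. exp (s * v))))"
    and "0 < T"
  shows "tendsto_in_prob M (\<lambda>N \<omega>. SUP t\<in>{0..T}. norm1 (x N t \<omega> - u t)) 0 \<and>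
         tendsto_in_prob M (\<lambda>N \<omega>. SUP t\<in>{0..T}. norm1 (y N t \<omega> - u t)) 0"
proof -
  let ?S = "real CARD('s)"
  let ?\<mu> = "\<integral>v. v \<partial>D" and ?m2 = "\<integral>v. v\<^sup>2 \<partial>D"
  obtain C where C: "rate_bound Q 2 C"
    using rate_bound_exists[OF assms(10)] by blast
  have graph: "er_graph (M N) D (p N) N (w N) (b N)" if "2 \<le> N" for N
    using that assms(5-8) by (simp add: er_graph_def er_graph_axioms_def)
  have chain: "er_chain (M N) D (p N) N (w N) (b N) Q (X N) u C" if "2 \<le> N" for N
    using graph[OF that] assms(9,10,14) assms(11)[OF that] C
    by (simp add: er_chain_def er_chain_axioms_def a_def d_def)
  have \<mu>: "0 < ?\<mu>"
    using er_graph.\<mu>_pos[OF graph[of 2]] by simp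
  have "\<exists>c>0. \<exists>e>0. \<forall>N\<ge>2. c * real N powr (1 / 2 + e) \<le> d N"
    using assms(17)
  proof
    assume B: "(\<forall>N\<ge>2. p N = 1) \<and> (\<exists>s>0. integrable D (\<lambda>v. exp (s * v)))"
    \<comment> \<open>With \<open>p\<close> equal to 1 the mean degree is linear in
      \<open>N\<close>, and \<open>N - 1 \<ge> N / 2\<close>; so the growth condition holds with
      exponent \<open>1 / 2 + 1 / 2\<close>.\<close>
    have "?\<mu> / 2 * real N powr (1 / 2 + 1 / 2) \<le> d N" if "2 \<le> N" for N
      using that B \<mu> by (simp add: d_def mean_degree_def field_simps)
    then show ?thesis
      using \<mu> by (intro exI[of _ "?\<mu> / 2"] conjI exI[of _ "1 / 2"]) auto
  qed auto
  then have growth: "(\<lambda>N. sqrt (real N) / d N) \<longlonglongrightarrow> 0"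
    using degree_growth by blast
  define W where "W N = er_graph.graph_disc D (p N) N (w N) (b N)" for N
  define PW where "PW \<delta> N = measure (M N) {\<omega> \<in> space (M N). W N \<omega> > \<delta>}" for \<delta> N
  have PW: "PW \<delta> \<longlonglongrightarrow> 0" if \<delta>: "0 < \<delta>" for \<delta>
  proof (rule tendsto_sandwich[OF _ _ tendsto_const])
    show "\<forall>\<^sub>F N in sequentially. PW \<delta> N \<le> 4 * ?m2 / (?\<mu> * \<delta>) * (sqrt (real N) / d N)"
      unfolding PW_def W_def d_def
      using er_graph.prob_graph_disc_gt[OF graph \<delta>] by (intro eventually_sequentiallyI[of 2])
    show "(\<lambda>N. 4 * ?m2 / (?\<mu> * \<delta>) * (sqrt (real N) / d N)) \<longlonglongrightarrow> 0"
      by (rule tendsto_mult_right_zero[OF growth])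
  qed (simp add: PW_def)
  define PX where "PX \<delta> N = measure (M N) {\<omega> \<in> space (M N). dist (x N 0 \<omega>) (u 0) > \<delta>}" for \<delta> N
  define PY where "PY \<delta> N = measure (M N) {\<omega> \<in> space (M N). dist (y N 0 \<omega>) (u 0) > \<delta>}" for \<delta> N
  have PX: "PX \<delta> \<longlonglongrightarrow> 0" and PY: "PY \<delta> \<longlonglongrightarrow> 0" if "0 < \<delta>" for \<delta>
    using assms(15,16) that by (simp_all add: tendsto_in_prob_def PX_def[abs_def] PY_def[abs_def])
  let ?x = "\<lambda>N \<omega>. SUP t\<in>{0..T}. norm1 (x N t \<omega> - u t)"
  let ?y = "\<lambda>N \<omega>. SUP t\<in>{0..T}. norm1 (y N t \<omega> - u t)"
  have sqrt0: "(sqrt \<longlongrightarrow> 0) (at_right 0)"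
    using tendsto_real_sqrt[OF tendsto_ident_at[of 0 "{0<..}"]] by simp
  have "tendsto_in_prob M ?x 0"
    unfolding tendsto_in_prob_def
  proof (intro conjI allI impI)
    show "\<forall>\<^sub>F N in sequentially. ?x N \<in> borel_measurable (M N)"
      unfolding x_def
      by (intro eventually_sequentiallyI[of 2] er_chain.prob_sup_X(1)[OF chain \<open>0 < T\<close>, of _ 0 1]) auto
    fix \<epsilon> :: real assume \<epsilon>: "0 < \<epsilon>"
    \<comment> \<open>The second argument will be \<open>mf_rate\<close> at a finite
      \<open>N\<close> or its limit in \<open>N\<close>.\<close>
    let ?\<Psi> = "\<lambda>\<delta> r. exp (6 * C * T) * (4 * \<delta>\<^sup>2 + T * r) / (\<epsilon> / (2 * ?S))\<^sup>2"
    show "(\<lambda>N. measure (M N) {\<omega> \<in> space (M N). \<epsilon> < dist (?x N \<omega>) 0}) \<longlonglongrightarrow> 0"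
    proof (rule tendsto_0_by_bounds)
      fix \<kappa> :: real assume "0 < \<kappa>"
      \<comment> \<open>The limit in \<open>N\<close> of the bound vanishes as
        \<open>\<delta>\<close> tends to 0; this fixes \<open>\<delta>\<close> before
        \<open>N\<close> grows.\<close>
      have "((\<lambda>\<delta>. ?\<Psi> \<delta> (2 * C * (?S * sqrt \<delta> + \<delta>)\<^sup>2)) \<longlongrightarrow> ?\<Psi> 0 (2 * C * (?S * 0 + 0)\<^sup>2)) (at_right 0)"
        using \<epsilon> by (intro tendsto_intros sqrt0) auto
      then have "((\<lambda>\<delta>. ?\<Psi> \<delta> (2 * C * (?S * sqrt \<delta> + \<delta>)\<^sup>2)) \<longlongrightarrow> 0) (at_right 0)"
        by simp
      then obtain \<delta> where \<delta>: "0 < \<delta>" "\<delta> \<le> \<epsilon> / (2 * ?S)" "?\<Psi> \<delta> (2 * C * (?S * sqrt \<delta> + \<delta>)\<^sup>2) < \<kappa>"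
        using \<open>0 < \<kappa>\<close> \<epsilon> by (elim small_positive_parameter[of _ \<kappa> "\<epsilon> / (2 * ?S)"]) auto
      have "(\<lambda>N. ?\<Psi> \<delta> (mf_rate C ?S N \<delta>) + 2 * PW \<delta> N + PX \<delta> N)
          \<longlonglongrightarrow> ?\<Psi> \<delta> (2 * C * (?S * sqrt \<delta> + \<delta>)\<^sup>2) + 2 * 0 + 0"
        using \<epsilon> by (intro tendsto_intros mf_rate_limit PW PX \<delta>(1)) auto
      moreover have "\<forall>\<^sub>F N in sequentially. measure (M N) {\<omega> \<in> space (M N). \<epsilon> < dist (?x N \<omega>) 0}
          \<le> ?\<Psi> \<delta> (mf_rate C ?S N \<delta>) + 2 * PW \<delta> N + PX \<delta> N"
        unfolding PW_def PX_def W_def x_def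
        using \<delta> by (intro eventually_sequentiallyI[of 2] er_chain.prob_sup_X(2)[OF chain \<open>0 < T\<close> _ \<epsilon>])
          (auto simp: field_simps)
      ultimately show "\<exists>q l. q \<longlonglongrightarrow> l \<and> l < \<kappa> \<and>
          (\<forall>\<^sub>F N in sequentially. measure (M N) {\<omega> \<in> space (M N). \<epsilon> < dist (?x N \<omega>) 0} \<le> q N)"
        using \<delta>(3) by fastforce
    qed simp
  qed
  moreover have "tendsto_in_prob M ?y 0"
    unfolding tendsto_in_prob_def
  proof (intro conjI allI impI)
    note nimfa = er_graph.prob_sup_NIMFA[OF graph assms(10) C assms(14) assms(12)
        assms(13)[unfolded a_def d_def] \<open>0 < T\<close>]
    show "\<forall>\<^sub>F N in sequentially. ?y N \<in> borel_measurable (M N)"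
      unfolding y_def by (intro eventually_sequentiallyI[of 2] nimfa(1)) auto
    fix \<epsilon> :: real assume \<epsilon>: "0 < \<epsilon>"
    show "(\<lambda>N. measure (M N) {\<omega> \<in> space (M N). \<epsilon> < dist (?y N \<omega>) 0}) \<longlonglongrightarrow> 0"
    proof (rule tendsto_0_by_bounds)
      fix \<kappa> :: real assume "0 < \<kappa>"
      let ?\<Psi> = "\<lambda>\<delta> s. ?S * (\<delta> + sqrt (exp (6 * C * T) * (4 * \<delta>\<^sup>2 + (?S * s + \<delta>)\<^sup>2)))"
      have "((\<lambda>\<delta>. ?\<Psi> \<delta> (sqrt \<delta>)) \<longlongrightarrow> ?\<Psi> 0 0) (at_right 0)"
        by (intro tendsto_intros sqrt0)
      then have "((\<lambda>\<delta>. ?\<Psi> \<delta> (sqrt \<delta>)) \<longlongrightarrow> 0) (at_right 0)" by simp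
      \<comment> \<open>The NIMFA bound is pathwise, so \<open>\<delta>\<close> has to be chosen for
        \<open>\<epsilon>\<close> only; the two remaining probabilities tend to 0 and meet any
        \<open>\<kappa>\<close>.\<close>
      then obtain \<delta> where \<delta>: "0 < \<delta>" "?\<Psi> \<delta> (sqrt \<delta>) < \<epsilon>"
        using \<epsilon> by (elim small_positive_parameter[of _ \<epsilon> 1]) auto
      have "(\<lambda>N. PW \<delta> N + PY \<delta> N) \<longlonglongrightarrow> 0 + 0"
        by (intro tendsto_intros PW PY \<delta>(1))
      moreover have "\<forall>\<^sub>F N in sequentially. measure (M N) {\<omega> \<in> space (M N). \<epsilon> < dist (?y N \<omega>) 0}
          \<le> PW \<delta> N + PY \<delta> N"
        using order_tendstoD(2)[OF NIMFA_bound_limit \<delta>(2)] eventually_ge_at_top[of 2]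
      proof eventually_elim
        case (elim N)
        then show ?case
          unfolding PW_def PY_def W_def y_def by (intro nimfa(2)) auto
      qed
      ultimately show "\<exists>q l. q \<longlonglongrightarrow> l \<and> l < \<kappa> \<and>
          (\<forall>\<^sub>F N in sequentially. measure (M N) {\<omega> \<in> space (M N). \<epsilon> < dist (?y N \<omega>) 0} \<le> q N)"
        using \<open>0 < \<kappa>\<close> by fastforce
    qed simp
  qed
  ultimately show ?thesis ..
qed

end
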